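(* Let $n\ge1$ and $1\le a\le\lfloor\frac n2\rfloor$. If $n$ is odd, or $n$ is even and $a<\frac n2$, define $$T_a=h_{2a}(x_1,\cdots,x_{n-2a})\,h_{2a-1}(x_1,\cdots,x_{n-2a+1})+u(x_1,\cdots,x_{n-2a}),$$ where $u$ satisfies $Sq^2(u)=h_{2a}(x_1,\cdots,x_{n-2a})^2$. If $n$ is even, define $T_{\frac n2}=x_1^{n-1}$. Then $$E^{*}(Fl(F^{\oplus n}))=\wedge[\{T_a\}],$$ the exterior algebra on the classes $T_a$, $1\le a\le\lfloor\frac n2\rfloor$.
   Context: $F$ is an infinite perfect field with $char(F)\ne2$, $Ch^*=CH^*/2$. $Fl(F^{\oplus n})$ is the variety of complete flags of $F^{\oplus n}$, constructed as a tower: $p_1:Y_1=\mathbb{P}(F^{\oplus n})\to pt$ and inductively $p_i:Y_i=\mathbb{P}(\Omega_{p_{i-1}}(1))\to Y_{i-1}$, where $\Omega_{p}(1)$ is the kernel of the tautological surjection $p^*\mathscr{V}\to O_{\mathscr{V}}(1)$ on $p:\mathbb{P}(\mathscr{V})\to Y$; $Fl(F^{\oplus n})=Y_{n-1}$. For $1\le i\le n-1$, $x_i$ is (the pullback of) the first Chern class of the tautological quotient line bundle on $Y_i$, and $x_n$ is that of the complementary line bundle on $Y_{n-1}$; so the $x_i$ are the first Chern classes of the successive quotient line bundles of the flag, and $Ch^*(Fl(F^{\oplus n}))=\mathbb{Z}/2[x_1,\ldots,x_n]/\mathcal{S}$, where $\mathcal{S}$ is the ideal generated by the (positive degree) symmetric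 functions. $Sq^2:Ch^i\to Ch^{i+1}$ is the Steenrod square, the derivation with $Sq^2(x_i)=x_i^2$. $h_i(x_1,\ldots,x_j)$ is the complete homogeneous symmetric polynomial of degree $i$. $u$ is any class in $Ch^{4a-1}$ expressed as a polynomial in $x_1,\ldots,x_{n-2a}$ satisfying the stated equation (in $Ch^{4a}$). For $X\in Sm/F$, $E^i(X)=Ker(Sq^2:Ch^i(X)\to Ch^{i+1}(X))/Im(Sq^2:Ch^{i-1}(X)\to Ch^i(X))$, and $E^*(X)=\bigoplus_iE^i(X)$ is a graded $\mathbb{Z}/2$-algebra under the product induced from $Ch^*(X)$. The exterior algebra is over $\mathbb{Z}/2$ (with $T_a^2=0$). *)

theory Defs
  imports "HOL-Combinatorics.Permutations" "HOL-Algebra.QuotRing" "HOL-Algebra.Product_Groups" "HOL-Library.Poly_Mapping" "HOL-Library.Z2"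
begin

section \<open>Polynomials over the field with two elements\<close>

text \<open>A monomial is a finitely supported exponent function, a polynomial a finitely supported
  family of coefficients in \<^typ>\<open>bit\<close>. The type has the variables $x_i$ for all \<open>i :: nat\<close>;
  $x_1, \ldots, x_n$ are singled out by the carrier \<open>polys n\<close>.\<close>

type_synonym monom = "nat \<Rightarrow>\<^sub>0 nat"
type_synonym mpoly2 = "monom \<Rightarrow>\<^sub>0 bit"

definition pvar :: "nat \<Rightarrow> mpoly2" where
  "pvar i = Poly_Mapping.single (Poly_Mapping.single i 1) 1"

definition polys :: "nat \<Rightarrow> mpoly2 set" where
  "polys n = {p. \<forall>m\<in>Poly_Mapping.keys p. Poly_Mapping.keys m \<subseteq> {1..n}}"

definition mdeg :: "monom \<Rightarrow> nat" where
  "mdeg m = (\<Sum>i\<in>Poly_Mapping.keys m. Poly_Mapping.lookup m i)"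

definition homog :: "nat \<Rightarrow> mpoly2 \<Rightarrow> bool" where
  "homog d p \<longleftrightarrow> (\<forall>m\<in>Poly_Mapping.keys p. mdeg m = d)"

definition poly_ring :: "nat \<Rightarrow> mpoly2 ring" where
  "poly_ring n = \<lparr>carrier = polys n, mult = (*), one = 1, zero = 0, add = (+)\<rparr>"

definition complete_h :: "nat \<Rightarrow> nat \<Rightarrow> mpoly2" where
  "complete_h d j =
     (\<Sum>e\<in>{e \<in> {1..j} \<rightarrow>\<^sub>E {0..d}. (\<Sum>i=1..j. e i) = d}. \<Prod>i=1..j. pvar i ^ e i)"


section \<open>The Chow ring modulo 2 of the variety of complete flags\<close>

definition symmetric_poly :: "nat \<Rightarrow> mpoly2 \<Rightarrow> bool" where
  "symmetric_poly n p \<longleftrightarrow> (\<forall>\<pi>. \<pi> permutes {1..n} \<longrightarrow>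
     (\<forall>m. Poly_Mapping.lookup p (Poly_Mapping.map_key \<pi> m) = Poly_Mapping.lookup p m))"

definition sym_ideal :: "nat \<Rightarrow> mpoly2 set" where
  "sym_ideal n =
     Idl\<^bsub>poly_ring n\<^esub> {p \<in> polys n. symmetric_poly n p \<and> (\<exists>d>0. homog d p)}"

text \<open>The ring $Ch^*(Fl(F^{\oplus n}))$ in its presentation
  $\mathbb{Z}/2[x_1, \ldots, x_n]/\mathcal{S}$, which does not depend on the base field $F$; \<open>cls n p\<close>
  is the class of the polynomial \<open>p\<close>.\<close>

definition Ch_Fl :: "nat \<Rightarrow> mpoly2 set ring" where
  "Ch_Fl n = poly_ring n Quot sym_ideal n"

definition cls :: "nat \<Rightarrow> mpoly2 \<Rightarrow> mpoly2 set" where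
  "cls n p = sym_ideal n +>\<^bsub>poly_ring n\<^esub> p"

definition Ch_Fl_deg :: "nat \<Rightarrow> nat \<Rightarrow> mpoly2 set set" where
  "Ch_Fl_deg n i = cls n ` {p \<in> polys n. homog i p}"

text \<open>The derivation $\sum_i x_i^2\, \partial/\partial x_i$, that is, the derivation with
  $x_i \mapsto x_i^2$, written out on coefficients, and the map it induces on the quotient. That it
  is this derivation and descends is shown in \<open>sq2_poly_mult\<close>, \<open>sq2_poly_pvar\<close> and \<open>sq2_cls\<close> below.\<close>

definition sq2_poly :: "mpoly2 \<Rightarrow> mpoly2" where
  "sq2_poly p = (\<Sum>m\<in>Poly_Mapping.keys p. \<Sum>i\<in>Poly_Mapping.keys m.
     Poly_Mapping.single (m + Poly_Mapping.single i 1)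
       (Poly_Mapping.lookup p m * of_nat (Poly_Mapping.lookup m i)))"

definition sq2 :: "nat \<Rightarrow> mpoly2 set \<Rightarrow> mpoly2 set" where
  "sq2 n C = (\<Union>p\<in>C. cls n (sq2_poly p))"


subsection \<open>The induced map is a well-defined derivation\<close>

lemma sq2_poly_superset:
  assumes "finite A" "Poly_Mapping.keys p \<subseteq> A"
  shows "sq2_poly p = (\<Sum>m\<in>A. \<Sum>i\<in>Poly_Mapping.keys m.
     Poly_Mapping.single (m + Poly_Mapping.single i 1)
       (Poly_Mapping.lookup p m * of_nat (Poly_Mapping.lookup m i)))"
  unfolding sq2_poly_def
  by (rule sum.mono_neutral_left) (use assms in \<open>auto simp: in_keys_iff\<close>)

lemma sq2_poly_add: "sq2_poly (p + q) = sq2_poly p + sq2_poly q"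
proof -
  let ?A = "Poly_Mapping.keys p \<union> Poly_Mapping.keys q"
  have "finite ?A" "Poly_Mapping.keys p \<subseteq> ?A" "Poly_Mapping.keys q \<subseteq> ?A"
    "Poly_Mapping.keys (p + q) \<subseteq> ?A"
    using Poly_Mapping.keys_add[of p q] by auto
  then show ?thesis
    by (simp only: sq2_poly_superset[of ?A] lookup_add distrib_right single_add sum.distrib)
qed

lemma sq2_poly_0 [simp]: "sq2_poly 0 = 0"
  by (simp add: sq2_poly_def)

lemma sq2_poly_sum: "sq2_poly (sum f A) = (\<Sum>a\<in>A. sq2_poly (f a))"
  by (induction A rule: infinite_finite_induct) (simp_all add: sq2_poly_add)

lemma sq2_poly_single:
  assumes "finite A" "Poly_Mapping.keys m \<subseteq> A"
  shows "sq2_poly (Poly_Mapping.single m c) = (\<Sum>i\<in>A.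
     Poly_Mapping.single (m + Poly_Mapping.single i 1) (c * of_nat (Poly_Mapping.lookup m i)))"
proof -
  have "sq2_poly (Poly_Mapping.single m c) = (\<Sum>i\<in>Poly_Mapping.keys m.
     Poly_Mapping.single (m + Poly_Mapping.single i 1) (c * of_nat (Poly_Mapping.lookup m i)))"
    by (subst sq2_poly_superset[of "{m}"]) auto
  also have "\<dots> = (\<Sum>i\<in>A.
     Poly_Mapping.single (m + Poly_Mapping.single i 1) (c * of_nat (Poly_Mapping.lookup m i)))"
    by (rule sum.mono_neutral_left) (use assms in \<open>auto simp: in_keys_iff\<close>)
  finally show ?thesis .
qed

lemma sq2_poly_pvar: "sq2_poly (pvar i) = pvar i ^ 2"
  unfolding pvar_def
  by (subst sq2_poly_single[of "{i}"]) (auto simp: power2_eq_square mult_single)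

lemma mpoly2_eq_sum:
  fixes p :: mpoly2
  shows "p = (\<Sum>m\<in>Poly_Mapping.keys p. Poly_Mapping.single m (Poly_Mapping.lookup p m))"
proof (rule poly_mapping_eqI)
  fix k
  show "Poly_Mapping.lookup p k = Poly_Mapping.lookup
    (\<Sum>m\<in>Poly_Mapping.keys p. Poly_Mapping.single m (Poly_Mapping.lookup p m)) k"
    by (auto simp: lookup_sum lookup_single when_def in_keys_iff)
qed

lemma sq2_poly_mult_single:
  "sq2_poly (Poly_Mapping.single m a * Poly_Mapping.single l b) =
     sq2_poly (Poly_Mapping.single m a) * Poly_Mapping.single l b
     + Poly_Mapping.single m a * sq2_poly (Poly_Mapping.single l b)"
proof -
  let ?A = "Poly_Mapping.keys m \<union> Poly_Mapping.keys l"
  have A: "finite ?A" "Poly_Mapping.keys m \<subseteq> ?A" "Poly_Mapping.keys l \<subseteq> ?A"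
    "Poly_Mapping.keys (m + l) \<subseteq> ?A"
    using Poly_Mapping.keys_add[of m l] by auto
  show ?thesis
    unfolding mult_single sq2_poly_single[OF A(1) A(4)] sq2_poly_single[OF A(1) A(2)]
      sq2_poly_single[OF A(1) A(3)] sum_distrib_left sum_distrib_right sum.distrib[symmetric]
    by (rule sum.cong[OF refl])
      (simp only: lookup_add of_nat_add distrib_left single_add ac_simps)
qed

lemma sq2_poly_mult: "sq2_poly (p * q) = sq2_poly p * q + p * sq2_poly q"
proof -
  let ?s = "\<lambda>p m. Poly_Mapping.single m (Poly_Mapping.lookup p m) :: mpoly2"
  let ?K = "Poly_Mapping.keys p" and ?L = "Poly_Mapping.keys q"
  have "sq2_poly (sum (?s p) ?K * sum (?s q) ?L) =
      sq2_poly (sum (?s p) ?K) * sum (?s q) ?L + sum (?s p) ?K * sq2_poly (sum (?s q) ?L)"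
    by (simp only: sum_product sq2_poly_sum sq2_poly_mult_single sum.distrib)
  then show ?thesis
    using mpoly2_eq_sum[of p] mpoly2_eq_sum[of q] by simp
qed

lemma polys_add: "p \<in> polys n \<Longrightarrow> q \<in> polys n \<Longrightarrow> p + q \<in> polys n"
  using Poly_Mapping.keys_add[of p q] unfolding polys_def by blast

lemma polys_mult:
  assumes "p \<in> polys n" "q \<in> polys n"
  shows "p * q \<in> polys n"
proof -
  have "Poly_Mapping.keys m \<subseteq> {1..n}" if m: "m \<in> Poly_Mapping.keys (p * q)" for m
  proof -
    obtain a b where "m = a + b" "a \<in> Poly_Mapping.keys p" "b \<in> Poly_Mapping.keys q"
      using keys_mult[of p q] m by blast
    with assms show ?thesis
      using Poly_Mapping.keys_add[of a b] unfolding polys_def by blast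
  qed
  then show ?thesis by (simp add: polys_def)
qed

lemma mpoly2_uminus [simp]: "- (p :: mpoly2) = p"
  by (rule poly_mapping_eqI) simp

lemma poly_ring_cring: "cring (poly_ring n)"
proof (rule cringI)
  show "abelian_group (poly_ring n)"
  proof (rule abelian_groupI)
    fix x assume "x \<in> carrier (poly_ring n)"
    then show "\<exists>y\<in>carrier (poly_ring n). y \<oplus>\<^bsub>poly_ring n\<^esub> x = \<zero>\<^bsub>poly_ring n\<^esub>"
      using add.left_inverse[of x] by (intro bexI[of _ x]) (auto simp: poly_ring_def)
  qed (auto simp: poly_ring_def polys_add ac_simps, simp add: polys_def)
  show "comm_monoid (poly_ring n)"
    by (rule comm_monoidI) (auto simp: poly_ring_def polys_mult ac_simps, simp add: polys_def)
qed (auto simp: poly_ring_def distrib_right)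

lemma sym_ideal_gens_subset:
  "{p \<in> polys n. symmetric_poly n p \<and> (\<exists>d>0. homog d p)} \<subseteq> carrier (poly_ring n)"
  by (auto simp: poly_ring_def)

lemma sym_ideal_ideal: "ideal (sym_ideal n) (poly_ring n)"
proof -
  interpret cring "poly_ring n" by (rule poly_ring_cring)
  show ?thesis unfolding sym_ideal_def by (rule genideal_ideal[OF sym_ideal_gens_subset])
qed

lemma lookup_sq2_poly:
  "Poly_Mapping.lookup (sq2_poly p) k = (\<Sum>i\<in>Poly_Mapping.keys k.
     Poly_Mapping.lookup p (k - Poly_Mapping.single i 1)
       * of_nat (Poly_Mapping.lookup k i - 1))" (is "?l p = ?r p")
proof -
  have *: "?l (Poly_Mapping.single m c) = ?r (Poly_Mapping.single m c)" for m c
  proof -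
    let ?A = "Poly_Mapping.keys m \<union> Poly_Mapping.keys k"
    have eq: "Poly_Mapping.lookup
        (Poly_Mapping.single (m + Poly_Mapping.single i 1) (c * of_nat (Poly_Mapping.lookup m i))) k
      = (if i \<in> Poly_Mapping.keys k then
         Poly_Mapping.lookup (Poly_Mapping.single m c) (k - Poly_Mapping.single i 1)
         * of_nat (Poly_Mapping.lookup k i - 1) else 0)" (is "?a = ?b") for i
    proof (cases "m + Poly_Mapping.single i 1 = k")
      case True
      then have "m = k - Poly_Mapping.single i 1" by auto
      moreover have "i \<in> Poly_Mapping.keys k"
        unfolding True[symmetric] by (simp add: in_keys_iff lookup_add)
      moreover have "Poly_Mapping.lookup k i - 1 = Poly_Mapping.lookup m i"
        unfolding True[symmetric] by (simp add: lookup_add)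
      ultimately show ?thesis using True by (simp add: lookup_single)
    next
      case False
      have "m \<noteq> k - Poly_Mapping.single i 1" if "i \<in> Poly_Mapping.keys k"
      proof
        assume m: "m = k - Poly_Mapping.single i 1"
        have "m + Poly_Mapping.single i 1 = k"
          unfolding m using that
          by (intro poly_mapping_eqI)
            (auto simp: lookup_add lookup_minus lookup_single when_def in_keys_iff)
        with False show False by simp
      qed
      with False show ?thesis by (auto simp: lookup_single when_def)
    qed
    have "?l (Poly_Mapping.single m c) = (\<Sum>i\<in>?A. Poly_Mapping.lookup
        (Poly_Mapping.single (m + Poly_Mapping.single i 1) (c * of_nat (Poly_Mapping.lookup m i))) k)"
      by (subst sq2_poly_single[of ?A]) (auto simp: lookup_sum)
    also have "\<dots> = ?r (Poly_Mapping.single m c)"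
      unfolding eq by (rule sum.mono_neutral_cong_right) auto
    finally show ?thesis .
  qed
  have "?l (\<Sum>m\<in>Poly_Mapping.keys p. Poly_Mapping.single m (Poly_Mapping.lookup p m)) =
    ?r (\<Sum>m\<in>Poly_Mapping.keys p. Poly_Mapping.single m (Poly_Mapping.lookup p m))"
    unfolding sq2_poly_sum lookup_sum * sum_distrib_right by (rule sum.swap)
  then show ?thesis using mpoly2_eq_sum[of p] by simp
qed

lemma symmetric_sq2_poly:
  assumes "symmetric_poly n p"
  shows "symmetric_poly n (sq2_poly p)"
  unfolding symmetric_poly_def
proof (intro allI impI)
  fix \<pi> and m :: monom assume \<pi>: "\<pi> permutes {1..n}"
  have inj: "inj \<pi>" using \<pi> by (rule permutes_inj)
  have surj: "surj \<pi>" using \<pi> by (rule permutes_surj)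
  have bij: "bij_betw \<pi> (\<pi> -` Poly_Mapping.keys m) (Poly_Mapping.keys m)"
    unfolding bij_betw_def using inj surj by (auto simp: inj_on_def surj_image_vimage_eq)
  have *: "Poly_Mapping.map_key \<pi> m - Poly_Mapping.single i 1
      = Poly_Mapping.map_key \<pi> (m - Poly_Mapping.single (\<pi> i) 1)" for i
    by (rule poly_mapping_eqI)
      (use inj in \<open>auto simp: lookup_minus map_key.rep_eq lookup_single when_def inj_eq\<close>)
  have "Poly_Mapping.lookup (sq2_poly p) (Poly_Mapping.map_key \<pi> m) =
    (\<Sum>i\<in>\<pi> -` Poly_Mapping.keys m.
     Poly_Mapping.lookup p (m - Poly_Mapping.single (\<pi> i) 1)
       * of_nat (Poly_Mapping.lookup m (\<pi> i) - 1))"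
    unfolding lookup_sq2_poly keys_map_key[OF inj] *
    using assms \<pi> by (simp add: symmetric_poly_def map_key.rep_eq inj)
  also have "\<dots> = Poly_Mapping.lookup (sq2_poly p) m"
    unfolding lookup_sq2_poly by (rule sum.reindex_bij_betw[OF bij])
  finally show "Poly_Mapping.lookup (sq2_poly p) (Poly_Mapping.map_key \<pi> m)
    = Poly_Mapping.lookup (sq2_poly p) m" .
qed

lemma mdeg_superset:
  assumes "finite A" "Poly_Mapping.keys m \<subseteq> A"
  shows "mdeg m = (\<Sum>i\<in>A. Poly_Mapping.lookup m i)"
  unfolding mdeg_def by (rule sum.mono_neutral_left) (use assms in \<open>auto simp: in_keys_iff\<close>)

lemma keys_sq2_poly:
  assumes "k \<in> Poly_Mapping.keys (sq2_poly p)"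
  obtains m i where "m \<in> Poly_Mapping.keys p" "i \<in> Poly_Mapping.keys m"
    "k = m + Poly_Mapping.single i 1"
proof -
  have "\<exists>m\<in>Poly_Mapping.keys p. \<exists>i\<in>Poly_Mapping.keys m. Poly_Mapping.lookup
      (Poly_Mapping.single (m + Poly_Mapping.single i 1)
       (Poly_Mapping.lookup p m * of_nat (Poly_Mapping.lookup m i))) k \<noteq> 0"
    using assms unfolding in_keys_iff sq2_poly_def lookup_sum
    by (meson sum.not_neutral_contains_not_neutral)
  then show ?thesis using that by (auto simp: lookup_single when_def split: if_splits)
qed

lemma homog_sq2_poly:
  assumes "homog d p"
  shows "homog (Suc d) (sq2_poly p)"
  unfolding homog_def
proof
  fix k assume "k \<in> Poly_Mapping.keys (sq2_poly p)"
  then obtain m i where m: "m \<in> Poly_Mapping.keys p" "i \<in> Poly_Mapping.keys m"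
    and k: "k = m + Poly_Mapping.single i 1" by (rule keys_sq2_poly)
  have "Poly_Mapping.keys k \<subseteq> Poly_Mapping.keys m"
    using Poly_Mapping.keys_add[of m "Poly_Mapping.single i 1"] m k by auto
  then have "mdeg k = (\<Sum>j\<in>Poly_Mapping.keys m. Poly_Mapping.lookup k j)"
    by (intro mdeg_superset) auto
  also have "\<dots> = Suc (mdeg m)"
    using m by (simp add: k lookup_add sum.distrib mdeg_def lookup_single when_def)
  finally show "mdeg k = Suc d" using assms m by (simp add: homog_def)
qed

lemma polys_sq2_poly:
  assumes "p \<in> polys n"
  shows "sq2_poly p \<in> polys n"
proof -
  have "Poly_Mapping.keys k \<subseteq> {1..n}" if "k \<in> Poly_Mapping.keys (sq2_poly p)" for k
    using that
  proof (rule keys_sq2_poly)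
    fix m i assume "m \<in> Poly_Mapping.keys p" "i \<in> Poly_Mapping.keys m"
      "k = m + Poly_Mapping.single i 1"
    then show ?thesis
      using assms Poly_Mapping.keys_add[of m "Poly_Mapping.single i 1"]
      by (auto simp: polys_def)
  qed
  then show ?thesis by (simp add: polys_def)
qed

lemma sq2_poly_sym_ideal:
  assumes "p \<in> sym_ideal n"
  shows "sq2_poly p \<in> sym_ideal n"
proof -
  interpret R: cring "poly_ring n" by (rule poly_ring_cring)
  interpret S: ideal "sym_ideal n" "poly_ring n" by (rule sym_ideal_ideal)
  let ?J = "{p \<in> sym_ideal n. sq2_poly p \<in> sym_ideal n}"
  have [simp]: "a + b \<in> sym_ideal n" if "a \<in> sym_ideal n" "b \<in> sym_ideal n" for a b
    using S.a_closed[OF that] by (simp add: poly_ring_def)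
  have [simp]: "a * b \<in> sym_ideal n" "b * a \<in> sym_ideal n" if "a \<in> sym_ideal n" "b \<in> polys n" for a b
    using S.I_l_closed[of a b] S.I_r_closed[of a b] that by (simp_all add: poly_ring_def)
  have sub: "sym_ideal n \<subseteq> polys n"
    using S.a_subset by (simp add: poly_ring_def)
  have "ideal ?J (poly_ring n)"
  proof (rule idealI)
    show "ring (poly_ring n)" by (rule R.ring_axioms)
    show "subgroup ?J (add_monoid (poly_ring n))"
    proof (rule group.subgroupI)
      show "group (add_monoid (poly_ring n))" by (rule R.a_group)
      show "?J \<subseteq> carrier (add_monoid (poly_ring n))"
        using sub by (auto simp: poly_ring_def)
      have "0 \<in> sym_ideal n" using S.zero_closed by (simp add: poly_ring_def)
      then show "?J \<noteq> {}" by (auto intro!: exI[of _ 0])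
      fix a b assume ab: "a \<in> ?J" "b \<in> ?J"
      then show "a \<otimes>\<^bsub>add_monoid (poly_ring n)\<^esub> b \<in> ?J"
        by (simp add: poly_ring_def sq2_poly_add)
    next
      fix a assume a: "a \<in> ?J"
      have "inv\<^bsub>add_monoid (poly_ring n)\<^esub> a = a"
        using a sub add.left_inverse[of a]
        by (intro group.inv_equality[OF R.a_group]) (auto simp: poly_ring_def)
      with a show "inv\<^bsub>add_monoid (poly_ring n)\<^esub> a \<in> ?J" by simp
    qed
  qed (use sub polys_sq2_poly in \<open>auto simp: poly_ring_def sq2_poly_mult\<close>)
  moreover have "{p \<in> polys n. symmetric_poly n p \<and> (\<exists>d>0. homog d p)} \<subseteq> ?J"
  proof -
    have gen: "q \<in> sym_ideal n" if "q \<in> polys n" "symmetric_poly n q" "homog d q" "d > 0" for q d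
      using R.genideal_self[OF sym_ideal_gens_subset] that unfolding sym_ideal_def by blast
    show ?thesis
      using gen polys_sq2_poly symmetric_sq2_poly homog_sq2_poly
      by (auto, metis zero_less_Suc)
  qed
  ultimately have "sym_ideal n \<subseteq> ?J"
    unfolding sym_ideal_def by (rule R.genideal_minimal)
  with assms show ?thesis by blast
qed

lemma sq2_cls:
  assumes "p \<in> polys n"
  shows "sq2 n (cls n p) = cls n (sq2_poly p)"
proof -
  interpret R: cring "poly_ring n" by (rule poly_ring_cring)
  interpret S: ideal "sym_ideal n" "poly_ring n" by (rule sym_ideal_ideal)
  have cls: "cls n q = {s + q | s. s \<in> sym_ideal n}" for q
    by (auto simp: cls_def a_r_coset_def r_coset_def poly_ring_def)
  have "0 \<in> sym_ideal n" using S.zero_closed by (simp add: poly_ring_def)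
  then have "cls n p \<noteq> {}" by (auto simp: cls)
  moreover have "cls n (sq2_poly q) = cls n (sq2_poly p)" if q: "q \<in> cls n p" for q
  proof -
    obtain s where s: "s \<in> sym_ideal n" "q = s + p" using q by (auto simp: cls)
    have "sq2_poly q \<in> cls n (sq2_poly p)"
      using s sq2_poly_sym_ideal by (auto simp: cls sq2_poly_add)
    then show ?thesis
      unfolding cls_def
      by (intro R.a_repr_independence[symmetric])
        (use polys_sq2_poly[OF assms] S.a_subgroup in \<open>auto simp: poly_ring_def\<close>)
  qed
  ultimately show ?thesis unfolding sq2_def by auto
qed


section \<open>The graded ring \<open>E\<^sup>*\<close>\<close>

text \<open>Here \<open>R\<close> is a commutative ring with homogeneous pieces \<open>gr i\<close> and \<open>d\<close> an additive map raising
  degrees by one. The quotient groups \<open>E_group R gr d i\<close> are written multiplicatively, as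
  \<^const>\<open>FactGroup\<close> and \<^const>\<open>sum_group\<close> require.\<close>

definition cycles ::
  "('a, 'b) ring_scheme \<Rightarrow> (nat \<Rightarrow> 'a set) \<Rightarrow> ('a \<Rightarrow> 'a) \<Rightarrow> nat \<Rightarrow> 'a set" where
  "cycles R gr d i = {c \<in> gr i. d c = \<zero>\<^bsub>R\<^esub>}"

definition boundaries ::
  "('a, 'b) ring_scheme \<Rightarrow> (nat \<Rightarrow> 'a set) \<Rightarrow> ('a \<Rightarrow> 'a) \<Rightarrow> nat \<Rightarrow> 'a set" where
  "boundaries R gr d i = (case i of 0 \<Rightarrow> {\<zero>\<^bsub>R\<^esub>} | Suc j \<Rightarrow> d ` gr j)"

definition E_group ::
  "('a, 'b) ring_scheme \<Rightarrow> (nat \<Rightarrow> 'a set) \<Rightarrow> ('a \<Rightarrow> 'a) \<Rightarrow> nat \<Rightarrow> 'a set monoid" where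
  "E_group R gr d i =
     \<lparr>carrier = cycles R gr d i, mult = add R, one = \<zero>\<^bsub>R\<^esub>\<rparr> Mod boundaries R gr d i"

text \<open>The class of a cycle \<open>c\<close> of degree \<open>i\<close>, as an element of the direct sum.\<close>

definition E_class ::
  "('a, 'b) ring_scheme \<Rightarrow> (nat \<Rightarrow> 'a set) \<Rightarrow> ('a \<Rightarrow> 'a) \<Rightarrow> nat \<Rightarrow> 'a \<Rightarrow> nat \<Rightarrow> 'a set" where
  "E_class R gr d i c =
     (\<lambda>j. if j = i then boundaries R gr d j +>\<^bsub>R\<^esub> c else boundaries R gr d j)"

text \<open>Elements are families indexed by the degree; the component of degree \<open>k\<close> of a product
  is the sum over \<open>i \<le> k\<close>, in \<open>E_group R gr d k\<close>, of the classes of products of representatives.\<close>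

definition E_ring ::
  "('a, 'b) ring_scheme \<Rightarrow> (nat \<Rightarrow> 'a set) \<Rightarrow> ('a \<Rightarrow> 'a) \<Rightarrow> (nat \<Rightarrow> 'a set) ring" where
  "E_ring R gr d =
    \<lparr>carrier = carrier (sum_group UNIV (E_group R gr d)),
     mult = (\<lambda>f g k. finprod (E_group R gr d k)
       (\<lambda>i. \<Union>a\<in>f i. \<Union>b\<in>g (k - i). boundaries R gr d k +>\<^bsub>R\<^esub> (a \<otimes>\<^bsub>R\<^esub> b)) {..k}),
     one = E_class R gr d 0 \<one>\<^bsub>R\<^esub>,
     zero = one (sum_group UNIV (E_group R gr d)),
     add = mult (sum_group UNIV (E_group R gr d))\<rparr>"

abbreviation E_Fl :: "nat \<Rightarrow> (nat \<Rightarrow> mpoly2 set set) ring" where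
  "E_Fl n \<equiv> E_ring (Ch_Fl n) (Ch_Fl_deg n) (sq2 n)"

abbreviation E_Fl_class :: "nat \<Rightarrow> nat \<Rightarrow> mpoly2 \<Rightarrow> nat \<Rightarrow> mpoly2 set set" where
  "E_Fl_class n i p \<equiv> E_class (Ch_Fl n) (Ch_Fl_deg n) (sq2 n) i (cls n p)"


section \<open>The exterior algebra and the classes \<open>T\<^sub>a\<close>\<close>

text \<open>In characteristic 2 graded commutativity is commutativity, and the square of
  $\sum_a c_a t_a$ is $\sum_a c_a^2 t_a^2$, so the exterior algebra on $t_1, \ldots, t_m$ is the
  commutative polynomial algebra modulo the squares of the generators.\<close>

definition ext_ideal :: "nat \<Rightarrow> mpoly2 set" where
  "ext_ideal m = Idl\<^bsub>poly_ring m\<^esub> {pvar a ^ 2 |a. a \<in> {1..m}}"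

definition ext_alg :: "nat \<Rightarrow> mpoly2 set ring" where
  "ext_alg m = poly_ring m Quot ext_ideal m"

definition ext_gen :: "nat \<Rightarrow> nat \<Rightarrow> mpoly2 set" where
  "ext_gen m a = ext_ideal m +>\<^bsub>poly_ring m\<^esub> pvar a"

definition T_poly :: "nat \<Rightarrow> (nat \<Rightarrow> mpoly2) \<Rightarrow> nat \<Rightarrow> mpoly2" where
  "T_poly n u a = (if even n \<and> a = n div 2 then pvar 1 ^ (n - 1)
     else complete_h (2*a) (n - 2*a) * complete_h (2*a - 1) (n - 2*a + 1) + u a)"

definition T_deg :: "nat \<Rightarrow> nat \<Rightarrow> nat" where
  "T_deg n a = (if even n \<and> a = n div 2 then n - 1 else 4*a - 1)"

end

(*
  Write d for the derivation and adjoin the variables one at a time: modulo the symmetric ideal,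
  F_2[x_1..x_{k+1}] is free over F_2[x_1..x_k] on the powers of x_{k+1} below n - k, and d maps odd
  powers to the next even power. If n - k = 2a + 1, adjoining x_{k+1} does not change the cohomology,
  and adjoining x_{k+2} as well gives the cone of multiplication by f = h_{2a}(x_1..x_{k+1}) from
  the complex with differential d + h_1(x_1..x_{k+1}) to the one with differential d. The cohomology
  of the twisted complex is free of rank one on f, and f is sent to f^2, which is the boundary of u;
  hence the two steps together adjoin exactly the class T_a = f h_{2a-1}(x_1..x_{k+2}) + u.

  Squares of polynomials of positive degree are boundaries, because x^2 q^2 = d(x q^2). So the T_a
  satisfy the relations of the exterior algebra, and there are no others if the product of all T_a is
  not a boundary. That product is congruent to x_1^{n-1} x_2^{n-2} ... x_{n-1}, and the sum of the
  coefficients at the permutations of this monomial is a functional that kills the symmetric ideal and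
  all boundaries but not the monomial itself.
*)

theory Submission
  imports Defs
begin

section \<open>Polynomials in characteristic 2 and the symmetric ideal\<close>

text \<open>The obstacle is that the two-step bundle is not a product. For g =
  h_{2a-1}(x_1..x_{k+2}) one has d g = h_1(x_1..x_{k+1}) g + h_{2a}(x_1..x_{k+1}) +
  h_{2a}(x_1..x_{k+2}), with the last term in the ideal: the first term is the origin of the twist,
  the second of the map f. Under d + h_1 it is x^{2i} that is paired with x^{2i+1}, so the top even
  power survives instead of 1. It is represented by f, because d f = h_1 f + h_{2a+1} and
  h_{2a+1}(x_1..x_{k+1}) lies in the ideal. All this compares coefficients of powers of x_{k+1}, so
  expansions modulo the ideal must be unique. That is Poincare duality: multiplied by the missing
  part of the staircase monomial, the functional of the last paragraph becomes a nondegenerate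
  pairing on polynomials in x_1..x_k. Partial flag varieties get no rings of their own; they are
  represented by polynomials in the first k variables modulo the ideal of the full flags. Removing
  two variables at a time ends in constants if n is odd and in P^{n-1} if n is even; the extra class
  x_1^{n-1} there is T_{n/2}.\<close>

lemma bit_add_self: "(b :: bit) + b = 0"
  by (cases b) simp_all

lemma bit_add_eq_0_iff: "(a :: bit) + b = 0 \<longleftrightarrow> a = b"
  by (cases a; cases b) simp_all

lemma bit_of_nat: "(of_nat k :: bit) = (if even k then 0 else 1)"
  by (induction k) auto

lemma mpoly2_add_self [simp]: "(p :: mpoly2) + p = 0"
  by (rule poly_mapping_eqI) (simp only: lookup_add bit_add_self lookup_zero)

lemma mpoly2_add_left_self [simp]: "(p :: mpoly2) + (p + q) = q"
  by (simp add: add.assoc[symmetric])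

lemma mpoly2_diff [simp]: "(p :: mpoly2) - q = p + q"
  using diff_conv_add_uminus[of p q] by simp

lemma mpoly2_of_nat: "(of_nat k :: mpoly2) = (if even k then 0 else 1)"
  by (induction k) auto

lemma mpoly2_2 [simp]: "(2 :: mpoly2) = 0"
  using mpoly2_of_nat[of 2] by simp

lemma mpoly2_eq_sum_keys: "(p :: mpoly2) = (\<Sum>m\<in>Poly_Mapping.keys p. Poly_Mapping.single m 1)"
  by (subst mpoly2_eq_sum[of p], rule sum.cong) (auto simp: in_keys_iff)

text \<open>The last case ranges over the monomials of p only, so that conditions on p such as
  membership in \<open>polys n\<close> or homogeneity pass to each monomial met in the
  induction.\<close>

lemma mpoly2_induct [case_names zero add single]:
  assumes "P 0" "\<And>p q. P p \<Longrightarrow> P q \<Longrightarrow> P (p + q)"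
    "\<And>m. m \<in> Poly_Mapping.keys p \<Longrightarrow> P (Poly_Mapping.single m (1 :: bit))"
  shows "P (p :: mpoly2)"
proof -
  have "P (\<Sum>m\<in>A. Poly_Mapping.single m 1)" if "A \<subseteq> Poly_Mapping.keys p" for A
    using finite_subset[OF that finite_keys] that
    by (induction A rule: finite_induct) (use assms in auto)
  then show ?thesis by (subst mpoly2_eq_sum_keys) auto
qed

section \<open>Degree, homogeneity and number of variables\<close>

lemma mdeg_add: "mdeg (a + b) = mdeg a + mdeg b"
proof -
  let ?A = "Poly_Mapping.keys a \<union> Poly_Mapping.keys b"
  have "mdeg m = (\<Sum>i\<in>?A. Poly_Mapping.lookup m i)" if "m \<in> {a, b, a + b}" for m
    using that Poly_Mapping.keys_add[of a b] by (intro mdeg_superset) auto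
  then show ?thesis by (simp add: lookup_add sum.distrib)
qed

lemma mdeg_0 [simp]: "mdeg 0 = 0"
  by (simp add: mdeg_def)

lemma mdeg_single [simp]: "mdeg (Poly_Mapping.single i c) = c"
  by (simp add: mdeg_def)

lemma mdeg_eq_0_iff [simp]: "mdeg m = 0 \<longleftrightarrow> m = 0"
  by (auto simp: mdeg_def in_keys_iff intro!: poly_mapping_eqI)

lemma homog_0 [simp]: "homog d 0"
  by (simp add: homog_def)

lemma homog_1 [simp]: "homog 0 1"
  by (simp add: homog_def)

lemma homog_pvar [simp]: "homog 1 (pvar i)"
  by (simp add: homog_def pvar_def)

lemma homog_add: "homog d p \<Longrightarrow> homog d q \<Longrightarrow> homog d (p + q)"
  using Poly_Mapping.keys_add[of p q] unfolding homog_def by blast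

lemma homog_sum: "(\<And>a. a \<in> A \<Longrightarrow> homog d (f a)) \<Longrightarrow> homog d (sum f A)"
  by (induction A rule: infinite_finite_induct) (auto intro: homog_add)

lemma homog_mult: "homog d p \<Longrightarrow> homog e q \<Longrightarrow> homog (d + e) (p * q)"
  using keys_mult[of p q] unfolding homog_def by (fastforce simp: mdeg_add)

lemma homog_power: "homog d p \<Longrightarrow> homog (d * k) (p ^ k)"
  by (induction k) (auto simp: homog_mult)

lemma polys_0 [simp]: "0 \<in> polys n"
  by (simp add: polys_def)

lemma polys_1 [simp]: "1 \<in> polys n"
  by (simp add: polys_def)

lemma polys_single [simp]: "Poly_Mapping.keys m \<subseteq> {1..n} \<Longrightarrow> Poly_Mapping.single m 1 \<in> polys n"
  by (simp add: polys_def)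

lemma polys_pvar [simp]: "i \<in> {1..n} \<Longrightarrow> pvar i \<in> polys n"
  by (simp add: pvar_def)

lemma polys_sum: "(\<And>a. a \<in> A \<Longrightarrow> f a \<in> polys n) \<Longrightarrow> sum f A \<in> polys n"
  by (induction A rule: infinite_finite_induct) (auto intro: polys_add)

lemma polys_prod: "(\<And>a. a \<in> A \<Longrightarrow> f a \<in> polys n) \<Longrightarrow> prod f A \<in> polys n"
  by (induction A rule: infinite_finite_induct) (auto intro: polys_mult)

lemma polys_power: "p \<in> polys n \<Longrightarrow> p ^ k \<in> polys n"
  by (induction k) (auto intro: polys_mult)

lemma polys_mono: "p \<in> polys k \<Longrightarrow> k \<le> n \<Longrightarrow> p \<in> polys n"
  by (fastforce simp: polys_def)

lemma polys_of_nat [simp]: "of_nat k \<in> polys n"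
  by (simp add: mpoly2_of_nat)

lemmas polys_intros = polys_add polys_mult polys_sum polys_prod polys_power polys_sq2_poly

section \<open>Ideals of the polynomial ring, in particular the symmetric ideal\<close>

lemma poly_ring_ideal:
  assumes "ideal I (poly_ring n)"
  shows poly_ring_ideal_0: "0 \<in> I"
    and poly_ring_ideal_add: "a \<in> I \<Longrightarrow> b \<in> I \<Longrightarrow> a + b \<in> I"
    and poly_ring_ideal_mult: "a \<in> I \<Longrightarrow> b \<in> polys n \<Longrightarrow> a * b \<in> I"
    and poly_ring_ideal_polys: "a \<in> I \<Longrightarrow> a \<in> polys n"
proof -
  interpret R: cring "poly_ring n" by (rule poly_ring_cring)
  interpret S: ideal I "poly_ring n" by (rule assms)
  show "0 \<in> I" using S.zero_closed by (simp add: poly_ring_def)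
  show "a \<in> I \<Longrightarrow> b \<in> I \<Longrightarrow> a + b \<in> I" using S.a_closed[of a b] by (simp add: poly_ring_def)
  show "a \<in> I \<Longrightarrow> b \<in> polys n \<Longrightarrow> a * b \<in> I" using S.I_r_closed[of a b] by (simp add: poly_ring_def)
  show "a \<in> I \<Longrightarrow> a \<in> polys n" using S.a_subset by (auto simp: poly_ring_def)
qed

lemma sym_ideal_0 [simp]: "0 \<in> sym_ideal n"
  by (rule poly_ring_ideal_0[OF sym_ideal_ideal])

lemmas sym_ideal_add = poly_ring_ideal_add[OF sym_ideal_ideal]
lemmas sym_ideal_mult = poly_ring_ideal_mult[OF sym_ideal_ideal]
lemmas sym_ideal_polys = poly_ring_ideal_polys[OF sym_ideal_ideal]

lemma sym_ideal_mult': "a \<in> sym_ideal n \<Longrightarrow> b \<in> polys n \<Longrightarrow> b * a \<in> sym_ideal n"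
  using sym_ideal_mult[of a n b] by (simp add: mult.commute)

lemma sym_ideal_sum: "(\<And>a. a \<in> A \<Longrightarrow> f a \<in> sym_ideal n) \<Longrightarrow> sum f A \<in> sym_ideal n"
  by (induction A rule: infinite_finite_induct) (auto intro: sym_ideal_add)

lemma sym_ideal_gen:
  assumes "p \<in> polys n" "symmetric_poly n p" "homog d p" "d > 0"
  shows "p \<in> sym_ideal n"
proof -
  interpret R: cring "poly_ring n" by (rule poly_ring_cring)
  show ?thesis
    using R.genideal_self[OF sym_ideal_gens_subset] assms unfolding sym_ideal_def by blast
qed

lemma sym_ideal_add_cancel: "a \<in> sym_ideal n \<Longrightarrow> a + b \<in> sym_ideal n \<longleftrightarrow> b \<in> sym_ideal n"
  using sym_ideal_add[of a n "a + b"] sym_ideal_add[of a n b] by auto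

lemma poly_ring_ideal_minimal:
  assumes A: "A \<subseteq> polys n" "p \<in> Idl\<^bsub>poly_ring n\<^esub> A"
    and 0: "P 0" and add: "\<And>p q. P p \<Longrightarrow> P q \<Longrightarrow> P (p + q)"
    and gen: "\<And>s q. s \<in> A \<Longrightarrow> q \<in> polys n \<Longrightarrow> P (q * s)"
  shows "P p"
proof -
  interpret R: cring "poly_ring n" by (rule poly_ring_cring)
  \<comment> \<open>\<open>P\<close> is not assumed to be closed under multiplication; asking for it
    on all multiples builds that closure into the ideal.\<close>
  let ?J = "{p \<in> polys n. \<forall>q\<in>polys n. P (q * p)}"
  have "ideal ?J (poly_ring n)"
  proof (rule idealI)
    show "ring (poly_ring n)" by (rule R.ring_axioms)
    show "subgroup ?J (add_monoid (poly_ring n))"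
    proof (rule group.subgroupI)
      show "group (add_monoid (poly_ring n))" by (rule R.a_group)
      show "?J \<subseteq> carrier (add_monoid (poly_ring n))" by (auto simp: poly_ring_def)
      show "?J \<noteq> {}" using 0 by (auto intro!: exI[of _ 0])
      fix a b assume ab: "a \<in> ?J" "b \<in> ?J"
      then show "a \<otimes>\<^bsub>add_monoid (poly_ring n)\<^esub> b \<in> ?J"
        by (simp add: poly_ring_def add distrib_left polys_add)
    next
      fix a assume a: "a \<in> ?J"
      have "inv\<^bsub>add_monoid (poly_ring n)\<^esub> a = a"
        using a by (intro group.inv_equality[OF R.a_group]) (auto simp: poly_ring_def)
      with a show "inv\<^bsub>add_monoid (poly_ring n)\<^esub> a \<in> ?J" by simp
    qed
  next
    fix a x assume *: "a \<in> ?J" "x \<in> carrier (poly_ring n)"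
    have "P (q * (x * a))" if "q \<in> polys n" for q
      using * that polys_mult[of q n x] by (auto simp: poly_ring_def mult.assoc[symmetric])
    then show "x \<otimes>\<^bsub>poly_ring n\<^esub> a \<in> ?J" "a \<otimes>\<^bsub>poly_ring n\<^esub> x \<in> ?J"
      using * by (auto simp: poly_ring_def polys_mult mult.commute)
  qed
  moreover have "A \<subseteq> ?J" using A gen by auto
  ultimately have "p \<in> ?J" using R.genideal_minimal A by blast
  then have "P (1 * p)" using polys_1 by blast
  then show ?thesis by simp
qed

lemma sym_ideal_induct [consumes 1, case_names add gen]:
  assumes p: "p \<in> sym_ideal n"
    and add: "\<And>p q. P p \<Longrightarrow> P q \<Longrightarrow> P (p + q)"
    and gen: "\<And>s d q. s \<in> polys n \<Longrightarrow> symmetric_poly n s \<Longrightarrow> homog d s \<Longrightarrow> d > 0 \<Longrightarrow>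
      q \<in> polys n \<Longrightarrow> P (q * s)"
  shows "P p"
proof -
  \<comment> \<open>Zero is covered by \<open>gen\<close>: the polynomial 0 is symmetric and
    homogeneous of every degree.\<close>
  have 0: "P (0 * 0)" by (rule gen[of 0 1]) (auto simp: symmetric_poly_def)
  show ?thesis
  proof (rule poly_ring_ideal_minimal[OF _ p[unfolded sym_ideal_def]])
    show "P 0" using 0 by simp
    show "P (a + b)" if "P a" "P b" for a b by (rule add[OF that])
  qed (auto intro: gen)
qed

section \<open>Complete homogeneous symmetric polynomials\<close>

definition hmonoms :: "nat \<Rightarrow> nat \<Rightarrow> monom set" where
  "hmonoms d j = {m. Poly_Mapping.keys m \<subseteq> {1..j} \<and> mdeg m = d}"

lemma pvar_power: "pvar i ^ e = Poly_Mapping.single (Poly_Mapping.single i e) 1"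
  by (induction e) (simp_all add: pvar_def mult_single single_add[symmetric])

lemma prod_single_1:
  "(\<Prod>i\<in>A. Poly_Mapping.single (f i) (1 :: bit)) = Poly_Mapping.single (\<Sum>i\<in>A. f i :: monom) 1"
  by (induction A rule: infinite_finite_induct) (simp_all add: mult_single)

lemma lookup_sum_single:
  "finite A \<Longrightarrow> Poly_Mapping.lookup (\<Sum>i\<in>A. Poly_Mapping.single i (e i)) k = (if k \<in> A then e k else 0)"
  by (simp add: lookup_sum lookup_single when_def)

lemma monom_eq_sum_single:
  assumes "finite A" "Poly_Mapping.keys m \<subseteq> A"
  shows "(\<Sum>i\<in>A. Poly_Mapping.single i (Poly_Mapping.lookup m i)) = (m :: monom)"
  by (rule poly_mapping_eqI) (use assms in \<open>auto simp: lookup_sum_single in_keys_iff\<close>)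

lemma bij_betw_hmonoms:
  "bij_betw (\<lambda>e. \<Sum>i=1..j. Poly_Mapping.single i (e i))
    {e \<in> {1..j} \<rightarrow>\<^sub>E {0..d}. (\<Sum>i=1..j. e i) = d} (hmonoms d j)"
proof (rule bij_betw_imageI)
  let ?E = "{e \<in> {1..j} \<rightarrow>\<^sub>E {0..d}. (\<Sum>i=1..j. e i) = d}"
  let ?f = "\<lambda>e. \<Sum>i=1..j. Poly_Mapping.single i (e i :: nat)"
  have lk: "Poly_Mapping.lookup (?f e) i = e i" if "i \<in> {1..j}" for e i
    using that by (subst lookup_sum_single) auto
  have keys: "Poly_Mapping.keys (?f e) \<subseteq> {1..j}" for e
  proof
    fix i assume "i \<in> Poly_Mapping.keys (?f e)"
    then show "i \<in> {1..j}" unfolding in_keys_iff by (subst (asm) lookup_sum_single) (auto split: if_splits)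
  qed
  show "inj_on ?f ?E"
  proof (rule inj_onI)
    fix e e' assume *: "e \<in> ?E" "e' \<in> ?E" "?f e = ?f e'"
    show "e = e'"
    proof (rule PiE_ext[of e "{1..j}" _ e'])
      show "e \<in> {1..j} \<rightarrow>\<^sub>E {0..d}" "e' \<in> {1..j} \<rightarrow>\<^sub>E {0..d}" using * by blast+
      show "e i = e' i" if "i \<in> {1..j}" for i
        using lk[OF that, of e] lk[OF that, of e'] *(3) by metis
    qed
  qed
  have mdeg: "mdeg (?f e) = (\<Sum>i=1..j. e i)" for e
    using mdeg_superset[OF _ keys, of e] lk[of _ e] by simp
  show "?f ` ?E = hmonoms d j"
  proof
    show "?f ` ?E \<subseteq> hmonoms d j" using keys mdeg by (auto simp: hmonoms_def)
    show "hmonoms d j \<subseteq> ?f ` ?E"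
    proof
      fix m assume m: "m \<in> hmonoms d j"
      let ?e = "restrict (Poly_Mapping.lookup m) {1..j}"
      have e: "?f ?e = m"
        using monom_eq_sum_single[of "{1..j}" m] m by (simp add: hmonoms_def)
      have d: "(\<Sum>i=1..j. Poly_Mapping.lookup m i) = d"
        using mdeg_superset[of "{1..j}" m] m by (simp add: hmonoms_def)
      \<comment> \<open>An exponent is at most the total degree, so the bound \<open>{0..d}\<close>
        in the definition of \<open>complete_h\<close> cuts off no monomial.\<close>
      have "Poly_Mapping.lookup m i \<le> d" if "i \<in> {1..j}" for i
        using member_le_sum[OF that, of "Poly_Mapping.lookup m"] d by simp
      then have "?e \<in> {1..j} \<rightarrow>\<^sub>E {0..d}" by (simp add: PiE_iff)
      moreover have "(\<Sum>i=1..j. ?e i) = d" using d by simp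
      ultimately have "?e \<in> ?E" by blast
      then have "?f ?e \<in> ?f ` ?E" by (rule imageI)
      then show "m \<in> ?f ` ?E" by (simp only: e)
    qed
  qed
qed

lemma finite_hmonoms [simp]: "finite (hmonoms d j)"
proof -
  have "finite {e \<in> {1..j} \<rightarrow>\<^sub>E {0..d}. (\<Sum>i=1..j. e i) = d}"
    by (rule finite_subset[OF _ finite_PiE[of "{1..j}" "\<lambda>_. {0..d}"]]) auto
  then show ?thesis using bij_betw_finite[OF bij_betw_hmonoms] by blast
qed

lemma complete_h_eq: "complete_h d j = (\<Sum>m\<in>hmonoms d j. Poly_Mapping.single m 1)"
  unfolding complete_h_def pvar_power prod_single_1
  by (rule sum.reindex_bij_betw[OF bij_betw_hmonoms])

lemma lookup_complete_h:
  "Poly_Mapping.lookup (complete_h d j) m = (if m \<in> hmonoms d j then 1 else 0)"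
  by (simp add: complete_h_eq lookup_sum lookup_single when_def)

lemma complete_h_polys [simp]: "complete_h d j \<in> polys j"
  by (auto simp: complete_h_eq hmonoms_def intro!: polys_sum)

lemma complete_h_polys' [simp]: "j \<le> n \<Longrightarrow> complete_h d j \<in> polys n"
  using polys_mono complete_h_polys by blast

lemma homog_complete_h [simp]: "homog d (complete_h d j)"
  unfolding complete_h_eq by (rule homog_sum) (simp add: hmonoms_def homog_def)

lemma complete_h_0 [simp]: "complete_h 0 j = 1"
proof -
  have "hmonoms 0 j = {0}" by (auto simp: hmonoms_def)
  then show ?thesis by (simp add: complete_h_eq)
qed

lemma complete_h_no_vars [simp]: "d > 0 \<Longrightarrow> complete_h d 0 = 0"
proof -
  assume "d > 0"
  then have "hmonoms d 0 = {}" by (auto simp: hmonoms_def)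
  then show ?thesis by (simp add: complete_h_eq)
qed

text \<open>A monomial of degree d + 1 either avoids the last variable or is that variable times a
  monomial of degree d.\<close>

lemma complete_h_Suc:
  "complete_h (Suc d) (Suc j) = complete_h (Suc d) j + pvar (Suc j) * complete_h d (Suc j)"
proof -
  let ?s = "Poly_Mapping.single (Suc j) 1 :: monom"
  have eq: "hmonoms (Suc d) (Suc j) = hmonoms (Suc d) j \<union> (\<lambda>m. m + ?s) ` hmonoms d (Suc j)"
  proof (intro equalityI subsetI)
    fix m assume m: "m \<in> hmonoms (Suc d) (Suc j)"
    show "m \<in> hmonoms (Suc d) j \<union> (\<lambda>m. m + ?s) ` hmonoms d (Suc j)"
    proof (cases "Suc j \<in> Poly_Mapping.keys m")
      case True
      have eq: "m = (m - ?s) + ?s"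
        using True by (intro poly_mapping_eqI)
          (auto simp: lookup_add lookup_minus lookup_single when_def in_keys_iff)
      moreover have "Poly_Mapping.keys (m - ?s) \<subseteq> Poly_Mapping.keys m"
        by (auto simp: in_keys_iff lookup_minus)
      moreover have "mdeg m = mdeg (m - ?s) + 1"
        by (subst eq) (simp add: mdeg_add)
      ultimately have "m - ?s \<in> hmonoms d (Suc j)" using m by (auto simp: hmonoms_def)
      then show ?thesis using eq by blast
    next
      case False
      then have "Poly_Mapping.keys m \<subseteq> {1..j}"
        using m by (auto simp: hmonoms_def atLeastAtMostSuc_conv)
      then show ?thesis using m by (auto simp: hmonoms_def)
    qed
  next
    fix m assume "m \<in> hmonoms (Suc d) j \<union> (\<lambda>m. m + ?s) ` hmonoms d (Suc j)"
    then show "m \<in> hmonoms (Suc d) (Suc j)"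
      using Poly_Mapping.keys_add[of _ ?s] by (fastforce simp: hmonoms_def mdeg_add)
  qed
  have disj: "hmonoms (Suc d) j \<inter> (\<lambda>m. m + ?s) ` hmonoms d (Suc j) = {}"
  proof -
    have "Suc j \<in> Poly_Mapping.keys (m + ?s)" for m by (simp add: in_keys_iff lookup_add)
    then show ?thesis by (fastforce simp: hmonoms_def)
  qed
  have inj: "inj_on (\<lambda>m. m + ?s) A" for A by (auto simp: inj_on_def)
  have "pvar (Suc j) * complete_h d (Suc j) =
      (\<Sum>m\<in>(\<lambda>m. m + ?s) ` hmonoms d (Suc j). Poly_Mapping.single m 1)"
    unfolding complete_h_eq sum.reindex[OF inj] pvar_def sum_distrib_left mult_single
    by (simp add: add.commute)
  then show ?thesis
    unfolding complete_h_eq[of "Suc d"] eq using disj by (simp add: sum.union_disjoint)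
qed

lemma complete_h_1: "complete_h (Suc 0) (Suc j) = complete_h (Suc 0) j + pvar (Suc j)"
  by (simp add: complete_h_Suc)

lemma complete_h_expand:
  "complete_h d (Suc j) = (\<Sum>i\<le>d. complete_h (d - i) j * pvar (Suc j) ^ i)"
proof (induction d)
  case (Suc d)
  have "pvar (Suc j) * complete_h d (Suc j) = (\<Sum>i\<le>d. complete_h (Suc d - Suc i) j * pvar (Suc j) ^ Suc i)"
    by (simp add: Suc.IH sum_distrib_left mult_ac)
  then show ?case
    by (simp only: complete_h_Suc sum.atMost_Suc_shift diff_zero power_0 mult_1_right)
qed simp

lemma symmetric_complete_h: "symmetric_poly n (complete_h d n)"
  unfolding symmetric_poly_def
proof (intro allI impI)
  fix \<pi> and m :: monom assume \<pi>: "\<pi> permutes {1..n}"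
  have inj: "inj \<pi>" using \<pi> by (rule permutes_inj)
  have img: "\<pi> ` (\<pi> -` Poly_Mapping.keys m) = Poly_Mapping.keys m"
    using permutes_surj[OF \<pi>] by (simp add: surj_image_vimage_eq)
  have "mdeg (Poly_Mapping.map_key \<pi> m) = mdeg m"
    unfolding mdeg_def keys_map_key[OF inj]
    by (subst (2) img[symmetric], subst sum.reindex)
      (auto simp: map_key.rep_eq inj intro: inj_on_subset[OF inj])
  moreover have "\<pi> -` Poly_Mapping.keys m \<subseteq> {1..n} \<longleftrightarrow> Poly_Mapping.keys m \<subseteq> {1..n}"
    using image_mono[of "\<pi> -` Poly_Mapping.keys m" "{1..n}" \<pi>] vimage_mono[of "Poly_Mapping.keys m" "{1..n}" \<pi>]
    unfolding img permutes_image[OF \<pi>] permutes_vimage[OF \<pi>] by argo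
  ultimately show "Poly_Mapping.lookup (complete_h d n) (Poly_Mapping.map_key \<pi> m)
      = Poly_Mapping.lookup (complete_h d n) m"
    by (simp add: lookup_complete_h hmonoms_def keys_map_key[OF inj])
qed

text \<open>Downward induction on k from the symmetric case k = n: the recursion writes
  \<open>complete_h j k\<close> through polynomials in one more variable. For j = n - k + 1 the
  relation is monic in x_k and so bounds the powers of x_k.\<close>

lemma complete_h_sym_ideal:
  assumes "k \<le> n" "n < j + k"
  shows "complete_h j k \<in> sym_ideal n"
  using assms
proof (induction "n - k" arbitrary: j k)
  case 0
  then have "k = n" "0 < j" by simp_all
  then show ?case
    using sym_ideal_gen[OF complete_h_polys symmetric_complete_h homog_complete_h, of j n] by simp
next
  case (Suc l)
  then obtain i where j: "j = Suc i" by (cases j) auto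
  have "complete_h j (Suc k) \<in> sym_ideal n" "complete_h i (Suc k) \<in> sym_ideal n"
    using Suc.hyps(2) Suc.prems j by (simp_all add: Suc.hyps(1))
  then have "complete_h j (Suc k) + pvar (Suc k) * complete_h i (Suc k) \<in> sym_ideal n"
    using Suc.hyps(2) by (intro sym_ideal_add sym_ideal_mult' polys_pvar) simp_all
  then show ?case by (simp add: j complete_h_Suc add.assoc)
qed

lemma sq2_poly_1 [simp]: "sq2_poly 1 = 0"
  using sq2_poly_mult[of 1 1] by simp

text \<open>For the generating series H(t) of the h_k, the product of the 1/(1 - x_i t), the
  derivation yields H' - h_1 H, and this is the coefficient of t^k. The parity of k decides whether
  d h_k is just h_1 h_k. The proof is an induction along the recursion in both indices.\<close>

lemma sq2_poly_complete_h:
  "sq2_poly (complete_h k j) = complete_h 1 j * complete_h k j + of_nat (Suc k) * complete_h (Suc k) j"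
proof (induction j arbitrary: k)
  case 0
  then show ?case by (cases k) auto
next
  case (Suc j)
  note IH = Suc.IH
  show ?case
  proof (induction k)
    case 0
    then show ?case by simp
  next
    case (Suc k)
    let ?x = "pvar (Suc j)" and ?h = "\<lambda>k. complete_h k j" and ?H = "\<lambda>k. complete_h k (Suc j)"
    have "sq2_poly (?H (Suc k)) = ?h 1 * ?h (Suc k) + of_nat (Suc (Suc k)) * ?h (Suc (Suc k))
       + (?x^2 * ?H k + ?x * (?H 1 * ?H k + of_nat (Suc k) * ?H (Suc k)))"
      by (simp only: complete_h_Suc[of k] sq2_poly_add sq2_poly_mult sq2_poly_pvar IH Suc.IH)
    also have "\<dots> = ?h 1 * (?h (Suc k) + ?x * ?H k)
       + of_nat (Suc (Suc k)) * ?h (Suc (Suc k)) + of_nat (Suc k) * (?x * ?H (Suc k))"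
      by (simp add: complete_h_1 algebra_simps power2_eq_square del: of_nat_Suc)
    also have "\<dots> = ?h 1 * ?H (Suc k)
       + of_nat (Suc (Suc k)) * ?h (Suc (Suc k)) + of_nat (Suc k) * (?x * ?H (Suc k))"
      by (simp only: complete_h_Suc[of k])
    also have "\<dots> = ?H 1 * ?H (Suc k) + of_nat (Suc (Suc k)) * ?H (Suc (Suc k))"
      by (simp only: complete_h_Suc[of "Suc k"]) (simp add: complete_h_1 algebra_simps mpoly2_of_nat)
    finally show ?case .
  qed
qed

section \<open>The top coefficient\<close>

definition stair_monoms :: "nat \<Rightarrow> monom set" where
  "stair_monoms n = {m. Poly_Mapping.keys m \<subseteq> {1..n} \<and> bij_betw (Poly_Mapping.lookup m) {1..n} {..<n}}"

text \<open>In the top degree this is the degree map of the flag variety modulo 2: it reads off the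
  coefficient of $x_1^{n-1} \cdots x_{n-1}$ in the (anti)symmetrization.\<close>

definition top_coeff :: "nat \<Rightarrow> mpoly2 \<Rightarrow> bit" where
  "top_coeff n p = (\<Sum>m\<in>stair_monoms n. Poly_Mapping.lookup p m)"

lemma mdeg_stair_monoms:
  assumes "m \<in> stair_monoms n"
  shows "mdeg m = \<Sum>{..<n}"
proof -
  have "mdeg m = (\<Sum>i=1..n. Poly_Mapping.lookup m i)"
    using assms by (intro mdeg_superset) (auto simp: stair_monoms_def)
  also have "\<dots> = \<Sum>{..<n}"
    using assms by (intro sum.reindex_bij_betw) (simp add: stair_monoms_def)
  finally show ?thesis .
qed

lemma finite_stair_monoms [simp]: "finite (stair_monoms n)"
  by (rule finite_subset[OF _ finite_hmonoms[of "\<Sum>{..<n}" n]])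
    (auto simp: mdeg_stair_monoms hmonoms_def, auto simp: stair_monoms_def)

lemma top_coeff_0 [simp]: "top_coeff n 0 = 0"
  by (simp add: top_coeff_def)

lemma top_coeff_add: "top_coeff n (p + q) = top_coeff n p + top_coeff n q"
  unfolding top_coeff_def lookup_add by (rule sum.distrib)

lemma top_coeff_sum: "top_coeff n (sum f A) = (\<Sum>a\<in>A. top_coeff n (f a))"
  by (induction A rule: infinite_finite_induct) (simp_all add: top_coeff_add)

lemma top_coeff_single: "top_coeff n (Poly_Mapping.single m c) = (if m \<in> stair_monoms n then c else 0)"
  unfolding top_coeff_def lookup_single when_def by simp

lemma top_coeff_keys:
  "top_coeff n p = (\<Sum>m\<in>Poly_Mapping.keys p. if m \<in> stair_monoms n then 1 else 0)"
  by (subst mpoly2_eq_sum_keys) (simp only: top_coeff_sum top_coeff_single)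

lemma sum_lessThan_card_le:
  assumes "finite (B :: nat set)"
  shows "\<Sum>{..<card B} \<le> \<Sum>B"
  using assms
proof (induction "card B" arbitrary: B)
  case (Suc k)
  then have ne: "B \<noteq> {}" by auto
  then have M: "Max B \<in> B" using Suc by simp
  have k: "card (B - {Max B}) = k" using Suc M by simp
  have "B \<subseteq> {..Max B}" using Suc by auto
  then have "card B \<le> Suc (Max B)" using card_mono[of "{..Max B}" B] by simp
  then have "k \<le> Max B" using Suc by simp
  moreover have "\<Sum>{..<k} \<le> \<Sum>(B - {Max B})" using Suc.hyps(1)[of "B - {Max B}"] k Suc.prems by simp
  moreover have "\<Sum>B = Max B + \<Sum>(B - {Max B})" using sum.remove[OF Suc.prems M, of "\<lambda>x. x"] by simp
  ultimately show ?case by (simp add: Suc.hyps(2)[symmetric])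
qed simp

text \<open>One half of a dichotomy on which the vanishing of \<open>top_coeff\<close> rests:
  distinct exponents already force the top degree, so anything that raises the degree leaves the
  staircase monomials. In the other half two exponents agree, and a transposition cancels terms in
  pairs.\<close>

lemma mdeg_inj_on_ge:
  assumes "Poly_Mapping.keys m \<subseteq> {1..n}" "inj_on (Poly_Mapping.lookup m) {1..n}"
  shows "\<Sum>{..<n} \<le> mdeg m"
proof -
  have "mdeg m = \<Sum>(Poly_Mapping.lookup m ` {1..n})"
    using mdeg_superset[of "{1..n}" m] assms by (simp add: sum.reindex)
  then show ?thesis
    using sum_lessThan_card_le[of "Poly_Mapping.lookup m ` {1..n}"] card_image[OF assms(2)] by simp
qed

lemma keys_single_mult:
  "Poly_Mapping.keys (Poly_Mapping.single \<mu> (1 :: bit) * q) = (\<lambda>m. \<mu> + m :: monom) ` Poly_Mapping.keys q"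
proof -
  have inj: "inj_on (\<lambda>m. \<mu> + m) A" for A by (auto simp: inj_on_def)
  have "Poly_Mapping.single \<mu> (1 :: bit) * q
      = (\<Sum>m\<in>(\<lambda>m. \<mu> + m) ` Poly_Mapping.keys q. Poly_Mapping.single m 1)"
    unfolding sum.reindex[OF inj]
    by (subst mpoly2_eq_sum_keys[of q]) (simp add: sum_distrib_left mult_single)
  then have "Poly_Mapping.lookup (Poly_Mapping.single \<mu> (1 :: bit) * q) m
      = (if m \<in> (\<lambda>m. \<mu> + m) ` Poly_Mapping.keys q then 1 else 0)" for m
    by (simp only: lookup_sum lookup_single when_def) simp
  then show ?thesis by (auto simp: in_keys_iff split: if_splits)
qed

context
  fixes n i j :: nat and \<tau>
  assumes ij: "i \<in> {1..n}" "j \<in> {1..n}" "i \<noteq> j"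
  defines "\<tau> \<equiv> Transposition.transpose i j"
begin

lemma inj_transp: "inj \<tau>"
  unfolding \<tau>_def by (rule inj_transpose)

lemma lookup_swap_vars: "Poly_Mapping.lookup (Poly_Mapping.map_key \<tau> m) k = Poly_Mapping.lookup m (\<tau> k)"
  by (simp add: map_key.rep_eq inj_transp)

lemma swap_vars_swap_vars: "Poly_Mapping.map_key \<tau> (Poly_Mapping.map_key \<tau> m) = m"
  by (rule poly_mapping_eqI) (simp add: lookup_swap_vars, simp add: \<tau>_def)

lemma swap_vars_stair_monoms:
  assumes "m \<in> stair_monoms n"
  shows "Poly_Mapping.map_key \<tau> m \<in> stair_monoms n"
proof -
  have \<tau>: "\<tau> permutes {1..n}" unfolding \<tau>_def by (rule permutes_swap_id) (use ij in auto)
  have "bij_betw (Poly_Mapping.lookup m \<circ> \<tau>) {1..n} {..<n}"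
    using assms permutes_imp_bij[OF \<tau>] by (intro bij_betw_trans[of \<tau> _ "{1..n}"]) (simp_all add: stair_monoms_def)
  moreover have "Poly_Mapping.lookup (Poly_Mapping.map_key \<tau> m) = Poly_Mapping.lookup m \<circ> \<tau>"
    by (simp add: fun_eq_iff lookup_swap_vars)
  moreover have "\<tau> -` Poly_Mapping.keys m \<subseteq> {1..n}"
    using vimage_mono[of "Poly_Mapping.keys m" "{1..n}" \<tau>] assms permutes_vimage[OF \<tau>]
    by (simp add: stair_monoms_def)
  ultimately show ?thesis
    unfolding stair_monoms_def mem_Collect_eq keys_map_key[OF inj_transp] by argo
qed

lemma stair_monoms_lookup_neq: "m \<in> stair_monoms n \<Longrightarrow> Poly_Mapping.lookup m i \<noteq> Poly_Mapping.lookup m j"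
  using ij unfolding stair_monoms_def bij_betw_def inj_on_def by blast

text \<open>The transposition acts on the staircase monomials without fixed points.\<close>

lemma top_coeff_swap_invariant:
  assumes inv: "\<And>m. m \<in> Poly_Mapping.keys p \<Longrightarrow> Poly_Mapping.map_key \<tau> m \<in> Poly_Mapping.keys p"
  shows "top_coeff n p = 0"
proof -
  let ?K = "Poly_Mapping.keys p \<inter> stair_monoms n"
  let ?A = "{m \<in> ?K. Poly_Mapping.lookup m i < Poly_Mapping.lookup m j}"
  let ?B = "{m \<in> ?K. Poly_Mapping.lookup m j < Poly_Mapping.lookup m i}"
  have K: "?K = ?A \<union> ?B" using stair_monoms_lookup_neq by (force simp: neq_iff)
  have \<tau>: "\<tau> i = j" "\<tau> j = i" by (simp_all add: \<tau>_def)
  have "bij_betw (Poly_Mapping.map_key \<tau>) ?A ?B"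
    by (rule bij_betw_byWitness[where f' = "Poly_Mapping.map_key \<tau>"])
      (auto simp: swap_vars_swap_vars lookup_swap_vars \<tau> inv swap_vars_stair_monoms)
  then have "card ?A = card ?B" by (rule bij_betw_same_card)
  then have "even (card ?K)" by (subst K, subst card_Un_disjoint) auto
  moreover have "top_coeff n p = of_nat (card ?K)"
    unfolding top_coeff_keys by (simp add: sum.If_cases Int_def)
  ultimately show ?thesis by (simp only: bit_of_nat if_True)
qed

text \<open>Raising any exponent other than those at i and j leaves these two equal, which no
  staircase monomial allows. The two remaining terms are exchanged by the transposition and carry
  the same coefficient.\<close>

lemma top_coeff_sq2_poly_swap:
  assumes \<mu>: "Poly_Mapping.keys \<mu> \<subseteq> {1..n}" "Poly_Mapping.lookup \<mu> i = Poly_Mapping.lookup \<mu> j"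
  shows "top_coeff n (sq2_poly (Poly_Mapping.single \<mu> 1)) = 0"
proof -
  let ?F = "\<lambda>k. top_coeff n (Poly_Mapping.single (\<mu> + Poly_Mapping.single k 1) (of_nat (Poly_Mapping.lookup \<mu> k)))"
  have "top_coeff n (sq2_poly (Poly_Mapping.single \<mu> 1)) = (\<Sum>k\<in>{1..n}. ?F k)"
    by (subst sq2_poly_single[OF _ \<mu>(1)]) (simp_all only: top_coeff_sum finite_atLeastAtMost mult_1_left)
  also have "\<dots> = (\<Sum>k\<in>{i, j}. ?F k)"
  proof (rule sum.mono_neutral_right)
    show "\<forall>k\<in>{1..n} - {i, j}. ?F k = 0"
    proof
      fix k assume "k \<in> {1..n} - {i, j}"
      then have "\<mu> + Poly_Mapping.single k 1 \<notin> stair_monoms n"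
        using stair_monoms_lookup_neq[of "\<mu> + Poly_Mapping.single k 1"] \<mu>
        by (auto simp: lookup_add lookup_single when_def)
      then show "?F k = 0" by (simp only: top_coeff_single if_False)
    qed
  qed (use ij in auto)
  also have "\<dots> = ?F i + ?F j" using ij by simp
  also have "?F i = ?F j"
  proof -
    have "Poly_Mapping.map_key \<tau> (\<mu> + Poly_Mapping.single i 1) = \<mu> + Poly_Mapping.single j 1"
      by (rule poly_mapping_eqI, unfold lookup_swap_vars, unfold \<tau>_def)
        (use \<mu> in \<open>auto simp: lookup_add lookup_single when_def Transposition.transpose_def\<close>)
    then have "\<mu> + Poly_Mapping.single i 1 \<in> stair_monoms n \<longleftrightarrow> \<mu> + Poly_Mapping.single j 1 \<in> stair_monoms n"
      using swap_vars_stair_monoms swap_vars_swap_vars by metis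
    then show ?thesis using \<mu> by (simp add: top_coeff_single)
  qed
  finally show ?thesis by (simp only: bit_add_self)
qed

end

text \<open>It suffices to treat a monomial times a symmetric polynomial s. If two exponents of the
  monomial agree, the product is invariant under their transposition; if all are distinct, the
  positive degree of s pushes the product above the top degree.\<close>

lemma top_coeff_sym_ideal:
  assumes "p \<in> sym_ideal n"
  shows "top_coeff n p = 0"
  using assms
proof (induction rule: sym_ideal_induct)
  case (gen s d q)
  show ?case
  proof (induction q rule: mpoly2_induct)
    case (single \<mu>)
    then have \<mu>: "Poly_Mapping.keys \<mu> \<subseteq> {1..n}" using gen by (auto simp: polys_def)
    show ?case
    proof (cases "inj_on (Poly_Mapping.lookup \<mu>) {1..n}")
      case True
      have "m \<notin> stair_monoms n" if "m \<in> Poly_Mapping.keys (Poly_Mapping.single \<mu> (1 :: bit) * s)" for m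
      proof -
        have "mdeg m = mdeg \<mu> + d" using that gen by (auto simp: keys_single_mult mdeg_add homog_def)
        then show ?thesis using mdeg_inj_on_ge[OF \<mu> True] mdeg_stair_monoms[of m n] gen by auto
      qed
      then show ?thesis unfolding top_coeff_keys by (intro sum.neutral) auto
    next
      case False
      then obtain i j where ij: "i \<in> {1..n}" "j \<in> {1..n}" "i \<noteq> j"
        and eq: "Poly_Mapping.lookup \<mu> i = Poly_Mapping.lookup \<mu> j" unfolding inj_on_def by blast
      let ?\<tau> = "Transposition.transpose i j"
      have \<tau>: "?\<tau> permutes {1..n}" using ij by (intro permutes_swap_id)
      have \<tau>\<mu>: "Poly_Mapping.map_key ?\<tau> \<mu> = \<mu>"
        using eq by (intro poly_mapping_eqI) (auto simp: lookup_swap_vars[OF ij] Transposition.transpose_def)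
      have "Poly_Mapping.map_key ?\<tau> m \<in> Poly_Mapping.keys s" if "m \<in> Poly_Mapping.keys s" for m
        using gen(2) \<tau> that unfolding symmetric_poly_def in_keys_iff by metis
      then show ?thesis
        by (intro top_coeff_swap_invariant[OF ij])
          (auto simp: keys_single_mult map_key_plus inj_transp[OF ij] \<tau>\<mu>)
    qed
  qed (simp_all add: distrib_right top_coeff_add)
qed (simp add: top_coeff_add)

text \<open>The derivation raises the degree by one, which settles monomials with distinct
  exponents; the others fall under \<open>top_coeff_sq2_poly_swap\<close>.\<close>

lemma top_coeff_sq2_poly:
  assumes "p \<in> polys n"
  shows "top_coeff n (sq2_poly p) = 0"
proof (induction p rule: mpoly2_induct)
  case (single \<mu>)
  then have \<mu>: "Poly_Mapping.keys \<mu> \<subseteq> {1..n}" using assms by (auto simp: polys_def)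
  show ?case
  proof (cases "inj_on (Poly_Mapping.lookup \<mu>) {1..n}")
    case True
    have "m \<notin> stair_monoms n" if "m \<in> Poly_Mapping.keys (sq2_poly (Poly_Mapping.single \<mu> (1 :: bit)))" for m
    proof -
      have "mdeg m = Suc (mdeg \<mu>)"
        using that homog_sq2_poly[of "mdeg \<mu>" "Poly_Mapping.single \<mu> 1"] by (simp add: homog_def)
      then show ?thesis using mdeg_inj_on_ge[OF \<mu> True] mdeg_stair_monoms[of m n] by auto
    qed
    then show ?thesis unfolding top_coeff_keys by (intro sum.neutral) auto
  next
    case False
    then obtain i j where "i \<in> {1..n}" "j \<in> {1..n}" "i \<noteq> j"
      "Poly_Mapping.lookup \<mu> i = Poly_Mapping.lookup \<mu> j" unfolding inj_on_def by blast
    with \<mu> show ?thesis by (intro top_coeff_sq2_poly_swap)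
  qed
qed (simp_all add: sq2_poly_add top_coeff_add)

section \<open>Expansions modulo the symmetric ideal\<close>

definition stair_prod :: "nat \<Rightarrow> nat \<Rightarrow> mpoly2" where
  "stair_prod n k = (\<Prod>i=1..k. pvar i ^ (n - i))"

text \<open>Multiplication by this complement of \<open>stair_prod n k\<close> turns
  \<open>top_coeff n\<close> into a functional on polynomials in x_1, ..., x_k: in the top degree,
  the degree map modulo 2 of the variety of partial flags.\<close>

definition costair_prod :: "nat \<Rightarrow> nat \<Rightarrow> mpoly2" where
  "costair_prod n k = (\<Prod>i=Suc k..n. pvar i ^ (n - i))"

lemma stair_prod_0 [simp]: "stair_prod n 0 = 1"
  by (simp add: stair_prod_def)

lemma stair_prod_Suc: "stair_prod n (Suc k) = stair_prod n k * pvar (Suc k) ^ (n - Suc k)"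
  by (simp add: stair_prod_def)

lemma costair_prod_0: "costair_prod n 0 = stair_prod n n"
  by (simp add: costair_prod_def stair_prod_def)

lemma costair_prod_step: "k < n \<Longrightarrow> costair_prod n k = pvar (Suc k) ^ (n - Suc k) * costair_prod n (Suc k)"
  unfolding costair_prod_def by (subst prod.atLeast_Suc_atMost) auto

lemma stair_prod_polys: "k \<le> n \<Longrightarrow> stair_prod n k \<in> polys n"
  unfolding stair_prod_def by (intro polys_prod polys_power polys_pvar) auto

lemma costair_prod_polys: "costair_prod n k \<in> polys n"
  unfolding costair_prod_def by (intro polys_prod polys_power polys_pvar) auto

section \<open>Staircase products as annihilators\<close>

lemma monom_split:
  assumes "i \<in> Poly_Mapping.keys (m :: monom)"
  obtains m' where "m = Poly_Mapping.single i 1 + m'" "Poly_Mapping.keys m' \<subseteq> Poly_Mapping.keys m"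
proof
  show "m = Poly_Mapping.single i 1 + (m - Poly_Mapping.single i 1)"
    using assms by (intro poly_mapping_eqI)
      (auto simp: lookup_add lookup_minus lookup_single when_def in_keys_iff)
qed (auto simp: in_keys_iff lookup_minus)

lemma sym_ideal_mult_single:
  assumes M: "M * pvar i \<in> sym_ideal n" and i: "i \<in> Poly_Mapping.keys m"
    and m: "Poly_Mapping.keys m \<subseteq> {1..n}"
  shows "M * Poly_Mapping.single m 1 \<in> sym_ideal n"
proof -
  obtain m' where m': "m = Poly_Mapping.single i 1 + m'" "Poly_Mapping.keys m' \<subseteq> Poly_Mapping.keys m"
    using monom_split[OF i] .
  have "Poly_Mapping.single m 1 = pvar i * Poly_Mapping.single m' 1"
    by (simp add: m'(1) pvar_def mult_single)
  then have "M * Poly_Mapping.single m 1 = (M * pvar i) * Poly_Mapping.single m' 1"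
    by (simp add: mult.assoc)
  then show ?thesis using M m m' sym_ideal_mult[of "M * pvar i" n] by (metis order.trans polys_single)
qed

lemma sym_ideal_mult_homog:
  assumes M: "\<And>i. i \<in> {1..k} \<Longrightarrow> M * pvar i \<in> sym_ideal n"
    and p: "p \<in> polys k" "homog d p" "d > 0" "k \<le> n"
  shows "M * p \<in> sym_ideal n"
proof (induction p rule: mpoly2_induct)
  case (single m)
  then have "m \<noteq> 0" "Poly_Mapping.keys m \<subseteq> {1..k}"
    using p by (auto simp: homog_def polys_def)
  then obtain i where "i \<in> Poly_Mapping.keys m" by (metis equals0I keys_eq_empty)
  with \<open>Poly_Mapping.keys m \<subseteq> {1..k}\<close> p(4) show ?case
    by (intro sym_ideal_mult_single[OF M]) auto
qed (auto simp: distrib_left sym_ideal_add)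

text \<open>\<open>stair_prod n k\<close> is the point class of the variety of partial flags, so it
  kills positive degrees in x_1, ..., x_k. For the newest variable expand the relation
  \<open>complete_h (n - k) (Suc k)\<close>: every term except the pure power has a factor of
  positive degree in the older variables.\<close>

lemma stair_prod_mult_pvar:
  "k \<le> n \<Longrightarrow> i \<in> {1..k} \<Longrightarrow> stair_prod n k * pvar i \<in> sym_ideal n"
proof (induction k arbitrary: i)
  case (Suc k)
  let ?x = "pvar (Suc k)"
  have IH: "stair_prod n k * p \<in> sym_ideal n" if "p \<in> polys k" "homog d p" "d > 0" for p d
    using sym_ideal_mult_homog[OF Suc.IH that] Suc.prems by simp
  show ?case
  proof (cases "i = Suc k")
    case True
    have S: "Suc (n - Suc k) = n - k" using Suc.prems by simp
    have "complete_h (n - k) (Suc k) = (\<Sum>i<n - k. complete_h (n - k - i) k * ?x ^ i) + ?x ^ (n - k)"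
      unfolding complete_h_expand by (simp add: lessThan_Suc_atMost[symmetric])
    then have "stair_prod n k * ?x ^ (n - k) = stair_prod n k * complete_h (n - k) (Suc k)
        + (\<Sum>i<n - k. stair_prod n k * complete_h (n - k - i) k * ?x ^ i)"
      by (simp add: distrib_left sum_distrib_left mult.assoc add.assoc[symmetric])
    also have "\<dots> \<in> sym_ideal n"
      using Suc.prems
      by (intro sym_ideal_add sym_ideal_sum sym_ideal_mult' sym_ideal_mult[OF IH] complete_h_sym_ideal
          polys_power polys_pvar stair_prod_polys) (auto intro: homog_complete_h)
    finally show ?thesis
      unfolding True stair_prod_Suc mult.assoc power_Suc2[symmetric] S .
  next
    case False
    then have "stair_prod n k * pvar i \<in> sym_ideal n" using Suc.IH[of i] Suc.prems by simp
    from sym_ideal_mult[OF this] have "stair_prod n k * pvar i * ?x ^ (n - Suc k) \<in> sym_ideal n"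
      using Suc.prems by (simp add: polys_power)
    then show ?thesis by (simp add: stair_prod_Suc mult_ac)
  qed
qed simp

lemma stair_prod_mult_homog:
  assumes "p \<in> polys k" "homog d p" "d > 0" "k \<le> n"
  shows "stair_prod n k * p \<in> sym_ideal n"
  using sym_ideal_mult_homog[OF stair_prod_mult_pvar assms] assms by simp

text \<open>In the expansion by powers of x_{k+1} all coefficients but the last have positive degree
  in x_1, ..., x_k and are killed by \<open>stair_prod n k\<close>.\<close>

lemma stair_prod_mult_complete_h:
  assumes "k < n"
  shows "stair_prod n k * complete_h j (Suc k) + stair_prod n k * pvar (Suc k) ^ j \<in> sym_ideal n"
proof -
  let ?x = "pvar (Suc k)"
  have "complete_h j (Suc k) = (\<Sum>i<j. complete_h (j - i) k * ?x ^ i) + ?x ^ j"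
    unfolding complete_h_expand by (simp add: lessThan_Suc_atMost[symmetric])
  then have "stair_prod n k * complete_h j (Suc k) + stair_prod n k * ?x ^ j
      = (\<Sum>i<j. stair_prod n k * complete_h (j - i) k * ?x ^ i)"
    by (simp add: distrib_left sum_distrib_left mult.assoc add.assoc)
  also have "\<dots> \<in> sym_ideal n"
    using assms
    by (intro sym_ideal_sum sym_ideal_mult[OF stair_prod_mult_homog] polys_power polys_pvar)
      (auto intro: homog_complete_h)
  finally show ?thesis .
qed

text \<open>This disposes of the summand u of T_a. A monomial of this degree either contains one of
  the first k variables or is a power of x_{k+1} with exponent at least n - k;
  \<open>stair_prod n k\<close> kills both kinds.\<close>

lemma stair_prod_mult_homog_Suc:
  assumes p: "p \<in> polys (Suc k)" "homog d p" and "n - k \<le> d" "k < n"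
  shows "stair_prod n k * p \<in> sym_ideal n"
proof (induction p rule: mpoly2_induct)
  case (single m)
  then have m: "mdeg m = d" "Poly_Mapping.keys m \<subseteq> {1..Suc k}"
    using p by (auto simp: homog_def polys_def)
  show ?case
  proof (cases "Poly_Mapping.keys m \<subseteq> {Suc k}")
    case True
    have "m = Poly_Mapping.single (Suc k) (Poly_Mapping.lookup m (Suc k))"
      using monom_eq_sum_single[OF _ True] by simp
    then have "m = Poly_Mapping.single (Suc k) d" using m(1) mdeg_single by metis
    then have "Poly_Mapping.single m 1 = pvar (Suc k) ^ d" by (simp add: pvar_power)
    also have "\<dots> = pvar (Suc k) ^ (n - Suc k) * pvar (Suc k) * pvar (Suc k) ^ (d - (n - k))"
      using assms by (simp add: power_add[symmetric] power_Suc2[symmetric] del: power_Suc)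
    finally have "stair_prod n k * Poly_Mapping.single m 1
        = stair_prod n (Suc k) * pvar (Suc k) * pvar (Suc k) ^ (d - (n - k))"
      by (simp add: stair_prod_Suc mult_ac)
    then show ?thesis using assms
      by (simp add: sym_ideal_mult stair_prod_mult_pvar polys_power)
  next
    case False
    then obtain i where "i \<in> Poly_Mapping.keys m" "i \<noteq> Suc k" by auto
    moreover from this have "i \<in> {1..k}" using m(2) by (auto simp: le_Suc_eq)
    ultimately show ?thesis
      using m(2) assms by (intro sym_ideal_mult_single[OF stair_prod_mult_pvar]) auto
  qed
qed (auto simp: distrib_left sym_ideal_add)

lemma prod_pvar_power:
  "(\<Prod>i\<in>A. pvar i ^ e i) = Poly_Mapping.single (\<Sum>i\<in>A. Poly_Mapping.single i (e i)) 1"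
  by (simp only: pvar_power prod_single_1)

lemma top_coeff_stair_prod: "top_coeff n (stair_prod n n) = 1"
proof -
  define m where "m = (\<Sum>i=1..n. Poly_Mapping.single i (n - i))"
  have lk: "Poly_Mapping.lookup m i = (if i \<in> {1..n} then n - i else 0)" for i
    unfolding m_def by (rule lookup_sum_single) simp
  have "Poly_Mapping.keys m \<subseteq> {1..n}" unfolding in_keys_iff subset_iff lk by auto
  moreover have "bij_betw (Poly_Mapping.lookup m) {1..n} {..<n}"
    by (rule bij_betw_byWitness[where f' = "\<lambda>i. n - i"]) (auto simp: lk image_subset_iff)
  ultimately have "m \<in> stair_monoms n" by (simp add: stair_monoms_def)
  then show ?thesis
    unfolding stair_prod_def prod_pvar_power m_def[symmetric] by (simp only: top_coeff_single if_True)
qed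

section \<open>Normal forms in the newest variable\<close>

lemma sym_ideal_expand_power:
  assumes "k < n"
  shows "\<exists>b. (\<forall>j. b j \<in> polys k) \<and> pvar (Suc k) ^ e + (\<Sum>j<n - k. b j * pvar (Suc k) ^ j) \<in> sym_ideal n"
proof (induction e)
  case 0
  have "(\<Sum>j<n - k. (if j = 0 then 1 else 0) * pvar (Suc k) ^ j) = 1"
    using assms by (simp add: if_distrib[of "\<lambda>a. a * _"] cong: if_cong)
  then show ?case by (intro exI[of _ "\<lambda>j. if j = 0 then 1 else 0"]) auto
next
  case (Suc e)
  then obtain b where b: "\<And>j. b j \<in> polys k"
    and e: "pvar (Suc k) ^ e + (\<Sum>j<n - k. b j * pvar (Suc k) ^ j) \<in> sym_ideal n" by auto
  let ?x = "pvar (Suc k)"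
  obtain r where r: "n - k = Suc r" using assms by (cases "n - k") auto
  \<comment> \<open>Division by \<open>complete_h (Suc r) (Suc k)\<close>, which lies in the ideal
    and is monic of degree r + 1 in x_{k+1}: multiplying by x_{k+1} shifts the coefficients, and the
    lower terms of the relation replace the overflow \<open>b r * ?x ^ Suc r\<close>.\<close>
  define b' where "b' j = (if j = 0 then 0 else b (j - 1)) + b r * complete_h (Suc r - j) k" for j
  have h: "complete_h (Suc r) (Suc k) = (\<Sum>i<Suc r. complete_h (Suc r - i) k * ?x ^ i) + ?x ^ Suc r"
    unfolding complete_h_expand by (simp add: lessThan_Suc_atMost[symmetric])
  have "(\<Sum>j<Suc r. (if j = 0 then 0 else b (j - 1)) * ?x ^ j) = (\<Sum>j<r. b j * ?x ^ Suc j)"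
    by (simp only: sum.lessThan_Suc_shift) simp
  then have "(\<Sum>j<Suc r. b' j * ?x ^ j)
      = (\<Sum>j<r. b j * ?x ^ Suc j) + b r * (\<Sum>i<Suc r. complete_h (Suc r - i) k * ?x ^ i)"
    unfolding b'_def distrib_right sum.distrib sum_distrib_left mult.assoc by simp
  also have "(\<Sum>i<Suc r. complete_h (Suc r - i) k * ?x ^ i) = complete_h (Suc r) (Suc k) + ?x ^ Suc r"
    unfolding h by (simp only: add.assoc mpoly2_add_self add_0_right)
  also have "(\<Sum>j<r. b j * ?x ^ Suc j) + b r * (complete_h (Suc r) (Suc k) + ?x ^ Suc r)
      = ?x * (\<Sum>j<Suc r. b j * ?x ^ j) + b r * complete_h (Suc r) (Suc k)"
    by (simp add: algebra_simps sum_distrib_left)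
  finally have "?x ^ Suc e + (\<Sum>j<n - k. b' j * ?x ^ j)
      = ?x * (?x ^ e + (\<Sum>j<n - k. b j * ?x ^ j)) + b r * complete_h (Suc r) (Suc k)"
    unfolding r by (simp only: distrib_left power_Suc add.assoc)
  also have "\<dots> \<in> sym_ideal n"
    using assms r
    by (intro sym_ideal_add sym_ideal_mult'[OF e] sym_ideal_mult'[OF complete_h_sym_ideal]
        polys_pvar polys_mono[OF b[of r]]) auto
  finally show ?case
    using b by (intro exI[of _ b']) (auto simp: b'_def intro!: polys_intros)
qed

lemma sym_ideal_expand:
  assumes "k < n" and z: "z \<in> polys (Suc k)"
  obtains b where "\<And>j. b j \<in> polys k" "z + (\<Sum>j<n - k. b j * pvar (Suc k) ^ j) \<in> sym_ideal n"
proof -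
  have "\<exists>b. (\<forall>j. b j \<in> polys k) \<and> z + (\<Sum>j<n - k. b j * pvar (Suc k) ^ j) \<in> sym_ideal n"
  proof (induction z rule: mpoly2_induct)
    case zero
    show ?case by (rule exI[of _ "\<lambda>_. 0"]) simp
  next
    case (add p q)
    then obtain b c where "\<And>j. b j \<in> polys k" "\<And>j. c j \<in> polys k"
      "p + (\<Sum>j<n - k. b j * pvar (Suc k) ^ j) \<in> sym_ideal n"
      "q + (\<Sum>j<n - k. c j * pvar (Suc k) ^ j) \<in> sym_ideal n" by auto
    then have "(p + (\<Sum>j<n - k. b j * pvar (Suc k) ^ j)) + (q + (\<Sum>j<n - k. c j * pvar (Suc k) ^ j)) \<in> sym_ideal n"
      and "\<And>j. b j + c j \<in> polys k"
      by (auto intro: sym_ideal_add polys_add)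
    then show ?case
      by (intro exI[of _ "\<lambda>j. b j + c j"]) (simp add: distrib_right sum.distrib ac_simps)
  next
    case (single m)
    then have m: "Poly_Mapping.keys m \<subseteq> {1..Suc k}" using z by (auto simp: polys_def)
    let ?e = "Poly_Mapping.lookup m (Suc k)"
    let ?m = "\<Sum>i=1..k. Poly_Mapping.single i (Poly_Mapping.lookup m i)"
    have "m = ?m + Poly_Mapping.single (Suc k) ?e"
      using monom_eq_sum_single[OF _ m] by simp
    then have eq: "Poly_Mapping.single m (1 :: bit) = Poly_Mapping.single ?m 1 * pvar (Suc k) ^ ?e"
      by (simp add: pvar_power mult_single)
    have c: "Poly_Mapping.single ?m 1 \<in> polys k"
      unfolding prod_pvar_power[symmetric] by (intro polys_intros polys_pvar)
    obtain b where b: "\<And>j. b j \<in> polys k"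
      and e: "pvar (Suc k) ^ ?e + (\<Sum>j<n - k. b j * pvar (Suc k) ^ j) \<in> sym_ideal n"
      using sym_ideal_expand_power[OF assms(1)] by blast
    have "Poly_Mapping.single ?m 1 * (pvar (Suc k) ^ ?e + (\<Sum>j<n - k. b j * pvar (Suc k) ^ j)) \<in> sym_ideal n"
      using assms(1) by (intro sym_ideal_mult'[OF e] polys_mono[OF c]) simp
    then show ?case
      unfolding eq using b c
      by (intro exI[of _ "\<lambda>j. Poly_Mapping.single ?m 1 * b j"])
        (simp add: distrib_left sum_distrib_left mult.assoc polys_mult)
  qed
  then show ?thesis using that by blast
qed

section \<open>Duality and uniqueness of normal forms\<close>

lemma top_coeff_small_power:
  assumes "c \<in> polys k" "s < n - Suc k"
  shows "top_coeff n (c * pvar (Suc k) ^ s * costair_prod n (Suc k)) = 0"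
proof (induction c rule: mpoly2_induct)
  case (single m)
  then have m: "Poly_Mapping.keys m \<subseteq> {1..k}" using assms by (auto simp: polys_def)
  let ?t = "\<Sum>i=Suc (Suc k)..n. Poly_Mapping.single i (n - i)"
  let ?m = "m + Poly_Mapping.single (Suc k) s + ?t"
  have eq: "Poly_Mapping.single m 1 * pvar (Suc k) ^ s * costair_prod n (Suc k) = Poly_Mapping.single ?m 1"
    unfolding costair_prod_def pvar_power prod_single_1 mult_single by simp
  have lk: "Poly_Mapping.lookup ?t i = (if i \<in> {Suc (Suc k)..n} then n - i else 0)" for i
    by (rule lookup_sum_single) simp
  \<comment> \<open>The variable x_{n-s} has exponent s in \<open>costair_prod n (Suc k)\<close>,
    the same as x_{k+1} has here, and staircase monomials have distinct exponents.\<close>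
  have ij: "Suc k \<in> {1..n}" "n - s \<in> {1..n}" "Suc k \<noteq> n - s" using assms by auto
  have "Suc k \<notin> {1..k}" "n - s \<notin> {1..k}" using assms by auto
  then have "Poly_Mapping.lookup m (Suc k) = 0" "Poly_Mapping.lookup m (n - s) = 0"
    using m unfolding not_in_keys_iff_lookup_eq_zero[symmetric] by blast+
  then have "Poly_Mapping.lookup ?m (Suc k) = s" "Poly_Mapping.lookup ?m (n - s) = s"
    using assms ij by (auto simp: lookup_add lk lookup_single when_def)
  then have "?m \<notin> stair_monoms n"
    using stair_monoms_lookup_neq[OF ij, of ?m] by auto
  then show ?case unfolding eq by (simp only: top_coeff_single if_False)
qed (simp_all add: distrib_right top_coeff_add)

text \<open>The factor x_{k+1}^{n-k-1-j0} lifts the power j0 to exponent n - k - 1, which completes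
  \<open>costair_prod n (Suc k)\<close> to \<open>costair_prod n k\<close>. Lower powers stay too
  small for \<open>top_coeff_small_power\<close> not to kill them, and the higher coefficients lie
  in the ideal.\<close>

lemma top_coeff_leading:
  assumes k: "k < n" and b: "\<And>j. b j \<in> polys k" and q: "q \<in> polys k"
    and j0: "j0 < n - k" "\<And>j. j0 < j \<Longrightarrow> j < n - k \<Longrightarrow> b j \<in> sym_ideal n"
  shows "top_coeff n ((\<Sum>j<n - k. b j * pvar (Suc k) ^ j)
      * (q * pvar (Suc k) ^ (n - Suc k - j0)) * costair_prod n (Suc k))
    = top_coeff n (b j0 * q * costair_prod n k)" (is "?L = ?R")
proof -
  let ?x = "pvar (Suc k)" and ?C = "costair_prod n (Suc k)"
  let ?F = "\<lambda>j. top_coeff n ((b j * q) * ?x ^ (j + (n - Suc k - j0)) * ?C)"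
  have "?L = (\<Sum>j<n - k. ?F j)"
    unfolding sum_distrib_right top_coeff_sum by (simp add: power_add mult_ac)
  also have "\<dots> = (\<Sum>j\<in>{j0}. ?F j)"
  proof (rule sum.mono_neutral_right)
    show "\<forall>j\<in>{..<n - k} - {j0}. ?F j = 0"
    proof
      fix j assume j: "j \<in> {..<n - k} - {j0}"
      show "?F j = 0"
      proof (cases "j < j0")
        case True
        then show ?thesis using j0 by (intro top_coeff_small_power polys_mult b q) auto
      next
        case False
        then have "b j \<in> sym_ideal n" using j j0 by auto
        then have "(b j * q) * ?x ^ (j + (n - Suc k - j0)) * ?C \<in> sym_ideal n"
          using k by (intro sym_ideal_mult polys_power polys_pvar costair_prod_polys polys_mono[OF q]) auto
        then show ?thesis by (rule top_coeff_sym_ideal)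
      qed
    qed
  qed (use j0 in auto)
  also have "\<dots> = ?R"
    using j0(1) k by (simp add: costair_prod_step mult.assoc)
  finally show ?thesis .
qed

lemma polys_no_vars_cases: "p \<in> polys 0 \<Longrightarrow> p = 0 \<or> p = 1"
proof -
  assume "p \<in> polys 0"
  then have "Poly_Mapping.keys p \<subseteq> {0}" by (auto simp: polys_def)
  moreover have "p = (\<Sum>m\<in>Poly_Mapping.keys p. Poly_Mapping.single m 1)" by (rule mpoly2_eq_sum_keys)
  ultimately show ?thesis by (auto simp: subset_singleton_iff)
qed

text \<open>Poincare duality for the variety of partial flags. In the induction b is expanded by
  powers of x_{k+1}, and the highest coefficient outside the ideal is paired with its dual
  polynomial.\<close>

lemma top_coeff_nondegenerate:
  "k \<le> n \<Longrightarrow> b \<in> polys k \<Longrightarrow> b \<notin> sym_ideal n \<Longrightarrow>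
    \<exists>q\<in>polys k. top_coeff n (b * q * costair_prod n k) \<noteq> 0"
proof (induction k arbitrary: b)
  case 0
  then have "b = 1" using polys_no_vars_cases[of b] by auto
  then show ?case by (intro bexI[of _ 1]) (simp_all add: costair_prod_0 top_coeff_stair_prod)
next
  case (Suc k)
  then have k: "k < n" by simp
  let ?x = "pvar (Suc k)"
  obtain c where c: "\<And>j. c j \<in> polys k" "b + (\<Sum>j<n - k. c j * ?x ^ j) \<in> sym_ideal n"
    using sym_ideal_expand[OF k Suc.prems(2)] by blast
  let ?J = "{j. j < n - k \<and> c j \<notin> sym_ideal n}"
  have "?J \<noteq> {}"
  proof
    assume "?J = {}"
    then have "(\<Sum>j<n - k. c j * ?x ^ j) \<in> sym_ideal n"
      using k by (intro sym_ideal_sum sym_ideal_mult polys_power polys_pvar) auto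
    then show False using c(2) Suc.prems(3) sym_ideal_add_cancel by (metis add.commute)
  qed
  moreover define j0 where "j0 = Max ?J"
  ultimately have "j0 \<in> ?J" using Max_in[of ?J] by simp
  then have j0: "j0 < n - k" "c j0 \<notin> sym_ideal n" by auto
  have j0_max: "c j \<in> sym_ideal n" if "j0 < j" "j < n - k" for j
    using that Max_ge[of ?J j] by (fastforce simp: j0_def)
  obtain q where q: "q \<in> polys k" "top_coeff n (c j0 * q * costair_prod n k) \<noteq> 0"
    using Suc.IH[OF _ c(1) j0(2)] k by auto
  let ?q = "q * ?x ^ (n - Suc k - j0)"
  have "?q \<in> polys (Suc k)" using polys_mono[OF q(1)] by (intro polys_intros polys_pvar) auto
  have "(b + (\<Sum>j<n - k. c j * ?x ^ j)) * ?q * costair_prod n (Suc k) \<in> sym_ideal n"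
    using k polys_mono[OF \<open>?q \<in> polys (Suc k)\<close>]
    by (intro sym_ideal_mult[OF sym_ideal_mult[OF c(2)]] costair_prod_polys) auto
  from top_coeff_sym_ideal[OF this]
  have "top_coeff n (b * ?q * costair_prod n (Suc k))
      = top_coeff n ((\<Sum>j<n - k. c j * ?x ^ j) * ?q * costair_prod n (Suc k))"
    by (simp only: distrib_right top_coeff_add bit_add_eq_0_iff)
  also have "\<dots> = top_coeff n (c j0 * q * costair_prod n k)"
    by (rule top_coeff_leading[OF k c(1) q(1) j0(1) j0_max])
  finally show ?case using q(2) \<open>?q \<in> polys (Suc k)\<close> by (intro bexI[of _ ?q]) simp_all
qed

text \<open>A highest coefficient outside the ideal would be detected by \<open>top_coeff\<close>.
  Together with \<open>sym_ideal_expand\<close> this is freeness on the powers of x_{k+1} below n -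
  k, with the elements of \<open>polys k\<close> in \<open>sym_ideal n\<close> as the relations
  among the first k variables.\<close>

lemma sym_ideal_expand_unique:
  assumes k: "k < n" and b: "\<And>j. b j \<in> polys k"
    and s: "(\<Sum>j<n - k. b j * pvar (Suc k) ^ j) \<in> sym_ideal n" and j: "j < n - k"
  shows "b j \<in> sym_ideal n"
proof (rule ccontr)
  let ?J = "{j. j < n - k \<and> b j \<notin> sym_ideal n}"
  assume "b j \<notin> sym_ideal n"
  then have "j \<in> ?J" using j by simp
  moreover have "finite ?J" by simp
  ultimately have "Max ?J \<in> ?J" using Max_in[of ?J] by blast
  then have j0: "Max ?J < n - k" "b (Max ?J) \<notin> sym_ideal n" by auto
  have j0_max: "b j \<in> sym_ideal n" if "Max ?J < j" "j < n - k" for j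
    using that Max_ge[of ?J j] by fastforce
  obtain q where q: "q \<in> polys k" "top_coeff n (b (Max ?J) * q * costair_prod n k) \<noteq> 0"
    using top_coeff_nondegenerate[OF _ b j0(2)] k by auto
  have "(\<Sum>j<n - k. b j * pvar (Suc k) ^ j) * (q * pvar (Suc k) ^ (n - Suc k - Max ?J))
      * costair_prod n (Suc k) \<in> sym_ideal n"
    using k by (intro sym_ideal_mult s costair_prod_polys polys_intros polys_pvar polys_mono[OF q(1)]) auto
  from top_coeff_sym_ideal[OF this] show False
    using top_coeff_leading[OF k b q(1) j0(1) j0_max] q(2) by simp
qed

section \<open>Cohomology of the two-step flag bundle\<close>

lemma sq2_poly_pvar_power: "sq2_poly (pvar i ^ j) = of_nat j * pvar i ^ Suc j"
proof (induction j)
  case (Suc j)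
  have "sq2_poly (pvar i ^ Suc j) = pvar i ^ Suc (Suc j) + of_nat j * pvar i ^ Suc (Suc j)"
    by (simp add: sq2_poly_mult sq2_poly_pvar Suc.IH power2_eq_square mult_ac)
  also have "\<dots> = of_nat (Suc j) * pvar i ^ Suc (Suc j)"
    by (simp only: of_nat_Suc distrib_right mult_1_left)
  finally show ?case .
qed simp

text \<open>The cross terms in the square of a derivation cancel in characteristic 2, so only powers
  of a variable have to be checked; there the factor is j (j + 1), which is even.\<close>

lemma sq2_poly_sq2_poly [simp]: "sq2_poly (sq2_poly p) = 0"
proof (induction p rule: mpoly2_induct)
  case (single m)
  have mult: "sq2_poly (sq2_poly (p * q)) = 0"
    if "sq2_poly (sq2_poly p) = 0" "sq2_poly (sq2_poly q) = 0" for p q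
    using that by (simp add: sq2_poly_mult sq2_poly_add)
  have pow: "sq2_poly (sq2_poly (pvar i ^ j)) = 0" for i j
    by (simp add: mpoly2_of_nat sq2_poly_pvar_power del: power_Suc)
  have "sq2_poly (sq2_poly (\<Prod>i\<in>A. pvar i ^ Poly_Mapping.lookup m i)) = 0" for A
    by (induction A rule: infinite_finite_induct) (simp_all add: mult pow)
  then show ?case
    unfolding prod_pvar_power by (metis monom_eq_sum_single finite_keys order_refl)
qed (simp_all add: sq2_poly_add)

lemma sum_lessThan_double: "(\<Sum>j<2 * m. f j) = (\<Sum>i<m. f (2 * i) + f (Suc (2 * i)) :: mpoly2)"
  by (induction m) (simp_all add: add.assoc)

text \<open>The plain differential pairs each odd exponent with the next even one and leaves 0 over,
  hence this grouping. The twisted one pairs each even exponent with the next odd one, as in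
  \<open>sum_lessThan_double\<close>.\<close>

lemma sum_lessThan_Suc_double:
  "(\<Sum>j<Suc (2 * m). f j) = f 0 + (\<Sum>i<m. f (Suc (2 * i)) + f (Suc (Suc (2 * i))) :: mpoly2)"
  unfolding sum.lessThan_Suc_shift sum_lessThan_double ..

lemma complete_h_top:
  assumes "n - k = Suc r"
  shows "complete_h r (Suc k) = (\<Sum>j<r. complete_h (r - j) k * pvar (Suc k) ^ j) + pvar (Suc k) ^ r"
  unfolding complete_h_expand by (simp add: lessThan_Suc_atMost[symmetric])

text \<open>The top power x_{k+1}^r is replaced by h_r(x_1..x_{k+1}), which is monic of the same
  degree. The gain is that x_{k+1} h_r is congruent to h_{r+1}(x_1..x_k), in which x_{k+1} does not
  occur, so differentiating this basis element needs no further reduction.\<close>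

lemma sym_ideal_expand_top:
  assumes r: "n - k = Suc r" and z: "z \<in> polys (Suc k)"
  obtains b c where "\<And>j. b j \<in> polys k" "c \<in> polys k"
    "z + ((\<Sum>j<r. b j * pvar (Suc k) ^ j) + c * complete_h r (Suc k)) \<in> sym_ideal n"
proof -
  have k: "k < n" using r by simp
  obtain b where b: "\<And>j. b j \<in> polys k"
    and e: "z + (\<Sum>j<n - k. b j * pvar (Suc k) ^ j) \<in> sym_ideal n"
    using sym_ideal_expand[OF k z] by blast
  have "(\<Sum>j<r. (b j + b r * complete_h (r - j) k) * pvar (Suc k) ^ j) + b r * complete_h r (Suc k)
      = (\<Sum>j<n - k. b j * pvar (Suc k) ^ j)"
    unfolding complete_h_top[OF r] r
    by (simp add: distrib_right distrib_left sum.distrib sum_distrib_left mult.assoc add.assoc)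
  then show ?thesis
    using b e by (intro that[of "\<lambda>j. b j + b r * complete_h (r - j) k" "b r"])
      (simp_all add: polys_add polys_mult)
qed

lemma sym_ideal_expand_top_unique:
  assumes r: "n - k = Suc r" and b: "\<And>j. b j \<in> polys k" "c \<in> polys k"
    and s: "(\<Sum>j<r. b j * pvar (Suc k) ^ j) + c * complete_h r (Suc k) \<in> sym_ideal n"
  shows "c \<in> sym_ideal n" and "j < r \<Longrightarrow> b j \<in> sym_ideal n"
proof -
  have k: "k < n" using r by simp
  define b' where "b' j = (if j < r then b j + c * complete_h (r - j) k else c)" for j
  have "(\<Sum>j<r. b' j * pvar (Suc k) ^ j) = (\<Sum>j<r. (b j + c * complete_h (r - j) k) * pvar (Suc k) ^ j)"
    by (rule sum.cong) (auto simp: b'_def)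
  then have "(\<Sum>j<n - k. b' j * pvar (Suc k) ^ j)
      = (\<Sum>j<r. b j * pvar (Suc k) ^ j) + c * complete_h r (Suc k)"
    unfolding complete_h_top[OF r] r
    by (simp add: b'_def distrib_right distrib_left sum.distrib sum_distrib_left mult.assoc add.assoc)
  then have s': "(\<Sum>j<n - k. b' j * pvar (Suc k) ^ j) \<in> sym_ideal n" using s by simp
  have b': "b' j \<in> polys k" for j using b by (simp add: b'_def polys_add polys_mult)
  have *: "b' j \<in> sym_ideal n" if "j < Suc r" for j
    by (rule sym_ideal_expand_unique[OF k b' s']) (use that r in simp)
  show c: "c \<in> sym_ideal n" using *[of r] by (simp add: b'_def)
  show "b j \<in> sym_ideal n" if "j < r"
  proof -
    have "c * complete_h (r - j) k \<in> sym_ideal n" using k by (intro sym_ideal_mult c) simp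
    then show ?thesis
      using *[of j] that by (simp add: b'_def) (metis add.commute sym_ideal_add_cancel)
  qed
qed

text \<open>The highest exponent 2m is even, so its power has derivative 0: no x^{2m+1} arises, and
  the formula holds exactly and not only modulo the ideal.\<close>

lemma sq2_poly_sum_pvar_odd:
  "sq2_poly (\<Sum>j<Suc (2 * m). b j * pvar i ^ j)
    = (\<Sum>j<Suc (2 * m). (sq2_poly (b j) + (if j = 0 then 0 else of_nat (j - 1) * b (j - 1))) * pvar i ^ j)"
proof -
  have "(\<Sum>j<Suc (2 * m). b j * (of_nat j * pvar i ^ Suc j)) = (\<Sum>j<2 * m. b j * (of_nat j * pvar i ^ Suc j))"
    by (simp add: mpoly2_of_nat)
  also have "\<dots> = (\<Sum>j<Suc (2 * m). (if j = 0 then 0 else of_nat (j - 1) * b (j - 1)) * pvar i ^ j)"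
    unfolding sum.lessThan_Suc_shift by (simp add: mult_ac)
  finally have *: "(\<Sum>j<Suc (2 * m). b j * (of_nat j * pvar i ^ Suc j))
    = (\<Sum>j<Suc (2 * m). (if j = 0 then 0 else of_nat (j - 1) * b (j - 1)) * pvar i ^ j)" .
  show ?thesis
    unfolding sq2_poly_sum sq2_poly_mult sq2_poly_pvar_power distrib_right sum.distrib * ..
qed

lemma sym_ideal_contract_odd:
  assumes k: "k < n" and b: "\<And>j. b j \<in> polys k"
    and g: "\<And>i. i < m \<Longrightarrow> sq2_poly (b (Suc (Suc (2 * i)))) + b (Suc (2 * i)) \<in> sym_ideal n"
  obtains w where "w \<in> polys (Suc k)"
    "(\<Sum>j<Suc (2 * m). b j * pvar (Suc k) ^ j) + b 0 + sq2_poly w \<in> sym_ideal n"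
proof
  let ?x = "pvar (Suc k)"
  \<comment> \<open>Contracting homotopy: x^{2i+1} is a primitive of x^{2i+2}, so the derivative of
    w reproduces the positive even part, and \<open>g\<close> makes its odd part match.\<close>
  define w where "w = (\<Sum>i<m. b (Suc (Suc (2 * i))) * ?x ^ Suc (2 * i))"
  show "w \<in> polys (Suc k)"
    unfolding w_def by (intro polys_intros polys_pvar polys_mono[OF b]) auto
  have "sq2_poly w = (\<Sum>i<m. sq2_poly (b (Suc (Suc (2 * i)))) * ?x ^ Suc (2 * i)
      + b (Suc (Suc (2 * i))) * ?x ^ Suc (Suc (2 * i)))"
    unfolding w_def sq2_poly_sum sq2_poly_mult sq2_poly_pvar_power by (simp add: mpoly2_of_nat)
  then have "(\<Sum>j<Suc (2 * m). b j * ?x ^ j) + b 0 + sq2_poly w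
      = (\<Sum>i<m. (sq2_poly (b (Suc (Suc (2 * i)))) + b (Suc (2 * i))) * ?x ^ Suc (2 * i))"
    unfolding sum_lessThan_Suc_double
    by (simp only: sum.distrib distrib_right power_0 mult_1_right) (simp add: ac_simps)
  also have "\<dots> \<in> sym_ideal n"
    using k by (intro sym_ideal_sum sym_ideal_mult[OF g] polys_power polys_pvar) auto
  finally show "(\<Sum>j<Suc (2 * m). b j * ?x ^ j) + b 0 + sq2_poly w \<in> sym_ideal n" .
qed

lemma sq2_poly_cong_sym_ideal:
  "a + b \<in> sym_ideal n \<Longrightarrow> sq2_poly a \<in> sym_ideal n \<longleftrightarrow> sq2_poly b \<in> sym_ideal n"
  using sq2_poly_sym_ideal[of "a + b" n] sym_ideal_add_cancel[of "sq2_poly a + sq2_poly b" n "sq2_poly b"]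
    sym_ideal_add_cancel[of "sq2_poly a" n "sq2_poly b"]
  by (auto simp: sq2_poly_add sym_ideal_add)

text \<open>Among the 2m + 1 powers of x_{k+1} only 1 remains unpaired. Uniqueness of the expansion
  turns the cycle condition into conditions on the coefficients, and those at positive even
  exponents are what \<open>sym_ideal_contract_odd\<close> requires.\<close>

lemma cycle_odd_rank:
  assumes r: "n - k = Suc (2 * m)" and z: "z \<in> polys (Suc k)" "sq2_poly z \<in> sym_ideal n"
  obtains b w where "b \<in> polys k" "w \<in> polys (Suc k)" "z + b + sq2_poly w \<in> sym_ideal n"
proof -
  have k: "k < n" using r by simp
  let ?x = "pvar (Suc k)"
  obtain b where b: "\<And>j. b j \<in> polys k" and e: "z + (\<Sum>j<n - k. b j * ?x ^ j) \<in> sym_ideal n"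
    using sym_ideal_expand[OF k z(1)] by blast
  let ?g = "\<lambda>j. sq2_poly (b j) + (if j = 0 then 0 else of_nat (j - 1) * b (j - 1))"
  have "(\<Sum>j<n - k. ?g j * ?x ^ j) \<in> sym_ideal n"
    using sq2_poly_cong_sym_ideal[OF e] z(2) unfolding r sq2_poly_sum_pvar_odd by simp
  then have g: "?g j \<in> sym_ideal n" if "j < n - k" for j
    by (rule sym_ideal_expand_unique[OF k, rotated]) (use b that in \<open>simp_all add: polys_add polys_mult polys_sq2_poly\<close>)
  obtain w where w: "w \<in> polys (Suc k)"
    "(\<Sum>j<Suc (2 * m). b j * ?x ^ j) + b 0 + sq2_poly w \<in> sym_ideal n"
  proof (rule sym_ideal_contract_odd[OF k b, of m])
    show "sq2_poly (b (Suc (Suc (2 * i)))) + b (Suc (2 * i)) \<in> sym_ideal n" if "i < m" for i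
      using g[of "Suc (Suc (2 * i))"] that r by (simp add: mpoly2_of_nat)
  qed blast
  have "z + b 0 + sq2_poly w = (z + (\<Sum>j<Suc (2 * m). b j * ?x ^ j))
      + ((\<Sum>j<Suc (2 * m). b j * ?x ^ j) + b 0 + sq2_poly w)"
    by (simp only: add.assoc mpoly2_add_left_self)
  also have "\<dots> \<in> sym_ideal n" using e w(2) unfolding r by (rule sym_ideal_add)
  finally show ?thesis using that b w(1) by blast
qed

text \<open>With 2m + 2 powers the top one is unpaired as well; h_{2m+1} stands in for it, with
  coefficient c. The last two conclusions say that (c0, c) is a cycle of the cone of multiplication
  by h_{2m+2}(x_1..x_k) from the twisted to the plain complex.\<close>

lemma cycle_even_rank:
  assumes r: "n - k = Suc (Suc (2 * m))" and z: "z \<in> polys (Suc k)" "sq2_poly z \<in> sym_ideal n"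
  obtains c0 c w where "c0 \<in> polys k" "c \<in> polys k" "w \<in> polys (Suc k)"
    "z + c0 + c * complete_h (Suc (2 * m)) (Suc k) + sq2_poly w \<in> sym_ideal n"
    "sq2_poly c + complete_h 1 k * c \<in> sym_ideal n"
    "sq2_poly c0 + c * complete_h (Suc (Suc (2 * m))) k \<in> sym_ideal n"
proof -
  have k: "k < n" using r by simp
  let ?x = "pvar (Suc k)" and ?h = "complete_h (Suc (2 * m)) (Suc k)"
  let ?f = "complete_h (Suc (Suc (2 * m))) k" and ?F = "complete_h (Suc (Suc (2 * m))) (Suc k)"
  obtain b c where b: "\<And>j. b j \<in> polys k" and c: "c \<in> polys k"
    and e: "z + ((\<Sum>j<Suc (2 * m). b j * ?x ^ j) + c * ?h) \<in> sym_ideal n"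
    using sym_ideal_expand_top[OF r z(1)] by blast
  let ?g = "\<lambda>j. sq2_poly (b j) + (if j = 0 then c * ?f else of_nat (j - 1) * b (j - 1))"
  let ?Z = "\<Sum>j<Suc (2 * m). b j * ?x ^ j"
  have F: "?F \<in> sym_ideal n" using r by (intro complete_h_sym_ideal) auto
  \<comment> \<open>Hence the derivative of \<open>c * ?h\<close> is, modulo the ideal, a multiple
    of \<open>?h\<close> plus \<open>c * ?f\<close>, and the latter enters the coefficients only at
    exponent 0.\<close>
  have xh: "?x * ?h = ?F + ?f" by (simp add: complete_h_Suc add.assoc[symmetric])
  have "sq2_poly (c * ?h) = sq2_poly c * ?h + c * (complete_h 1 k * ?h + ?x * ?h)"
    by (simp add: sq2_poly_mult sq2_poly_complete_h complete_h_1 mpoly2_of_nat distrib_right)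
  also have "\<dots> = (sq2_poly c + complete_h 1 k * c) * ?h + (c * ?F + c * ?f)"
    unfolding xh by (simp add: algebra_simps)
  finally have dc: "sq2_poly (c * ?h) = (sq2_poly c + complete_h 1 k * c) * ?h + (c * ?F + c * ?f)" .
  have "(\<Sum>j<Suc (2 * m). ?g j * ?x ^ j) = sq2_poly ?Z + c * ?f"
    unfolding sq2_poly_sum_pvar_odd
    by (simp add: sum.lessThan_Suc_shift distrib_right ac_simps del: sum.lessThan_Suc)
  then have "(\<Sum>j<Suc (2 * m). ?g j * ?x ^ j) + (sq2_poly c + complete_h 1 k * c) * ?h
      = sq2_poly (?Z + c * ?h) + c * ?F"
    by (simp only: sq2_poly_add dc) (simp add: ac_simps)
  also have "\<dots> \<in> sym_ideal n"
    using sq2_poly_cong_sym_ideal[OF e] z(2) k polys_mono[OF c]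
    by (intro sym_ideal_add sym_ideal_mult'[OF F]) auto
  finally have s: "(\<Sum>j<Suc (2 * m). ?g j * ?x ^ j) + (sq2_poly c + complete_h 1 k * c) * ?h \<in> sym_ideal n" .
  have gp: "?g j \<in> polys k" for j using b c by (simp add: polys_add polys_mult polys_sq2_poly)
  have cp: "sq2_poly c + complete_h 1 k * c \<in> polys k" using c by (simp add: polys_add polys_mult polys_sq2_poly)
  note u = sym_ideal_expand_top_unique[OF r gp cp s]
  obtain w where w: "w \<in> polys (Suc k)" "?Z + b 0 + sq2_poly w \<in> sym_ideal n"
  proof (rule sym_ideal_contract_odd[OF k b, of m])
    show "sq2_poly (b (Suc (Suc (2 * i)))) + b (Suc (2 * i)) \<in> sym_ideal n" if "i < m" for i
      using u(2)[of "Suc (Suc (2 * i))"] that r by (simp add: mpoly2_of_nat)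
  qed blast
  have "z + b 0 + c * ?h + sq2_poly w = (z + (?Z + c * ?h)) + (?Z + b 0 + sq2_poly w)"
    by (simp add: ac_simps del: sum.lessThan_Suc)
  also have "\<dots> \<in> sym_ideal n" using e w(2) by (rule sym_ideal_add)
  finally have "z + b 0 + c * ?h + sq2_poly w \<in> sym_ideal n" .
  moreover have "sq2_poly (b 0) + c * ?f \<in> sym_ideal n" using u(2)[of 0] by simp
  ultimately show ?thesis using that[OF b c w(1)] u(1) by blast
qed

text \<open>The twisted differential sends x^j to (j + 1) x^{j+1} + e x^j. The highest exponent 2m -
  1 is odd, so again nothing overflows.\<close>

lemma sq2_poly_sum_pvar_even:
  "sq2_poly (\<Sum>j<2 * m. b j * pvar i ^ j) + (e + pvar i) * (\<Sum>j<2 * m. b j * pvar i ^ j)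
    = (\<Sum>j<2 * m. (sq2_poly (b j) + e * b j + (if j = 0 then 0 else of_nat j * b (j - 1))) * pvar i ^ j)"
proof -
  have "(\<Sum>j<2 * m. of_nat (Suc j) * b j * pvar i ^ Suc j)
      = (\<Sum>j<2 * m. (if j = 0 then 0 else of_nat j * b (j - 1)) * pvar i ^ j)"
  proof (cases m)
    case (Suc l)
    have "(\<Sum>j<2 * m. of_nat (Suc j) * b j * pvar i ^ Suc j) = (\<Sum>j<Suc (2 * l). of_nat (Suc j) * b j * pvar i ^ Suc j)"
      by (simp add: Suc mpoly2_of_nat del: of_nat_Suc)
    also have "\<dots> = (\<Sum>j<Suc (Suc (2 * l)). (if j = 0 then 0 else of_nat j * b (j - 1)) * pvar i ^ j)"
      unfolding sum.lessThan_Suc_shift[of _ "Suc (2 * l)"] by simp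
    finally show ?thesis by (simp add: Suc)
  qed simp
  then show ?thesis
    by (simp only: distrib_right sum.distrib sq2_poly_sum sq2_poly_mult sq2_poly_pvar_power
        sum_distrib_left of_nat_Suc mult_1_left) (simp add: sum.distrib ac_simps)
qed

text \<open>The coefficient of \<open>complete_h (2 * a - 1) (Suc (Suc k))\<close> in a cycle is closed for this twisted
  differential and not for \<^const>\<open>sq2_poly\<close>.\<close>

lemma twisted_cycle_odd_rank:
  assumes r: "n - k = Suc (2 * m)" and z: "z \<in> polys (Suc k)"
    "sq2_poly z + complete_h 1 (Suc k) * z \<in> sym_ideal n"
  obtains b w where "b \<in> polys k" "w \<in> polys (Suc k)" "sq2_poly b \<in> sym_ideal n"
    "z + b * complete_h (2 * m) (Suc k) + (sq2_poly w + complete_h 1 (Suc k) * w) \<in> sym_ideal n"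
proof -
  have k: "k < n" using r by simp
  let ?x = "pvar (Suc k)" and ?h = "complete_h (2 * m) (Suc k)" and ?e = "complete_h 1 k"
  let ?F = "complete_h (Suc (2 * m)) (Suc k)"
  have e1: "complete_h 1 (Suc k) = ?e + ?x" by (simp add: complete_h_1)
  have F: "?F \<in> sym_ideal n" using r by (intro complete_h_sym_ideal) auto
  obtain b c where b: "\<And>j. b j \<in> polys k" and c: "c \<in> polys k"
    and e: "z + ((\<Sum>j<2 * m. b j * ?x ^ j) + c * ?h) \<in> sym_ideal n"
    using sym_ideal_expand_top[OF r z(1)] by blast
  let ?Z = "\<Sum>j<2 * m. b j * ?x ^ j"
  let ?g = "\<lambda>j. sq2_poly (b j) + ?e * b j + (if j = 0 then 0 else of_nat j * b (j - 1))"
  \<comment> \<open>The twist cancels the term h_1 h_{2m} in the derivative of \<open>?h\<close>. On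
    multiples of \<open>?h\<close> the twisted differential therefore acts as the plain one on the
    coefficient, which is why c turns out to be an ordinary cycle.\<close>
  have dc: "sq2_poly (c * ?h) + (?e + ?x) * (c * ?h) = sq2_poly c * ?h + c * ?F"
    by (simp add: sq2_poly_mult sq2_poly_complete_h complete_h_1 mpoly2_of_nat algebra_simps)
  let ?s = "z + (?Z + c * ?h)"
  have "(\<Sum>j<2 * m. ?g j * ?x ^ j) + sq2_poly c * ?h
      = (sq2_poly ?Z + (?e + ?x) * ?Z) + (sq2_poly (c * ?h) + (?e + ?x) * (c * ?h)) + c * ?F"
    unfolding dc sq2_poly_sum_pvar_even by (simp only: add.assoc mpoly2_add_self add_0_right)
  also have "\<dots> = (sq2_poly z + (?e + ?x) * z) + (sq2_poly ?s + (?e + ?x) * ?s) + c * ?F"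
    by (simp only: sq2_poly_add distrib_left) (simp add: ac_simps)
  also have "\<dots> \<in> sym_ideal n"
    using k polys_mono[OF c, of n]
    by (intro sym_ideal_add[OF sym_ideal_add[OF z(2)[unfolded e1] sym_ideal_add]]
        sq2_poly_sym_ideal[OF e] sym_ideal_mult'[OF e] sym_ideal_mult'[OF F]) (simp_all add: polys_add)
  finally have s: "(\<Sum>j<2 * m. ?g j * ?x ^ j) + sq2_poly c * ?h \<in> sym_ideal n" .
  have gp: "?g j \<in> polys k" for j using b c by (simp add: polys_add polys_mult polys_sq2_poly)
  note u = sym_ideal_expand_top_unique[OF r gp polys_sq2_poly[OF c] s]
  \<comment> \<open>The twisted differential carries x^{2i} to x^{2i+1}, up to a multiple of x^{2i},
    so w is built from the coefficients at odd exponents.\<close>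
  define w where "w = (\<Sum>i<m. b (Suc (2 * i)) * ?x ^ (2 * i))"
  have wp: "w \<in> polys (Suc k)"
    unfolding w_def by (intro polys_intros polys_pvar polys_mono[OF b]) auto
  have dw: "sq2_poly w + (?e + ?x) * w = (\<Sum>i<m. (sq2_poly (b (Suc (2 * i))) + ?e * b (Suc (2 * i))) * ?x ^ (2 * i)
      + b (Suc (2 * i)) * ?x ^ Suc (2 * i))"
    unfolding w_def sq2_poly_sum sq2_poly_mult sq2_poly_pvar_power sum_distrib_left sum.distrib[symmetric]
    by (rule sum.cong) (simp_all add: mpoly2_of_nat algebra_simps)
  have "?Z + (sq2_poly w + (?e + ?x) * w)
      = (\<Sum>i<m. (sq2_poly (b (Suc (2 * i))) + ?e * b (Suc (2 * i)) + b (2 * i)) * ?x ^ (2 * i))"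
    unfolding sum_lessThan_double dw sum.distrib[symmetric]
    by (rule sum.cong) (simp_all add: algebra_simps)
  also have "\<dots> \<in> sym_ideal n"
  proof (intro sym_ideal_sum sym_ideal_mult polys_power polys_pvar)
    show "sq2_poly (b (Suc (2 * i))) + ?e * b (Suc (2 * i)) + b (2 * i) \<in> sym_ideal n" if "i \<in> {..<m}" for i
      using u(2)[of "Suc (2 * i)"] that by (simp add: mpoly2_of_nat)
  qed (use k in auto)
  finally have "?Z + (sq2_poly w + (?e + ?x) * w) \<in> sym_ideal n" .
  from sym_ideal_add[OF e this]
  have "z + c * ?h + (sq2_poly w + (?e + ?x) * w) \<in> sym_ideal n" by (simp add: ac_simps)
  then show ?thesis using that[OF c wp u(1)] unfolding e1 by blast
qed

section \<open>Combining the plain and the twisted step\<close>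

lemma sq2_poly_complete_h_even: "sq2_poly (complete_h (2 * a) k) = complete_h 1 k * complete_h (2 * a) k + complete_h (Suc (2 * a)) k"
  unfolding sq2_poly_complete_h by (simp add: mpoly2_of_nat)

text \<open>Here h_1 is taken in the first k variables only: by the recursion, the contribution
  x_{k+1} h_{2a-1} of the remaining variable becomes the sum of the two h_{2a}.\<close>

lemma sq2_poly_complete_h_odd:
  assumes "a > 0"
  shows "sq2_poly (complete_h (2 * a - 1) (Suc k))
    = complete_h 1 k * complete_h (2 * a - 1) (Suc k) + (complete_h (2 * a) (Suc k) + complete_h (2 * a) k)"
proof -
  obtain m where m: "a = Suc m" using assms by (cases a) auto
  have "pvar (Suc k) * complete_h (2 * a - 1) (Suc k) = complete_h (2 * a) (Suc k) + complete_h (2 * a) k"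
    by (simp add: m complete_h_Suc add.assoc[symmetric])
  then show ?thesis
    unfolding sq2_poly_complete_h by (simp add: m mpoly2_of_nat complete_h_1 distrib_right)
qed

text \<open>A cycle c0 + c g of the cone has c equal to a multiple b f of the twisted generator up
  to a twisted boundary. Subtracting b T_a and a boundary removes the g-component, and
  \<open>cycle_odd_rank\<close> eliminates x_{k+1} from what is left.\<close>

lemma cycle_step:
  assumes r: "n - k = Suc (2 * a)" and a: "a > 0"
    and u: "u \<in> polys (Suc k)" "sq2_poly u + (complete_h (2 * a) (Suc k))\<^sup>2 \<in> sym_ideal n"
    and z: "z \<in> polys (Suc (Suc k))" "sq2_poly z \<in> sym_ideal n"
  obtains b b' w where "b \<in> polys k" "b' \<in> polys k" "sq2_poly b \<in> sym_ideal n"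
    "sq2_poly b' \<in> sym_ideal n" "w \<in> polys n"
    "z + b' + b * (complete_h (2 * a) (Suc k) * complete_h (2 * a - 1) (Suc (Suc k)) + u) + sq2_poly w
      \<in> sym_ideal n"
proof -
  obtain m where m: "a = Suc m" using a by (cases a) auto
  have r': "n - Suc k = Suc (Suc (2 * m))" and k: "Suc (Suc k) \<le> n" using r m by simp_all
  let ?f = "complete_h (2 * a) (Suc k)"
  let ?g = "complete_h (2 * a - 1) (Suc (Suc k))" and ?e = "complete_h 1 (Suc k)"
  let ?F = "complete_h (2 * a) (Suc (Suc k))" and ?G = "complete_h (Suc (2 * a)) (Suc k)"
  have gm: "?g = complete_h (Suc (2 * m)) (Suc (Suc k))" "?f = complete_h (Suc (Suc (2 * m))) (Suc k)"
    by (simp_all add: m)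
  have F: "?F \<in> sym_ideal n" and G: "?G \<in> sym_ideal n" using r a by (auto intro!: complete_h_sym_ideal)
  obtain c0 c w1 where c: "c0 \<in> polys (Suc k)" "c \<in> polys (Suc k)" "w1 \<in> polys (Suc (Suc k))"
    and e1: "z + c0 + c * ?g + sq2_poly w1 \<in> sym_ideal n"
    and dc: "sq2_poly c + ?e * c \<in> sym_ideal n" and dc0: "sq2_poly c0 + c * ?f \<in> sym_ideal n"
    unfolding gm using cycle_even_rank[OF r' z] by blast
  obtain b w2 where b: "b \<in> polys k" "w2 \<in> polys (Suc k)" "sq2_poly b \<in> sym_ideal n"
    and e2: "c + b * ?f + (sq2_poly w2 + ?e * w2) \<in> sym_ideal n"
    using twisted_cycle_odd_rank[OF r c(2) dc] by blast
  have polys: "c0 \<in> polys n" "c \<in> polys n" "w1 \<in> polys n" "b \<in> polys n" "w2 \<in> polys n" "u \<in> polys n"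
    using c b u k by (auto elim!: polys_mono)
  have fg: "?f \<in> polys n" "?g \<in> polys n" using k by auto
  \<comment> \<open>This is what remains free of \<open>?g\<close> after adding b T_a and the
    derivative of \<open>w2 * ?g\<close> to z: that derivative contributes \<open>w2 * ?f\<close>.
    It is a cycle because the derivative of u cancels the square of \<open>?f\<close>.\<close>
  define z' where "z' = c0 + b * u + w2 * ?f"
  note df = sq2_poly_complete_h_even[of a "Suc k"] and dg = sq2_poly_complete_h_odd[OF a, of "Suc k"]
  have "sq2_poly z' = (sq2_poly c0 + c * ?f) + sq2_poly b * u + b * (sq2_poly u + ?f\<^sup>2)
      + (c + b * ?f + (sq2_poly w2 + ?e * w2)) * ?f + w2 * ?G"
    unfolding z'_def by (simp only: sq2_poly_add sq2_poly_mult df) (simp add: algebra_simps power2_eq_square)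
  also have "\<dots> \<in> sym_ideal n"
    using polys fg by (intro sym_ideal_add dc0 sym_ideal_mult[OF b(3)] sym_ideal_mult'[OF u(2)]
        sym_ideal_mult[OF e2] sym_ideal_mult'[OF G])
  finally have dz': "sq2_poly z' \<in> sym_ideal n" .
  have "z' \<in> polys (Suc k)"
    unfolding z'_def using c u b by (intro polys_intros) (auto elim: polys_mono)
  then obtain b' w3 where b': "b' \<in> polys k" "w3 \<in> polys (Suc k)"
    and e3: "z' + b' + sq2_poly w3 \<in> sym_ideal n"
    using cycle_odd_rank[OF r _ dz'] by blast
  have w3: "w3 \<in> polys n" using b'(2) k by (auto elim: polys_mono)
  from sq2_poly_sym_ideal[OF e3] have db': "sq2_poly b' \<in> sym_ideal n"
    using dz' by (simp add: sq2_poly_add sym_ideal_add_cancel)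
  let ?w = "w1 + w2 * ?g + w3"
  have "z + b' + b * (?f * ?g + u) + sq2_poly ?w
     = (z + c0 + c * ?g + sq2_poly w1) + (c + b * ?f + (sq2_poly w2 + ?e * w2)) * ?g
       + (z' + b' + sq2_poly w3) + w2 * ?F"
    unfolding z'_def by (simp only: sq2_poly_add sq2_poly_mult dg) (simp add: algebra_simps)
  also have "\<dots> \<in> sym_ideal n"
    using polys fg by (intro sym_ideal_add e1 sym_ideal_mult[OF e2] e3 sym_ideal_mult'[OF F])
  finally have "z + b' + b * (?f * ?g + u) + sq2_poly ?w \<in> sym_ideal n" .
  moreover have "?w \<in> polys n" using polys fg w3 by (intro polys_intros)
  ultimately show ?thesis using that b b' db' by blast
qed

section \<open>Cycles, boundaries and the classes \<open>T\<^sub>a\<close>\<close>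

definition monom_eval :: "(nat \<Rightarrow> mpoly2) \<Rightarrow> monom \<Rightarrow> mpoly2" where
  "monom_eval t m = (\<Prod>i\<in>Poly_Mapping.keys m. t i ^ Poly_Mapping.lookup m i)"

definition poly_subst :: "(nat \<Rightarrow> mpoly2) \<Rightarrow> mpoly2 \<Rightarrow> mpoly2" where
  "poly_subst t p = (\<Sum>m\<in>Poly_Mapping.keys p. Poly_Mapping.single 0 (Poly_Mapping.lookup p m) * monom_eval t m)"

lemma monom_eval_superset:
  assumes "finite A" "Poly_Mapping.keys m \<subseteq> A"
  shows "monom_eval t m = (\<Prod>i\<in>A. t i ^ Poly_Mapping.lookup m i)"
  unfolding monom_eval_def by (rule prod.mono_neutral_left) (use assms in \<open>auto simp: in_keys_iff\<close>)

lemma monom_eval_add: "monom_eval t (a + b) = monom_eval t a * monom_eval t b"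
proof -
  let ?A = "Poly_Mapping.keys a \<union> Poly_Mapping.keys b"
  have "monom_eval t m = (\<Prod>i\<in>?A. t i ^ Poly_Mapping.lookup m i)" if "m \<in> {a, b, a + b}" for m
    using that Poly_Mapping.keys_add[of a b] by (intro monom_eval_superset) auto
  then show ?thesis by (simp add: lookup_add power_add prod.distrib)
qed

lemma poly_subst_superset:
  assumes "finite A" "Poly_Mapping.keys p \<subseteq> A"
  shows "poly_subst t p = (\<Sum>m\<in>A. Poly_Mapping.single 0 (Poly_Mapping.lookup p m) * monom_eval t m)"
  unfolding poly_subst_def by (rule sum.mono_neutral_left) (use assms in \<open>auto simp: in_keys_iff\<close>)

lemma poly_subst_0 [simp]: "poly_subst t 0 = 0"
  by (simp add: poly_subst_def)

lemma poly_subst_add: "poly_subst t (p + q) = poly_subst t p + poly_subst t q"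
proof -
  let ?A = "Poly_Mapping.keys p \<union> Poly_Mapping.keys q"
  have "finite ?A" "Poly_Mapping.keys p \<subseteq> ?A" "Poly_Mapping.keys q \<subseteq> ?A"
    "Poly_Mapping.keys (p + q) \<subseteq> ?A"
    using Poly_Mapping.keys_add[of p q] by auto
  then show ?thesis
    by (simp only: poly_subst_superset[of ?A] lookup_add distrib_right single_add sum.distrib)
qed

lemma poly_subst_single: "poly_subst t (Poly_Mapping.single m 1) = monom_eval t m"
  by (simp add: poly_subst_def)

lemma poly_subst_1 [simp]: "poly_subst t 1 = 1"
  using poly_subst_single[of t 0] by (simp add: monom_eval_def)

lemma poly_subst_pvar [simp]: "poly_subst t (pvar i) = t i"
  unfolding pvar_def poly_subst_single by (simp add: monom_eval_def)

lemma poly_subst_mult: "poly_subst t (p * q) = poly_subst t p * poly_subst t q"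
proof (induction p rule: mpoly2_induct)
  case (single m)
  show ?case
    by (induction q rule: mpoly2_induct)
      (simp_all add: distrib_left poly_subst_add mult_single poly_subst_single monom_eval_add)
qed (simp_all add: distrib_right poly_subst_add)

text \<open>Polynomial lifts of the cycles and boundaries of Ch, all degrees together; cosets and
  the grading enter only in the comparison with \<open>E_Fl\<close>.\<close>

definition sq2_cycles :: "nat \<Rightarrow> mpoly2 set" where
  "sq2_cycles n = {p \<in> polys n. sq2_poly p \<in> sym_ideal n}"

definition sq2_bounds :: "nat \<Rightarrow> mpoly2 set" where
  "sq2_bounds n = {p \<in> polys n. \<exists>w\<in>polys n. p + sq2_poly w \<in> sym_ideal n}"

lemma sq2_cyclesI: "p \<in> polys n \<Longrightarrow> sq2_poly p \<in> sym_ideal n \<Longrightarrow> p \<in> sq2_cycles n"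
  by (simp add: sq2_cycles_def)

lemma sq2_cycles_polys: "p \<in> sq2_cycles n \<Longrightarrow> p \<in> polys n"
  by (simp add: sq2_cycles_def)

lemma sq2_cycles_0 [simp]: "0 \<in> sq2_cycles n"
  by (simp add: sq2_cycles_def)

lemma sq2_cycles_1 [simp]: "1 \<in> sq2_cycles n"
  by (simp add: sq2_cycles_def)

lemma sq2_cycles_add: "p \<in> sq2_cycles n \<Longrightarrow> q \<in> sq2_cycles n \<Longrightarrow> p + q \<in> sq2_cycles n"
  by (simp add: sq2_cycles_def polys_add sq2_poly_add sym_ideal_add)

lemma sq2_cycles_mult: "p \<in> sq2_cycles n \<Longrightarrow> q \<in> sq2_cycles n \<Longrightarrow> p * q \<in> sq2_cycles n"
  by (simp add: sq2_cycles_def polys_mult sq2_poly_mult sym_ideal_add sym_ideal_mult sym_ideal_mult')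

lemma sq2_cycles_prod: "(\<And>a. a \<in> A \<Longrightarrow> f a \<in> sq2_cycles n) \<Longrightarrow> prod f A \<in> sq2_cycles n"
  by (induction A rule: infinite_finite_induct) (auto intro: sq2_cycles_mult)

lemma sq2_cycles_power: "p \<in> sq2_cycles n \<Longrightarrow> p ^ e \<in> sq2_cycles n"
  by (induction e) (auto intro: sq2_cycles_mult)

lemma sq2_boundsI: "p \<in> polys n \<Longrightarrow> w \<in> polys n \<Longrightarrow> p + sq2_poly w \<in> sym_ideal n \<Longrightarrow> p \<in> sq2_bounds n"
  by (auto simp: sq2_bounds_def)

lemma sq2_bounds_sym_ideal: "p \<in> sym_ideal n \<Longrightarrow> p \<in> sq2_bounds n"
  by (rule sq2_boundsI[of _ _ 0]) (auto intro: sym_ideal_polys)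

lemma sq2_bounds_0 [simp]: "0 \<in> sq2_bounds n"
  by (simp add: sq2_bounds_sym_ideal)

lemma sq2_bounds_add:
  assumes "p \<in> sq2_bounds n" "q \<in> sq2_bounds n"
  shows "p + q \<in> sq2_bounds n"
proof -
  obtain v w where w: "v \<in> polys n" "w \<in> polys n"
    "p + sq2_poly v \<in> sym_ideal n" "q + sq2_poly w \<in> sym_ideal n"
    using assms unfolding sq2_bounds_def by blast
  have "p + q + sq2_poly (v + w) \<in> sym_ideal n"
    using sym_ideal_add[OF w(3,4)] by (simp add: sq2_poly_add ac_simps)
  then show ?thesis
    using assms w by (intro sq2_boundsI[of _ _ "v + w"]) (auto simp: sq2_bounds_def polys_add)
qed

lemma sq2_bounds_mult:
  assumes "p \<in> sq2_bounds n" "c \<in> sq2_cycles n"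
  shows "p * c \<in> sq2_bounds n"
proof -
  obtain w where w: "w \<in> polys n" "p + sq2_poly w \<in> sym_ideal n"
    using assms unfolding sq2_bounds_def by blast
  have c: "c \<in> polys n" "sq2_poly c \<in> sym_ideal n" using assms by (auto simp: sq2_cycles_def)
  have "p * c + sq2_poly (w * c) = (p + sq2_poly w) * c + w * sq2_poly c"
    by (simp add: sq2_poly_mult algebra_simps)
  also have "\<dots> \<in> sym_ideal n" using w c by (intro sym_ideal_add sym_ideal_mult[OF w(2)] sym_ideal_mult'[OF c(2)])
  finally show ?thesis
    using assms w c by (intro sq2_boundsI[of _ _ "w * c"]) (auto simp: sq2_bounds_def polys_mult)
qed

lemma top_coeff_sq2_bounds: "p \<in> sq2_bounds n \<Longrightarrow> top_coeff n p = 0"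
  unfolding sq2_bounds_def using top_coeff_sym_ideal top_coeff_sq2_poly
  by (fastforce simp: top_coeff_add)

text \<open>Squaring is additive in characteristic 2, which reduces the claim to monomials; positive
  degree provides the variable to split off.\<close>

lemma sq2_bounds_square:
  assumes p: "p \<in> polys n" "homog e p" "e > 0"
  shows "p\<^sup>2 \<in> sq2_bounds n"
proof (induction p rule: mpoly2_induct)
  case (add p q)
  have "(p + q)\<^sup>2 = p\<^sup>2 + q\<^sup>2" by (simp add: power2_eq_square algebra_simps)
  then show ?case using add by (simp add: sq2_bounds_add)
next
  case (single m)
  then have m: "m \<noteq> 0" "Poly_Mapping.keys m \<subseteq> {1..n}" using p by (auto simp: homog_def polys_def)
  then obtain i where i: "i \<in> Poly_Mapping.keys m" by (metis equals0I keys_eq_empty)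
  obtain m' where m': "m = Poly_Mapping.single i 1 + m'" "Poly_Mapping.keys m' \<subseteq> Poly_Mapping.keys m"
    using monom_split[OF i] .
  let ?q = "Poly_Mapping.single m' (1 :: bit)"
  have eq: "Poly_Mapping.single m 1 = pvar i * ?q"
    by (simp add: m'(1) pvar_def mult_single)
  have q: "?q \<in> polys n" "pvar i \<in> polys n" using m m' i by auto
  have "(pvar i * ?q)\<^sup>2 + sq2_poly (pvar i * ?q\<^sup>2) = 0"
    by (simp add: sq2_poly_mult sq2_poly_pvar power2_eq_square algebra_simps)
  then show ?case
    unfolding eq using q by (intro sq2_boundsI[of _ _ "pvar i * ?q\<^sup>2"]) (auto intro: polys_intros)
qed simp

lemma complete_h_one_var: "complete_h d (Suc 0) = pvar (Suc 0) ^ d"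
  by (induction d) (simp_all add: complete_h_Suc)

text \<open>The condition 2 * a < n describes exactly the indices whose class involves u, and
  \<open>u_sq2\<close> is the equation for Sq^2(u) lifted to polynomials.\<close>

locale flag_classes =
  fixes n :: nat and u :: "nat \<Rightarrow> mpoly2"
  assumes u_polys: "\<And>a. 0 < a \<Longrightarrow> 2 * a < n \<Longrightarrow> u a \<in> polys (n - 2 * a)"
    and u_homog: "\<And>a. 0 < a \<Longrightarrow> 2 * a < n \<Longrightarrow> homog (4 * a - 1) (u a)"
    and u_sq2: "\<And>a. 0 < a \<Longrightarrow> 2 * a < n \<Longrightarrow>
      sq2_poly (u a) + (complete_h (2 * a) (n - 2 * a))\<^sup>2 \<in> sym_ideal n"
begin

abbreviation T :: "nat \<Rightarrow> mpoly2" where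
  "T \<equiv> T_poly n u"

text \<open>Writing n - 2 * a as \<open>Suc k\<close> aligns T_a with the step that adjoins x_{k+1}
  and x_{k+2}.\<close>

lemma T_eq:
  assumes "n = Suc k + 2 * a" "a > 0"
  shows "T a = complete_h (2 * a) (Suc k) * complete_h (2 * a - 1) (Suc (Suc k)) + u a"
proof -
  have "\<not> (even n \<and> a = n div 2)" using assms by presburger
  then show ?thesis using assms by (simp only: T_poly_def if_False) simp
qed

lemma T_top: "n = 2 * a \<Longrightarrow> T a = pvar 1 ^ (n - 1)"
  by (simp add: T_poly_def)

lemma T_cases:
  assumes "a \<in> {1..n div 2}"
  obtains k where "n = Suc k + 2 * a" "a > 0" | "n = 2 * a" "a > 0"
proof (cases "n = 2 * a")
  case False
  then have "n = Suc (n - 2 * a - 1) + 2 * a" using assms by auto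
  then show ?thesis using that assms by auto
qed (use that assms in auto)

lemma T_polys: "a \<in> {1..n div 2} \<Longrightarrow> T a \<in> polys n"
proof (erule T_cases)
  fix k assume k: "n = Suc k + 2 * a" "a > 0"
  then have "u a \<in> polys n" using u_polys[of a] by (auto elim: polys_mono)
  then show ?thesis unfolding T_eq[OF k] using k by (intro polys_intros) auto
next
  assume a: "n = 2 * a" "a > 0"
  then show ?thesis unfolding T_top[OF a(1)] by (intro polys_power polys_pvar) auto
qed

lemma T_homog: "a \<in> {1..n div 2} \<Longrightarrow> homog (T_deg n a) (T a)"
proof (erule T_cases)
  fix k assume k: "n = Suc k + 2 * a" "a > 0"
  then have "T_deg n a = 2 * a + (2 * a - 1)" by (auto simp: T_deg_def)
  moreover have "homog (2 * a + (2 * a - 1)) (u a)"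
  proof -
    have "2 * a + (2 * a - 1) = 4 * a - 1" using k(2) by simp
    then show ?thesis using k u_homog[of a] by simp
  qed
  ultimately show ?thesis
    unfolding T_eq[OF k] by (simp add: homog_add homog_mult)
next
  assume a: "n = 2 * a" "a > 0"
  then show ?thesis
    unfolding T_top[OF a(1)] using homog_power[OF homog_pvar, of "n - 1" 1] by (simp add: T_deg_def)
qed

lemma T_deg_pos: "a \<in> {1..n div 2} \<Longrightarrow> T_deg n a > 0"
  by (erule T_cases) (auto simp: T_deg_def)

text \<open>In the derivative of f g the two terms h_1 f g cancel; the term f^2 is absorbed by u,
  and the terms G g and f F lie in the ideal. For T_{n/2} the derivative is x_1^n =
  h_n(x_1).\<close>

lemma sq2_poly_T: "a \<in> {1..n div 2} \<Longrightarrow> sq2_poly (T a) \<in> sym_ideal n"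
proof (erule T_cases)
  fix k assume k: "n = Suc k + 2 * a" "a > 0"
  let ?f = "complete_h (2 * a) (Suc k)" and ?g = "complete_h (2 * a - 1) (Suc (Suc k))"
  let ?F = "complete_h (2 * a) (Suc (Suc k))" and ?G = "complete_h (Suc (2 * a)) (Suc k)"
  have "sq2_poly (T a) = ?G * ?g + ?f * ?F + (sq2_poly (u a) + ?f\<^sup>2)"
    unfolding T_eq[OF k] sq2_poly_add sq2_poly_mult sq2_poly_complete_h_even
      sq2_poly_complete_h_odd[OF k(2)] by (simp add: algebra_simps power2_eq_square)
  also have "\<dots> \<in> sym_ideal n"
  proof (intro sym_ideal_add[OF sym_ideal_add])
    show "sq2_poly (u a) + ?f\<^sup>2 \<in> sym_ideal n" using k u_sq2[of a] by simp
    show "?G * ?g \<in> sym_ideal n" using k by (intro sym_ideal_mult complete_h_sym_ideal) auto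
    show "?f * ?F \<in> sym_ideal n" using k by (intro sym_ideal_mult' complete_h_sym_ideal) auto
  qed
  finally show ?thesis .
next
  assume a: "n = 2 * a" "a > 0"
  then have "odd (n - 1)" "Suc (n - 1) = n" by auto
  then have "sq2_poly (T a) = complete_h n (Suc 0)"
    unfolding T_top[OF a(1)] sq2_poly_pvar_power complete_h_one_var by (simp add: mpoly2_of_nat)
  then show ?thesis using a by (simp add: complete_h_sym_ideal)
qed

lemma T_cycles: "a \<in> {1..n div 2} \<Longrightarrow> T a \<in> sq2_cycles n"
  by (intro sq2_cyclesI T_polys sq2_poly_T)

lemma monom_eval_T_cycles: "Poly_Mapping.keys m \<subseteq> {1..n div 2} \<Longrightarrow> monom_eval T m \<in> sq2_cycles n"
  unfolding monom_eval_def by (intro sq2_cycles_prod sq2_cycles_power T_cycles) auto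

lemma poly_subst_T_cycles:
  assumes "p \<in> polys (n div 2)"
  shows "poly_subst T p \<in> sq2_cycles n"
proof (induction p rule: mpoly2_induct)
  case (single m)
  then have "Poly_Mapping.keys m \<subseteq> {1..n div 2}" using assms unfolding polys_def by blast
  then show ?case unfolding poly_subst_single by (rule monom_eval_T_cycles)
qed (auto simp: poly_subst_add intro: sq2_cycles_add)

text \<open>The parity of n - k is kept by removing two variables at a time, so the descent stops at
  k = 0 for odd n and at k = 1 for even n.\<close>

lemma cycles_generated_partial:
  "odd (n - k) \<Longrightarrow> k < n \<Longrightarrow> z \<in> polys k \<Longrightarrow> sq2_poly z \<in> sym_ideal n \<Longrightarrow>
    \<exists>p\<in>polys (n div 2). z + poly_subst T p \<in> sq2_bounds n"
proof (induction k arbitrary: z rule: less_induct)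
  case (less k)
  have const: "p \<in> polys (n div 2) \<and> poly_subst T p = p" if "p \<in> polys 0" for p
    using polys_no_vars_cases[OF that] by auto
  consider "k = 0" | "k = 1" | k' where "k = Suc (Suc k')" by (metis One_nat_def not0_implies_Suc)
  then show ?case
  proof cases
    case 1
    then show ?thesis using less.prems const[of z] by (intro bexI[of _ z]) auto
  next
    case 2
    with less.prems have "even n" "n \<ge> 2" by (auto elim: oddE)
    then obtain m where m: "n = Suc (Suc (2 * m))" by (auto elim!: evenE) (metis One_nat_def Suc_le_D mult_2 not0_implies_Suc add_Suc_right add_Suc)
    have n: "n - 0 = Suc (Suc (2 * m))" "n div 2 = Suc m" "n = 2 * Suc m" using m by auto
    \<comment> \<open>With no older variables the coefficients are constants: the cohomology of
      P^{n-1} is spanned by 1 and h_{n-1}(x_1) = T_{n/2}.\<close>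
    obtain c0 c w where c: "c0 \<in> polys 0" "c \<in> polys 0" and w: "w \<in> polys (Suc 0)"
      and e: "z + c0 + c * complete_h (Suc (2 * m)) (Suc 0) + sq2_poly w \<in> sym_ideal n"
      using cycle_even_rank[OF n(1), of z] less.prems 2 by (metis One_nat_def)
    have "T (Suc m) = complete_h (Suc (2 * m)) (Suc 0)"
      using T_top[OF n(3)] m by (simp add: complete_h_one_var)
    then have eq: "poly_subst T (c0 + c * pvar (Suc m)) = c0 + c * complete_h (Suc (2 * m)) (Suc 0)"
      using const c by (simp add: poly_subst_add poly_subst_mult)
    have "z + poly_subst T (c0 + c * pvar (Suc m)) + sq2_poly w \<in> sym_ideal n"
      using e unfolding eq by (simp add: add.assoc)
    moreover have p: "c0 + c * pvar (Suc m) \<in> polys (n div 2)"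
      using const[OF c(1)] const[OF c(2)] unfolding n(2) by (intro polys_add polys_mult polys_pvar) auto
    moreover have "z + poly_subst T (c0 + c * pvar (Suc m)) \<in> polys n"
      using less.prems 2
      by (intro polys_add[OF _ sq2_cycles_polys[OF poly_subst_T_cycles[OF p]]]) (auto elim: polys_mono)
    moreover have "w \<in> polys n" using w m by (auto elim: polys_mono)
    ultimately show ?thesis by (meson sq2_boundsI)
  next
    case 3
    \<comment> \<open>The index is forced by n - k' = 2a + 1. Modulo boundaries
      \<open>cycle_step\<close> then writes z as b' + b T_a, where b and b' are cycles in two
      variables fewer.\<close>
    define a where "a = (n - k') div 2"
    have a: "n - k' = Suc (2 * a)" "a > 0" using less.prems 3 by (auto simp: a_def elim!: oddE)
    then have n: "n = Suc k' + 2 * a" using less.prems 3 by auto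
    have am: "a \<in> {1..n div 2}" using n a by auto
    have "u a \<in> polys (Suc k')" "sq2_poly (u a) + (complete_h (2 * a) (Suc k'))\<^sup>2 \<in> sym_ideal n"
      using u_polys[of a] u_sq2[of a] n a by auto
    then obtain b b' w where b: "b \<in> polys k'" "b' \<in> polys k'" "sq2_poly b \<in> sym_ideal n"
      "sq2_poly b' \<in> sym_ideal n" "w \<in> polys n" and e: "z + b' + b * T a + sq2_poly w \<in> sym_ideal n"
      using cycle_step[OF a, of "u a" z] less.prems 3 unfolding T_eq[OF n a(2)] by metis
    have "odd (n - k')" "k' < n" "k' < k" using a 3 by auto
    note IH = less.IH[OF this(3,1,2)]
    obtain p p' where p: "p \<in> polys (n div 2)" "p' \<in> polys (n div 2)"
      and bp: "b + poly_subst T p \<in> sq2_bounds n" "b' + poly_subst T p' \<in> sq2_bounds n"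
      using IH[OF b(1,3)] IH[OF b(2,4)] by blast
    have "z \<in> polys n" "b \<in> polys n" "b' \<in> polys n" "T a \<in> polys n"
      using polys_mono[OF less.prems(3)] polys_mono[OF b(1)] polys_mono[OF b(2)] T_polys[OF am]
        less.prems(2) \<open>k' < n\<close> by simp_all
    then have "z + b' + b * T a \<in> sq2_bounds n"
      using e b by (intro sq2_boundsI[of _ _ w]) (auto intro: polys_intros)
    from sq2_bounds_add[OF sq2_bounds_add[OF this bp(2)] sq2_bounds_mult[OF bp(1) T_cycles[OF am]]]
    have "(z + b' + b * T a) + (b' + poly_subst T p') + (b + poly_subst T p) * T a \<in> sq2_bounds n" .
    also have "(z + b' + b * T a) + (b' + poly_subst T p') + (b + poly_subst T p) * T a
        = z + poly_subst T (p' + p * pvar a)"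
      by (simp add: poly_subst_add poly_subst_mult algebra_simps)
    finally show ?thesis
      using p am by (intro bexI[of _ "p' + p * pvar a"]) (auto intro!: polys_intros)
  qed
qed

lemma cycles_generated:
  assumes n: "n > 0" and z: "z \<in> sq2_cycles n"
  obtains p where "p \<in> polys (n div 2)" "z + poly_subst T p \<in> sq2_bounds n"
proof -
  obtain k where k: "n = Suc k" using n by (cases n) auto
  \<comment> \<open>Only the power 1 of x_n survives modulo the ideal; eliminating x_n leads to k =
    n - 1, where n - k is odd.\<close>
  have r: "n - k = Suc (2 * 0)" using k by simp
  obtain b w where b: "b \<in> polys k" "w \<in> polys (Suc k)" "z + b + sq2_poly w \<in> sym_ideal n"
    using cycle_odd_rank[OF r, of z] z k unfolding sq2_cycles_def by blast
  from sq2_poly_sym_ideal[OF b(3)] have "sq2_poly b \<in> sym_ideal n"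
    using z by (simp add: sq2_poly_add sym_ideal_add_cancel sq2_cycles_def)
  with b obtain p where p: "p \<in> polys (n div 2)" "b + poly_subst T p \<in> sq2_bounds n"
    using cycles_generated_partial[of k b] k by auto
  have "z + b \<in> sq2_bounds n"
    using b z k polys_mono[of b k n] by (intro sq2_boundsI[of _ _ w]) (auto simp: sq2_cycles_def polys_add)
  from sq2_bounds_add[OF this p(2)] show ?thesis
    using p(1) that by (simp add: add.assoc)
qed

text \<open>After multiplication by \<open>stair_prod n k\<close> only x_{k+1}^{2a} is left of f,
  then only x_{k+2}^{2a-1} of the other factor, and these are the next two factors of the
  staircase.\<close>

lemma stair_prod_T:
  assumes n: "n = Suc k + 2 * a" and a: "a > 0"
  shows "stair_prod n k * T a + stair_prod n (Suc (Suc k)) \<in> sym_ideal n"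
proof -
  let ?f = "complete_h (2 * a) (Suc k)" and ?g = "complete_h (2 * a - 1) (Suc (Suc k))"
  have e: "n - Suc k = 2 * a" "n - Suc (Suc k) = 2 * a - 1" using n by auto
  have "stair_prod n k * u a \<in> sym_ideal n"
    \<comment> \<open>The degree is large enough: n - k = 2a + 1 is at most 4a - 1 since a >
      0.\<close>
    using n a u_polys[of a] by (intro stair_prod_mult_homog_Suc[OF _ u_homog[OF a]]) auto
  moreover have "(stair_prod n k * ?f + stair_prod n (Suc k)) * ?g \<in> sym_ideal n"
    using stair_prod_mult_complete_h[of k n "2 * a"] n a unfolding stair_prod_Suc e
    by (intro sym_ideal_mult) auto
  moreover have "stair_prod n (Suc k) * ?g + stair_prod n (Suc (Suc k)) \<in> sym_ideal n"
    using stair_prod_mult_complete_h[of "Suc k" n "2 * a - 1"] n a unfolding stair_prod_Suc[of n "Suc k"] e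
    by auto
  ultimately have "stair_prod n k * u a + (stair_prod n k * ?f + stair_prod n (Suc k)) * ?g
      + (stair_prod n (Suc k) * ?g + stair_prod n (Suc (Suc k))) \<in> sym_ideal n"
    by (intro sym_ideal_add[OF sym_ideal_add])
  then show ?thesis unfolding T_eq[OF n a] by (simp add: algebra_simps)
qed

text \<open>Read from the largest index downwards, each class extends the staircase by two
  variables; for even n the class T_{n/2} = x_1^{n-1} supplies the first factor alone.\<close>

lemma prod_T_stair_prod:
  "j \<le> n div 2 \<Longrightarrow> (\<Prod>a\<in>{Suc j..n div 2}. T a) + stair_prod n (n - 2 * j - 1) \<in> sym_ideal n"
proof (induction "n div 2 - j" arbitrary: j)
  case 0
  \<comment> \<open>For even n the second equation relies on truncated subtraction.\<close>
  then have "j = n div 2" "n - 2 * j - 1 = 0" by auto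
  then show ?case by simp
next
  case (Suc l)
  let ?Q = "\<Prod>a\<in>{Suc (Suc j)..n div 2}. T a"
  have IH: "?Q + stair_prod n (n - 2 * Suc j - 1) \<in> sym_ideal n"
    using Suc.hyps(2) by (intro Suc.hyps(1)) auto
  have Q: "(\<Prod>a\<in>{Suc j..n div 2}. T a) = T (Suc j) * ?Q"
    using Suc by (intro prod.atLeast_Suc_atMost) auto
  have am: "Suc j \<in> {1..n div 2}" using Suc by auto
  then show ?case
  proof (cases rule: T_cases)
    case (1 k)
    then have k: "n - 2 * Suc j - 1 = k" "n - 2 * j - 1 = Suc (Suc k)" by auto
    have "T (Suc j) * (?Q + stair_prod n k) + (stair_prod n k * T (Suc j) + stair_prod n (Suc (Suc k))) \<in> sym_ideal n"
      by (intro sym_ideal_add sym_ideal_mult'[OF IH[unfolded k]] T_polys[OF am] stair_prod_T 1)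
    then show ?thesis unfolding Q k by (simp add: algebra_simps)
  next
    case 2
    then have "?Q = 1" "n - 2 * j - 1 = Suc 0" by auto
    then show ?thesis unfolding Q by (simp add: T_top[OF 2(1)] stair_prod_Suc)
  qed
qed

lemma prod_T_not_bound: "n > 0 \<Longrightarrow> (\<Prod>a\<in>{1..n div 2}. T a) \<notin> sq2_bounds n"
proof
  assume n: "n > 0" and b: "(\<Prod>a\<in>{1..n div 2}. T a) \<in> sq2_bounds n"
  have "stair_prod n n = stair_prod n (n - 1)"
    using n stair_prod_Suc[of n "n - 1"] by simp
  then have "(\<Prod>a\<in>{1..n div 2}. T a) + stair_prod n n \<in> sym_ideal n"
    using prod_T_stair_prod[of 0] by simp
  from top_coeff_sym_ideal[OF this] show False
    using top_coeff_sq2_bounds[OF b] by (simp add: top_coeff_add top_coeff_stair_prod)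
qed

lemma ext_ideal_poly_subst:
  assumes "p \<in> ext_ideal (n div 2)"
  shows "poly_subst T p \<in> sq2_bounds n"
proof (rule poly_ring_ideal_minimal[OF _ assms[unfolded ext_ideal_def]])
  fix s q assume s: "s \<in> {pvar a ^ 2 |a. a \<in> {1..n div 2}}" and q: "q \<in> polys (n div 2)"
  then obtain a where a: "a \<in> {1..n div 2}" "s = pvar a ^ 2" by blast
  have "(T a)\<^sup>2 * poly_subst T q \<in> sq2_bounds n"
    using a q by (intro sq2_bounds_mult sq2_bounds_square[OF T_polys T_homog T_deg_pos] poly_subst_T_cycles)
  then show "poly_subst T (q * s) \<in> sq2_bounds n"
    by (simp add: a(2) power2_eq_square poly_subst_mult mult_ac)
qed (auto simp: poly_subst_add intro: sq2_bounds_add polys_intros)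

end

section \<open>The exterior algebra and its socle\<close>

lemma ext_ideal_ideal: "ideal (ext_ideal m) (poly_ring m)"
proof -
  interpret cring "poly_ring m" by (rule poly_ring_cring)
  show ?thesis unfolding ext_ideal_def
    by (rule genideal_ideal) (auto simp: poly_ring_def intro: polys_power)
qed

lemma ext_ideal_not_squarefree:
  assumes "Poly_Mapping.keys m \<subseteq> {1..k}" "Poly_Mapping.lookup m i \<ge> 2"
  shows "Poly_Mapping.single m 1 \<in> ext_ideal k"
proof -
  interpret R: cring "poly_ring k" by (rule poly_ring_cring)
  have i: "i \<in> {1..k}" using assms by (auto simp: in_keys_iff subset_iff)
  have "{pvar a ^ 2 |a. a \<in> {1..k}} \<subseteq> ext_ideal k"
    unfolding ext_ideal_def by (rule R.genideal_self) (auto simp: poly_ring_def intro: polys_power)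
  then have x: "pvar i ^ 2 \<in> ext_ideal k" using i by blast
  let ?m = "m - Poly_Mapping.single i 2"
  have "m = Poly_Mapping.single i 2 + ?m"
    using assms(2) by (intro poly_mapping_eqI) (auto simp: lookup_add lookup_minus lookup_single when_def)
  then have "Poly_Mapping.single m 1 = pvar i ^ 2 * Poly_Mapping.single ?m 1"
    by (simp add: pvar_power mult_single)
  moreover have "Poly_Mapping.keys ?m \<subseteq> Poly_Mapping.keys m" by (auto simp: in_keys_iff lookup_minus)
  ultimately show ?thesis
    using poly_ring_ideal_mult[OF ext_ideal_ideal x] assms by (metis order.trans polys_single)
qed

text \<open>Multiply by the variables missing from a squarefree monomial of least degree: every other
  monomial then acquires a square.\<close>

lemma ext_ideal_socle:
  assumes p: "p \<in> polys k" "p \<notin> ext_ideal k"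
  obtains q where "q \<in> polys k"
    "q * p + Poly_Mapping.single (\<Sum>i=1..k. Poly_Mapping.single i 1) 1 \<in> ext_ideal k"
proof -
  note I = poly_ring_ideal[OF ext_ideal_ideal[of k]]
  have sum: "sum f A \<in> ext_ideal k" if "\<And>m. m \<in> A \<Longrightarrow> f m \<in> ext_ideal k" for f :: "monom \<Rightarrow> mpoly2" and A
    using that by (induction A rule: infinite_finite_induct) (auto intro: I(1,2))
  define sqf where "sqf m \<longleftrightarrow> (\<forall>i. Poly_Mapping.lookup m i < 2)" for m :: monom
  have keys: "Poly_Mapping.keys m \<subseteq> {1..k}" if "m \<in> Poly_Mapping.keys p" for m
    using p that by (auto simp: polys_def)
  have "\<exists>m\<in>Poly_Mapping.keys p. sqf m"
  proof (rule ccontr)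
    assume "\<not> ?thesis"
    then have "(\<Sum>m\<in>Poly_Mapping.keys p. Poly_Mapping.single m (1 :: bit)) \<in> ext_ideal k"
      by (intro sum) (meson ext_ideal_not_squarefree keys not_less sqf_def)
    then show False using p(2) mpoly2_eq_sum_keys[of p] by simp
  qed
  then obtain m0 where m0: "m0 \<in> Poly_Mapping.keys p" "sqf m0"
    and min: "\<And>m. m \<in> Poly_Mapping.keys p \<Longrightarrow> sqf m \<Longrightarrow> mdeg m0 \<le> mdeg m"
    using ex_has_least_nat[of "\<lambda>m. m \<in> Poly_Mapping.keys p \<and> sqf m" _ mdeg] by blast
  have sqf1: "Poly_Mapping.lookup m i = 1" if "sqf m" "i \<in> Poly_Mapping.keys m" for m i
    using that unfolding sqf_def in_keys_iff by (metis less_2_cases One_nat_def)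
  have mdeg: "mdeg m = card (Poly_Mapping.keys m)" if "sqf m" for m
    unfolding mdeg_def using sqf1[OF that] by simp
  let ?A = "{1..k} - Poly_Mapping.keys m0"
  define c where "c = (\<Sum>i\<in>?A. Poly_Mapping.single i (1 :: nat))"
  have lk: "Poly_Mapping.lookup c i = (if i \<in> ?A then 1 else 0)" for i
    unfolding c_def by (rule lookup_sum_single) simp
  have ck: "Poly_Mapping.keys c \<subseteq> {1..k}" by (auto simp: in_keys_iff lk split: if_splits)
  have full: "c + m0 = (\<Sum>i=1..k. Poly_Mapping.single i 1)"
  proof (rule poly_mapping_eqI)
    fix i
    have "Poly_Mapping.lookup (\<Sum>i=1..k. Poly_Mapping.single i (1 :: nat)) i = (if i \<in> {1..k} then 1 else 0)"
      by (rule lookup_sum_single) simp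
    then show "Poly_Mapping.lookup (c + m0) i = Poly_Mapping.lookup (\<Sum>i=1..k. Poly_Mapping.single i 1) i"
      using subsetD[OF keys[OF m0(1)], of i] sqf1[OF m0(2), of i]
      by (cases "i \<in> Poly_Mapping.keys m0") (auto simp: lookup_add lk not_in_keys_iff_lookup_eq_zero)
  qed
  have other: "Poly_Mapping.single (c + m) 1 \<in> ext_ideal k" if m: "m \<in> Poly_Mapping.keys p - {m0}" for m
  proof -
    have "\<exists>i. Poly_Mapping.lookup (c + m) i \<ge> 2"
    proof (cases "sqf m")
      case True
      \<comment> \<open>A squarefree m with support inside that of m0 would equal m0 by minimality
        of the degree. So m has a variable outside m0, and c contains it too.\<close>
      have "\<not> Poly_Mapping.keys m \<subseteq> Poly_Mapping.keys m0"
      proof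
        assume "Poly_Mapping.keys m \<subseteq> Poly_Mapping.keys m0"
        moreover have "card (Poly_Mapping.keys m0) \<le> card (Poly_Mapping.keys m)"
          using min[of m] True m mdeg m0(2) by auto
        ultimately have eq: "Poly_Mapping.keys m = Poly_Mapping.keys m0" by (simp add: card_seteq)
        have "m = m0"
        proof (rule poly_mapping_eqI)
          fix i show "Poly_Mapping.lookup m i = Poly_Mapping.lookup m0 i"
            using sqf1[OF True, of i] sqf1[OF m0(2), of i] eq
            by (cases "i \<in> Poly_Mapping.keys m") (auto simp: in_keys_iff)
        qed
        then show False using m by simp
      qed
      then obtain i where i: "i \<in> Poly_Mapping.keys m" "i \<notin> Poly_Mapping.keys m0" by blast
      then have "i \<in> ?A" using keys m by blast
      then have "Poly_Mapping.lookup (c + m) i = 2" using sqf1[OF True i(1)] by (simp add: lookup_add lk)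
      then show ?thesis by (intro exI[of _ i]) simp
    next
      case False
      then show ?thesis by (auto simp: sqf_def not_less lookup_add intro: trans_le_add2)
    qed
    moreover have "Poly_Mapping.keys (c + m) \<subseteq> {1..k}"
      using Poly_Mapping.keys_add[of c m] ck keys m by blast
    ultimately show ?thesis using ext_ideal_not_squarefree by blast
  qed
  have "Poly_Mapping.single c 1 * p = (\<Sum>m\<in>Poly_Mapping.keys p. Poly_Mapping.single (c + m) 1)"
    by (subst mpoly2_eq_sum_keys[of p]) (simp add: sum_distrib_left mult_single)
  also have "\<dots> = Poly_Mapping.single (c + m0) 1 + (\<Sum>m\<in>Poly_Mapping.keys p - {m0}. Poly_Mapping.single (c + m) 1)"
    using m0(1) by (simp add: sum.remove)
  finally have "Poly_Mapping.single c 1 * p + Poly_Mapping.single (\<Sum>i=1..k. Poly_Mapping.single i 1) 1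
      = (\<Sum>m\<in>Poly_Mapping.keys p - {m0}. Poly_Mapping.single (c + m) 1)"
    unfolding full by (simp add: add.commute[of "Poly_Mapping.single _ _"] add.assoc)
  also have "\<dots> \<in> ext_ideal k" by (rule sum) (rule other)
  finally show ?thesis using that[of "Poly_Mapping.single c 1"] ck by simp
qed

context flag_classes
begin

text \<open>Every nonzero ideal of the exterior algebra contains the product of all generators. A
  further relation would thus make the product of all T_a a boundary.\<close>

lemma poly_subst_bound_iff:
  assumes n: "n > 0" and p: "p \<in> polys (n div 2)"
  shows "poly_subst T p \<in> sq2_bounds n \<longleftrightarrow> p \<in> ext_ideal (n div 2)"
proof
  assume b: "poly_subst T p \<in> sq2_bounds n"
  show "p \<in> ext_ideal (n div 2)"
  proof (rule ccontr)
    let ?full = "\<Sum>i=1..n div 2. Poly_Mapping.single i (1 :: nat)"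
    assume "p \<notin> ext_ideal (n div 2)"
    then obtain q where q: "q \<in> polys (n div 2)"
      "q * p + Poly_Mapping.single ?full 1 \<in> ext_ideal (n div 2)"
      using ext_ideal_socle[OF p] by blast
    have "poly_subst T (q * p + Poly_Mapping.single ?full 1) + poly_subst T p * poly_subst T q \<in> sq2_bounds n"
      using q by (intro sq2_bounds_add ext_ideal_poly_subst sq2_bounds_mult[OF b] poly_subst_T_cycles)
    moreover have "Poly_Mapping.single ?full 1 = (\<Prod>i=1..n div 2. pvar i ^ 1)"
      by (simp only: prod_pvar_power)
    moreover have "poly_subst T (\<Prod>i\<in>A. pvar i ^ 1) = (\<Prod>i\<in>A. T i)" for A
      by (induction A rule: infinite_finite_induct) (simp_all add: poly_subst_mult)
    ultimately have "(\<Prod>a\<in>{1..n div 2}. T a) \<in> sq2_bounds n"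
      by (simp add: poly_subst_add poly_subst_mult mult.commute add.commute)
    then show False using prod_T_not_bound[OF n] by simp
  qed
qed (rule ext_ideal_poly_subst)

end

section \<open>The graded ring of cohomology classes\<close>

definition hcomp :: "nat \<Rightarrow> mpoly2 \<Rightarrow> mpoly2" where
  "hcomp i p = (\<Sum>m\<in>{m \<in> Poly_Mapping.keys p. mdeg m = i}. Poly_Mapping.single m 1)"

lemma lookup_hcomp: "Poly_Mapping.lookup (hcomp i p) m = (if mdeg m = i then Poly_Mapping.lookup p m else 0)"
proof -
  have "finite {m \<in> Poly_Mapping.keys p. mdeg m = i}" by simp
  then have "Poly_Mapping.lookup (hcomp i p) m = (if m \<in> {m \<in> Poly_Mapping.keys p. mdeg m = i} then 1 else 0)"
    unfolding hcomp_def lookup_sum lookup_single when_def by (rule sum.delta)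
  then show ?thesis by (cases "Poly_Mapping.lookup p m") (auto simp: in_keys_iff)
qed

lemma hcomp_0 [simp]: "hcomp i 0 = 0"
  by (simp add: hcomp_def)

lemma hcomp_add: "hcomp i (p + q) = hcomp i p + hcomp i q"
  by (rule poly_mapping_eqI) (simp add: lookup_hcomp lookup_add)

lemma hcomp_sum: "hcomp i (sum f A) = (\<Sum>a\<in>A. hcomp i (f a))"
  by (induction A rule: infinite_finite_induct) (simp_all add: hcomp_add)

lemma homog_hcomp [simp]: "homog i (hcomp i p)"
  unfolding hcomp_def by (rule homog_sum) (simp add: homog_def)

lemma hcomp_polys: "p \<in> polys n \<Longrightarrow> hcomp i p \<in> polys n"
  unfolding hcomp_def by (intro polys_sum) (auto simp: polys_def)

lemma hcomp_homog: "homog d p \<Longrightarrow> hcomp i p = (if i = d then p else 0)"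
  by (rule poly_mapping_eqI) (auto simp: lookup_hcomp homog_def in_keys_iff)

lemma sum_hcomp:
  assumes "finite A" "mdeg ` Poly_Mapping.keys p \<subseteq> A"
  shows "(\<Sum>i\<in>A. hcomp i p) = p"
proof (rule poly_mapping_eqI)
  fix m
  show "Poly_Mapping.lookup (\<Sum>i\<in>A. hcomp i p) m = Poly_Mapping.lookup p m"
    using assms by (cases "m \<in> Poly_Mapping.keys p")
      (auto simp: lookup_sum lookup_hcomp not_in_keys_iff_lookup_eq_zero)
qed

lemma hcomp_eq_0: "i \<notin> mdeg ` Poly_Mapping.keys p \<Longrightarrow> hcomp i p = 0"
  unfolding hcomp_def by (rule sum.neutral) auto

lemma hcomp_mult: "hcomp k (p * q) = (\<Sum>i\<le>k. hcomp i p * hcomp (k - i) q)"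
proof (induction p rule: mpoly2_induct)
  case (single a)
  show ?case
  proof (induction q rule: mpoly2_induct)
    case (single b)
    have h: "hcomp i (Poly_Mapping.single m 1) = (if mdeg m = i then Poly_Mapping.single m 1 else 0)" for i m
      by (subst hcomp_homog[of "mdeg m"]) (auto simp: homog_def)
    have "(\<Sum>i\<le>k. hcomp i (Poly_Mapping.single a 1) * hcomp (k - i) (Poly_Mapping.single b 1))
        = (\<Sum>i\<in>{mdeg a} \<inter> {..k}. hcomp i (Poly_Mapping.single a 1) * hcomp (k - i) (Poly_Mapping.single b 1))"
      by (rule sum.mono_neutral_right) (auto simp: h)
    then show ?case by (auto simp: mult_single h mdeg_add Int_insert_left)
  qed (simp_all add: distrib_left hcomp_add sum.distrib)
qed (simp_all add: distrib_right hcomp_add sum.distrib)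

lemma hcomp_sq2_poly: "hcomp i (sq2_poly p) = (case i of 0 \<Rightarrow> 0 | Suc j \<Rightarrow> sq2_poly (hcomp j p))"
proof (induction p rule: mpoly2_induct)
  case (single m)
  have "homog (mdeg m) (Poly_Mapping.single m 1)" by (simp add: homog_def)
  from hcomp_homog[OF this] hcomp_homog[OF homog_sq2_poly[OF this]] show ?case
    by (auto split: nat.split)
qed (auto simp: sq2_poly_add hcomp_add split: nat.splits)

text \<open>The generators are homogeneous, hence so is the ideal; this allows cycles and primitives
  to be split by degree.\<close>

lemma hcomp_sym_ideal: "p \<in> sym_ideal n \<Longrightarrow> hcomp i p \<in> sym_ideal n"
proof (induction rule: sym_ideal_induct)
  case (gen s d q)
  have "hcomp j s \<in> sym_ideal n" for j
    using sym_ideal_gen[OF gen(1-4)] hcomp_homog[OF gen(3)] by simp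
  then show ?case
    unfolding hcomp_mult by (intro sym_ideal_sum sym_ideal_mult' hcomp_polys gen)
qed (auto simp: hcomp_add intro: sym_ideal_add)

section \<open>Cosets and quotient rings\<close>

lemma poly_ring_coset: "I +>\<^bsub>poly_ring n\<^esub> p = {s + p | s. s \<in> I}"
  by (auto simp: a_r_coset_def r_coset_def poly_ring_def)

lemma poly_ring_coset_eq_iff:
  assumes I: "ideal I (poly_ring n)"
  shows "I +>\<^bsub>poly_ring n\<^esub> p = I +>\<^bsub>poly_ring n\<^esub> q \<longleftrightarrow> p + q \<in> I"
proof
  assume "I +>\<^bsub>poly_ring n\<^esub> p = I +>\<^bsub>poly_ring n\<^esub> q"
  then have "0 + p \<in> {s + q | s. s \<in> I}"
    unfolding poly_ring_coset using poly_ring_ideal_0[OF I] by blast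
  then obtain s where "s \<in> I" "p = s + q" by auto
  then show "p + q \<in> I" by (simp add: add.assoc)
next
  assume pq: "p + q \<in> I"
  have "{s + p | s. s \<in> I} \<subseteq> {s + q | s. s \<in> I}" if pq: "p + q \<in> I" for p q
  proof
    fix x assume "x \<in> {s + p | s. s \<in> I}"
    then obtain s where s: "s \<in> I" "x = s + p" by blast
    from s(1) pq have "s + (p + q) \<in> I" by (rule poly_ring_ideal_add[OF I])
    moreover have "x = (s + (p + q)) + q" by (simp add: s(2) add.assoc)
    ultimately show "x \<in> {s + q | s. s \<in> I}" by blast
  qed
  from this[of p q] this[of q p] show "I +>\<^bsub>poly_ring n\<^esub> p = I +>\<^bsub>poly_ring n\<^esub> q"
    using pq unfolding poly_ring_coset by (simp add: add.commute)
qed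

lemma poly_ring_quot:
  assumes I: "ideal I (poly_ring n)"
  shows poly_ring_quot_carrier: "carrier (poly_ring n Quot I) = (\<lambda>p. I +>\<^bsub>poly_ring n\<^esub> p) ` polys n"
    and poly_ring_quot_add: "p \<in> polys n \<Longrightarrow> q \<in> polys n \<Longrightarrow>
      (I +>\<^bsub>poly_ring n\<^esub> p) \<oplus>\<^bsub>poly_ring n Quot I\<^esub> (I +>\<^bsub>poly_ring n\<^esub> q) = I +>\<^bsub>poly_ring n\<^esub> (p + q)"
    and poly_ring_quot_mult: "p \<in> polys n \<Longrightarrow> q \<in> polys n \<Longrightarrow>
      (I +>\<^bsub>poly_ring n\<^esub> p) \<otimes>\<^bsub>poly_ring n Quot I\<^esub> (I +>\<^bsub>poly_ring n\<^esub> q) = I +>\<^bsub>poly_ring n\<^esub> (p * q)"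
    and poly_ring_quot_one: "\<one>\<^bsub>poly_ring n Quot I\<^esub> = I +>\<^bsub>poly_ring n\<^esub> 1"
    and poly_ring_quot_zero: "\<zero>\<^bsub>poly_ring n Quot I\<^esub> = I +>\<^bsub>poly_ring n\<^esub> 0"
proof -
  interpret R: cring "poly_ring n" by (rule poly_ring_cring)
  interpret S: ideal I "poly_ring n" by (rule I)
  have c: "carrier (poly_ring n) = polys n" "(\<oplus>\<^bsub>poly_ring n\<^esub>) = (+)" "(\<otimes>\<^bsub>poly_ring n\<^esub>) = (*)"
    "\<one>\<^bsub>poly_ring n\<^esub> = 1" by (simp_all add: poly_ring_def)
  show "carrier (poly_ring n Quot I) = (\<lambda>p. I +>\<^bsub>poly_ring n\<^esub> p) ` polys n"
    unfolding FactRing_def A_RCOSETS_def' c by auto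
  show "\<one>\<^bsub>poly_ring n Quot I\<^esub> = I +>\<^bsub>poly_ring n\<^esub> 1" by (simp add: FactRing_def c)
  show "\<zero>\<^bsub>poly_ring n Quot I\<^esub> = I +>\<^bsub>poly_ring n\<^esub> 0" by (simp add: FactRing_def poly_ring_coset)
  show "(I +>\<^bsub>poly_ring n\<^esub> p) \<oplus>\<^bsub>poly_ring n Quot I\<^esub> (I +>\<^bsub>poly_ring n\<^esub> q) = I +>\<^bsub>poly_ring n\<^esub> (p + q)"
    if "p \<in> polys n" "q \<in> polys n"
    using S.a_rcos_sum[of p q] that by (simp add: FactRing_def c)
  show "(I +>\<^bsub>poly_ring n\<^esub> p) \<otimes>\<^bsub>poly_ring n Quot I\<^esub> (I +>\<^bsub>poly_ring n\<^esub> q) = I +>\<^bsub>poly_ring n\<^esub> (p * q)"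
    if "p \<in> polys n" "q \<in> polys n"
    using S.rcoset_mult_add[of p q] that by (simp add: FactRing_def c)
qed

lemmas cls_eq_iff = poly_ring_coset_eq_iff[OF sym_ideal_ideal, folded cls_def]
lemmas cls_add = poly_ring_quot_add[OF sym_ideal_ideal, folded cls_def Ch_Fl_def]
lemmas cls_mult = poly_ring_quot_mult[OF sym_ideal_ideal, folded cls_def Ch_Fl_def]
lemmas cls_one = poly_ring_quot_one[OF sym_ideal_ideal, folded cls_def Ch_Fl_def]
lemmas cls_zero = poly_ring_quot_zero[OF sym_ideal_ideal, folded cls_def Ch_Fl_def]

lemma cls_eq_zero_iff: "cls n p = \<zero>\<^bsub>Ch_Fl n\<^esub> \<longleftrightarrow> p \<in> sym_ideal n"
  unfolding cls_zero cls_eq_iff by simp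

section \<open>Homogeneous cycles and boundaries\<close>

definition hcycles :: "nat \<Rightarrow> nat \<Rightarrow> mpoly2 set" where
  "hcycles n i = {p \<in> sq2_cycles n. homog i p}"

text \<open>Primitives of degree \<open>i - 1\<close>, where degree \<open>-1\<close> only contains zero.\<close>

definition hprims :: "nat \<Rightarrow> nat \<Rightarrow> mpoly2 set" where
  "hprims n i = {w \<in> polys n. \<forall>m\<in>Poly_Mapping.keys w. Suc (mdeg m) = i}"

abbreviation "cycles_Fl n i \<equiv> cycles (Ch_Fl n) (Ch_Fl_deg n) (sq2 n) i"
abbreviation "bounds_Fl n i \<equiv> boundaries (Ch_Fl n) (Ch_Fl_deg n) (sq2 n) i"
abbreviation "group_Fl n i \<equiv> E_group (Ch_Fl n) (Ch_Fl_deg n) (sq2 n) i"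

lemma hcycles_polys: "p \<in> hcycles n i \<Longrightarrow> p \<in> polys n"
  by (simp add: hcycles_def sq2_cycles_def)

lemma hcycles_0 [simp]: "0 \<in> hcycles n i"
  by (simp add: hcycles_def)

lemma hcycles_add: "p \<in> hcycles n i \<Longrightarrow> q \<in> hcycles n i \<Longrightarrow> p + q \<in> hcycles n i"
  by (simp add: hcycles_def sq2_cycles_add homog_add)

lemma hcycles_mult: "p \<in> hcycles n i \<Longrightarrow> q \<in> hcycles n j \<Longrightarrow> p * q \<in> hcycles n (i + j)"
  by (simp add: hcycles_def sq2_cycles_mult homog_mult)

lemma hcomp_hcycles: "p \<in> sq2_cycles n \<Longrightarrow> hcomp i p \<in> hcycles n i"
  using hcomp_sym_ideal[of "sq2_poly p" n "Suc i"]
  by (simp add: hcycles_def sq2_cycles_def hcomp_polys hcomp_sq2_poly)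

lemma hprims_polys: "w \<in> hprims n i \<Longrightarrow> w \<in> polys n"
  by (simp add: hprims_def)

lemma hprims_0 [simp]: "0 \<in> hprims n i"
  by (simp add: hprims_def)

lemma hprims_nonempty [simp]: "hprims n i \<noteq> {}"
  using hprims_0 by blast

lemma hprims_add: "v \<in> hprims n i \<Longrightarrow> w \<in> hprims n i \<Longrightarrow> v + w \<in> hprims n i"
  using Poly_Mapping.keys_add[of v w] polys_add[of v n w] unfolding hprims_def by blast

lemma hprims_Suc: "hprims n (Suc i) = {w \<in> polys n. homog i w}"
  by (auto simp: hprims_def homog_def)

lemma hprims_0_eq: "hprims n 0 = {0}"
  by (auto simp: hprims_def keys_eq_empty[symmetric] simp del: keys_eq_empty)

lemma hprims_mult: "w \<in> hprims n i \<Longrightarrow> p \<in> polys n \<Longrightarrow> homog j p \<Longrightarrow> w * p \<in> hprims n (i + j)"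
  by (cases i) (auto simp: hprims_Suc hprims_0_eq homog_mult polys_mult)

lemma sq2_poly_hprims: "w \<in> hprims n i \<Longrightarrow> sq2_poly w \<in> hcycles n i"
  by (cases i)
    (auto simp: hprims_Suc hprims_0_eq hcycles_def sq2_cycles_def homog_sq2_poly polys_sq2_poly)

lemma cycles_Fl_eq: "cycles_Fl n i = cls n ` hcycles n i"
proof -
  have "cls n p \<in> cycles_Fl n i" if "p \<in> hcycles n i" for p
    using that by (auto simp: cycles_def Ch_Fl_deg_def sq2_cls cls_eq_zero_iff hcycles_def sq2_cycles_def)
  moreover have "c \<in> cls n ` hcycles n i" if "c \<in> cycles_Fl n i" for c
    using that by (auto simp: cycles_def Ch_Fl_deg_def sq2_cls cls_eq_zero_iff hcycles_def sq2_cycles_def)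
  ultimately show ?thesis by blast
qed

lemma bounds_Fl_eq: "bounds_Fl n i = (\<lambda>w. cls n (sq2_poly w)) ` hprims n i"
proof (cases i)
  case 0
  then show ?thesis by (simp add: boundaries_def hprims_0_eq cls_zero)
next
  case (Suc j)
  then show ?thesis
    unfolding Suc boundaries_def hprims_Suc Ch_Fl_deg_def nat.case image_image
    by (intro image_cong) (auto simp: sq2_cls)
qed

section \<open>The groups of cohomology classes in a fixed degree\<close>

abbreviation cycle_group_Fl :: "nat \<Rightarrow> nat \<Rightarrow> mpoly2 set monoid" where
  "cycle_group_Fl n i \<equiv> \<lparr>carrier = cycles_Fl n i, mult = add (Ch_Fl n), one = \<zero>\<^bsub>Ch_Fl n\<^esub>\<rparr>"

lemma cycle_group_Fl_comm_group: "comm_group (cycle_group_Fl n i)"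
proof (rule comm_groupI)
  fix x assume "x \<in> carrier (cycle_group_Fl n i)"
  then obtain p where "p \<in> hcycles n i" "x = cls n p" by (auto simp: cycles_Fl_eq)
  then show "\<exists>y\<in>carrier (cycle_group_Fl n i). y \<otimes>\<^bsub>cycle_group_Fl n i\<^esub> x = \<one>\<^bsub>cycle_group_Fl n i\<^esub>"
    by (intro bexI[of _ x]) (auto simp: cls_zero cls_add hcycles_polys cycles_Fl_eq)
qed (auto simp: cycles_Fl_eq cls_zero cls_add hcycles_polys hcycles_add polys_add ac_simps)

lemma bounds_Fl_subgroup: "subgroup (bounds_Fl n i) (cycle_group_Fl n i)"
proof -
  interpret G: comm_group "cycle_group_Fl n i" by (rule cycle_group_Fl_comm_group)
  show ?thesis
  proof (rule G.subgroupI)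
    show "bounds_Fl n i \<subseteq> carrier (cycle_group_Fl n i)"
      by (auto simp: bounds_Fl_eq cycles_Fl_eq sq2_poly_hprims)
    show "bounds_Fl n i \<noteq> {}" by (simp add: bounds_Fl_eq)
    fix a assume a: "a \<in> bounds_Fl n i"
    then have "inv\<^bsub>cycle_group_Fl n i\<^esub> a = a"
      by (intro G.inv_equality) (auto simp: bounds_Fl_eq cls_zero cls_add hprims_polys polys_sq2_poly
          cycles_Fl_eq sq2_poly_hprims)
    then show "inv\<^bsub>cycle_group_Fl n i\<^esub> a \<in> bounds_Fl n i" using a by simp
    fix b assume "b \<in> bounds_Fl n i"
    with a show "a \<otimes>\<^bsub>cycle_group_Fl n i\<^esub> b \<in> bounds_Fl n i"
      by (auto simp: bounds_Fl_eq cls_add hprims_polys polys_sq2_poly sq2_poly_add[symmetric] hprims_add)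
  qed
qed

definition E_cls :: "nat \<Rightarrow> nat \<Rightarrow> mpoly2 \<Rightarrow> mpoly2 set set" where
  "E_cls n i p = bounds_Fl n i +>\<^bsub>Ch_Fl n\<^esub> cls n p"

lemma E_cls_eq:
  assumes "p \<in> polys n"
  shows "E_cls n i p = (\<lambda>w. cls n (sq2_poly w + p)) ` hprims n i"
  unfolding E_cls_def a_r_coset_def r_coset_def bounds_Fl_eq
  using assms by (auto simp: cls_add hprims_polys polys_sq2_poly)

lemma E_cls_eq_iff:
  assumes p: "p \<in> polys n" and q: "q \<in> polys n"
  shows "E_cls n i p = E_cls n i q \<longleftrightarrow> (\<exists>w\<in>hprims n i. p + q + sq2_poly w \<in> sym_ideal n)"
proof
  assume "E_cls n i p = E_cls n i q"
  moreover have "cls n (sq2_poly 0 + p) \<in> E_cls n i p"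
    unfolding E_cls_eq[OF p] by (rule imageI) simp
  ultimately obtain w where "w \<in> hprims n i" "cls n p = cls n (sq2_poly w + q)"
    unfolding E_cls_eq[OF q] by auto
  then show "\<exists>w\<in>hprims n i. p + q + sq2_poly w \<in> sym_ideal n"
    unfolding cls_eq_iff by (auto simp: ac_simps)
next
  have sub: "E_cls n i p \<subseteq> E_cls n i q"
    if w: "w \<in> hprims n i" "p + q + sq2_poly w \<in> sym_ideal n" and P: "p \<in> polys n" "q \<in> polys n" for p q w
  proof
    fix x assume "x \<in> E_cls n i p"
    then obtain v where v: "v \<in> hprims n i" "x = cls n (sq2_poly v + p)" using E_cls_eq[OF P(1)] by auto
    have "x = cls n (sq2_poly (v + w) + q)"
      unfolding v(2) cls_eq_iff using w(2) by (simp add: sq2_poly_add ac_simps)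
    then show "x \<in> E_cls n i q" unfolding E_cls_eq[OF P(2)] using hprims_add[OF v(1) w(1)] by blast
  qed
  assume "\<exists>w\<in>hprims n i. p + q + sq2_poly w \<in> sym_ideal n"
  then obtain w where w: "w \<in> hprims n i" "p + q + sq2_poly w \<in> sym_ideal n" by blast
  from sub[OF w p q] sub[OF w(1) _ q p] w(2) show "E_cls n i p = E_cls n i q" by (simp add: add.commute)
qed

lemma E_cls_rcoset: "E_cls n i p = bounds_Fl n i #>\<^bsub>cycle_group_Fl n i\<^esub> cls n p"
  by (simp add: E_cls_def a_r_coset_def r_coset_def)

lemma bounds_Fl_eq_E_cls: "bounds_Fl n i = E_cls n i 0"
  by (simp add: E_cls_eq bounds_Fl_eq)

lemma group_Fl_comm_group: "comm_group (group_Fl n i)"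
  unfolding E_group_def
  by (rule comm_group.abelian_FactGroup[OF cycle_group_Fl_comm_group bounds_Fl_subgroup])

lemma group_Fl_carrier: "carrier (group_Fl n i) = E_cls n i ` hcycles n i"
  unfolding E_group_def carrier_FactGroup by (simp add: cycles_Fl_eq image_image E_cls_rcoset)

lemma group_Fl_one: "\<one>\<^bsub>group_Fl n i\<^esub> = E_cls n i 0"
  unfolding E_group_def one_FactGroup bounds_Fl_eq_E_cls ..

lemma group_Fl_mult:
  assumes "p \<in> hcycles n i" "q \<in> hcycles n i"
  shows "E_cls n i p \<otimes>\<^bsub>group_Fl n i\<^esub> E_cls n i q = E_cls n i (p + q)"
proof -
  interpret G: comm_group "cycle_group_Fl n i" by (rule cycle_group_Fl_comm_group)
  have N: "bounds_Fl n i \<lhd> cycle_group_Fl n i"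
    by (simp add: G.normal_iff_subgroup bounds_Fl_subgroup)
  show ?thesis
    unfolding E_group_def E_cls_rcoset mult_FactGroup
    by (subst normal.rcos_sum[OF N]) (use assms in \<open>auto simp: cycles_Fl_eq cls_add hcycles_polys\<close>)
qed

lemma group_Fl_finprod:
  assumes "finite A" "\<And>a. a \<in> A \<Longrightarrow> f a \<in> hcycles n i"
  shows "finprod (group_Fl n i) (\<lambda>a. E_cls n i (f a)) A = E_cls n i (sum f A)"
proof -
  interpret E: comm_group "group_Fl n i" by (rule group_Fl_comm_group)
  have "sum f A \<in> hcycles n i \<and> ?thesis"
    using assms
  proof (induction A rule: finite_induct)
    case (insert a A)
    then have "(\<lambda>a. E_cls n i (f a)) \<in> A \<rightarrow> carrier (group_Fl n i)" by (auto simp: group_Fl_carrier)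
    with insert show ?case by (auto simp: group_Fl_carrier group_Fl_mult hcycles_add)
  qed (simp add: group_Fl_one)
  then show ?thesis ..
qed

lemma E_cls_mult:
  assumes p: "p \<in> hcycles n i" and q: "q \<in> hcycles n j"
  shows "(\<Union>a\<in>E_cls n i p. \<Union>b\<in>E_cls n j q. bounds_Fl n (i + j) +>\<^bsub>Ch_Fl n\<^esub> (a \<otimes>\<^bsub>Ch_Fl n\<^esub> b))
    = E_cls n (i + j) (p * q)"
proof -
  note P = hcycles_polys[OF p] hcycles_polys[OF q]
  have "bounds_Fl n (i + j) +>\<^bsub>Ch_Fl n\<^esub> (a \<otimes>\<^bsub>Ch_Fl n\<^esub> b) = E_cls n (i + j) (p * q)"
    if ab: "a \<in> E_cls n i p" "b \<in> E_cls n j q" for a b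
  proof -
    obtain v w where v: "v \<in> hprims n i" "a = cls n (sq2_poly v + p)"
      and w: "w \<in> hprims n j" "b = cls n (sq2_poly w + q)"
      using ab unfolding E_cls_eq[OF P(1)] E_cls_eq[OF P(2)] by blast
    let ?a = "sq2_poly v + p" and ?b = "sq2_poly w + q"
    have "?a \<in> polys n" and "?b \<in> polys n"
      using P v w by (auto simp: polys_add polys_sq2_poly hprims_polys)
    have bq: "?b \<in> hcycles n j" using q w by (simp add: hcycles_add sq2_poly_hprims)
    \<comment> \<open>The difference of the two products is dv ?b + p dw. The derivatives of
      \<open>v * ?b\<close> and \<open>w * p\<close> give these two terms up to v dq and w dp, which
      lie in the ideal.\<close>
    let ?x = "v * ?b + w * p"
    have x: "?x \<in> hprims n (i + j)"
      using hprims_mult[OF v(1) \<open>?b \<in> polys n\<close>, of j] hprims_mult[OF w(1) P(1), of i] bq p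
      by (auto simp: hcycles_def add.commute intro!: hprims_add)
    have "?a * ?b + p * q + sq2_poly ?x = v * sq2_poly q + w * sq2_poly p"
      by (simp add: sq2_poly_add sq2_poly_mult algebra_simps)
    also have "\<dots> \<in> sym_ideal n"
      using p q v w by (intro sym_ideal_add sym_ideal_mult') (auto simp: hcycles_def sq2_cycles_def hprims_polys)
    finally have "E_cls n (i + j) (?a * ?b) = E_cls n (i + j) (p * q)"
      using x P \<open>?a \<in> polys n\<close> \<open>?b \<in> polys n\<close> by (subst E_cls_eq_iff) (auto intro: polys_mult)
    then show ?thesis
      using \<open>?a \<in> polys n\<close> \<open>?b \<in> polys n\<close> by (simp add: v(2) w(2) cls_mult E_cls_def)
  qed
  moreover have "E_cls n i p \<noteq> {}" "E_cls n j q \<noteq> {}"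
    by (simp_all add: E_cls_eq P)
  ultimately show ?thesis by auto
qed

section \<open>From polynomial cycles to elements of the graded ring\<close>

definition E_family :: "nat \<Rightarrow> mpoly2 \<Rightarrow> nat \<Rightarrow> mpoly2 set set" where
  "E_family n p i = E_cls n i (hcomp i p)"

lemma E_Fl_carrier:
  "carrier (E_Fl n) = {x. (\<forall>i. x i \<in> E_cls n i ` hcycles n i) \<and> finite {i. x i \<noteq> E_cls n i 0}}"
proof -
  have "group (group_Fl n i)" for i using group_Fl_comm_group by (rule comm_group.axioms(2))
  then show ?thesis
    by (simp add: E_ring_def carrier_sum_group group_Fl_carrier group_Fl_one PiE_UNIV_domain Pi_def)
qed

lemma E_Fl_add: "x \<oplus>\<^bsub>E_Fl n\<^esub> y = (\<lambda>i. x i \<otimes>\<^bsub>group_Fl n i\<^esub> y i)"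
  by (simp add: E_ring_def restrict_def)

lemma E_family_carrier: "p \<in> sq2_cycles n \<Longrightarrow> E_family n p \<in> carrier (E_Fl n)"
proof -
  assume p: "p \<in> sq2_cycles n"
  have "{i. E_family n p i \<noteq> E_cls n i 0} \<subseteq> mdeg ` Poly_Mapping.keys p"
    using hcomp_eq_0[of _ p] by (force simp: E_family_def)
  then have "finite {i. E_family n p i \<noteq> E_cls n i 0}" by (rule finite_subset) simp
  then show ?thesis unfolding E_Fl_carrier by (auto simp: E_family_def hcomp_hcycles[OF p])
qed

lemma E_family_add:
  "p \<in> sq2_cycles n \<Longrightarrow> q \<in> sq2_cycles n \<Longrightarrow> E_family n (p + q) = E_family n p \<oplus>\<^bsub>E_Fl n\<^esub> E_family n q"
  by (simp add: E_Fl_add E_family_def fun_eq_iff group_Fl_mult hcomp_hcycles hcomp_add)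

lemma E_family_mult:
  assumes p: "p \<in> sq2_cycles n" and q: "q \<in> sq2_cycles n"
  shows "E_family n (p * q) = E_family n p \<otimes>\<^bsub>E_Fl n\<^esub> E_family n q"
proof
  fix k
  have "(E_family n p \<otimes>\<^bsub>E_Fl n\<^esub> E_family n q) k = finprod (group_Fl n k)
       (\<lambda>i. \<Union>a\<in>E_cls n i (hcomp i p). \<Union>b\<in>E_cls n (k - i) (hcomp (k - i) q).
         bounds_Fl n k +>\<^bsub>Ch_Fl n\<^esub> (a \<otimes>\<^bsub>Ch_Fl n\<^esub> b)) {..k}"
    by (simp add: E_ring_def E_family_def)
  also have "\<dots> = finprod (group_Fl n k) (\<lambda>i. E_cls n k (hcomp i p * hcomp (k - i) q)) {..k}"
  proof (rule comm_monoid.finprod_cong'[OF comm_group.axioms(1)[OF group_Fl_comm_group] refl])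
    have *: "hcomp i p * hcomp (k - i) q \<in> hcycles n k" if "i \<le> k" for i
      using hcycles_mult[OF hcomp_hcycles[OF p, of i] hcomp_hcycles[OF q, of "k - i"]] that by simp
    then show "(\<lambda>i. E_cls n k (hcomp i p * hcomp (k - i) q)) \<in> {..k} \<rightarrow> carrier (group_Fl n k)"
      by (auto simp: group_Fl_carrier)
    fix i assume i: "i \<in> {..k}"
    then show "(\<Union>a\<in>E_cls n i (hcomp i p). \<Union>b\<in>E_cls n (k - i) (hcomp (k - i) q).
         bounds_Fl n k +>\<^bsub>Ch_Fl n\<^esub> (a \<otimes>\<^bsub>Ch_Fl n\<^esub> b)) = E_cls n k (hcomp i p * hcomp (k - i) q)"
      using E_cls_mult[OF hcomp_hcycles[OF p, of i] hcomp_hcycles[OF q, of "k - i"]] by simp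
  qed
  also have "\<dots> = E_cls n k (hcomp k (p * q))"
  proof (subst group_Fl_finprod)
    show "hcomp i p * hcomp (k - i) q \<in> hcycles n k" if "i \<in> {..k}" for i
      using hcycles_mult[OF hcomp_hcycles[OF p, of i] hcomp_hcycles[OF q, of "k - i"]] that by simp
  qed (simp_all add: hcomp_mult)
  finally show "E_family n (p * q) k = (E_family n p \<otimes>\<^bsub>E_Fl n\<^esub> E_family n q) k"
    by (simp add: E_family_def)
qed

lemma E_family_homog:
  assumes "homog d p"
  shows "E_family n p = E_Fl_class n d p"
  using hcomp_homog[OF assms]
  by (auto simp: fun_eq_iff E_family_def E_class_def bounds_Fl_eq_E_cls[symmetric]) (simp_all add: E_cls_def)

lemma E_family_one: "E_family n 1 = \<one>\<^bsub>E_Fl n\<^esub>"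
  by (simp add: E_family_homog[OF homog_1] E_ring_def cls_one)

text \<open>Only finitely many degrees occur, so primitives chosen degree by degree add up to one;
  conversely a primitive is split into its homogeneous components.\<close>

lemma E_family_eq_iff:
  assumes p: "p \<in> sq2_cycles n" and q: "q \<in> sq2_cycles n"
  shows "E_family n p = E_family n q \<longleftrightarrow> p + q \<in> sq2_bounds n"
proof -
  note P = sq2_cycles_polys[OF p] sq2_cycles_polys[OF q]
  have "E_family n p = E_family n q \<longleftrightarrow> (\<forall>i. \<exists>w\<in>hprims n i. hcomp i (p + q) + sq2_poly w \<in> sym_ideal n)"
    unfolding fun_eq_iff E_family_def by (simp add: E_cls_eq_iff hcomp_polys P hcomp_add)
  also have "\<dots> \<longleftrightarrow> p + q \<in> sq2_bounds n"
  proof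
    assume "\<forall>i. \<exists>w\<in>hprims n i. hcomp i (p + q) + sq2_poly w \<in> sym_ideal n"
    then obtain w where w: "\<And>i. w i \<in> hprims n i" "\<And>i. hcomp i (p + q) + sq2_poly (w i) \<in> sym_ideal n"
      by metis
    let ?A = "mdeg ` Poly_Mapping.keys (p + q)"
    have "(\<Sum>i\<in>?A. hcomp i (p + q) + sq2_poly (w i)) \<in> sym_ideal n" by (intro sym_ideal_sum w)
    then have "p + q + sq2_poly (\<Sum>i\<in>?A. w i) \<in> sym_ideal n"
      by (simp only: sum.distrib sq2_poly_sum sum_hcomp finite_imageI finite_keys order_refl)
    then show "p + q \<in> sq2_bounds n"
      using P w(1) by (intro sq2_boundsI[of _ _ "\<Sum>i\<in>?A. w i"]) (auto intro: polys_add polys_sum hprims_polys)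
  next
    assume "p + q \<in> sq2_bounds n"
    then obtain w where w: "w \<in> polys n" "p + q + sq2_poly w \<in> sym_ideal n" by (auto simp: sq2_bounds_def)
    show "\<forall>i. \<exists>w\<in>hprims n i. hcomp i (p + q) + sq2_poly w \<in> sym_ideal n"
    proof
      fix i
      \<comment> \<open>The derivation raises degrees by one, so degree i takes the component of w
        in degree i - 1, and degree 0 takes none.\<close>
      let ?w = "case i of 0 \<Rightarrow> 0 | Suc j \<Rightarrow> hcomp j w"
      have "hcomp i (p + q) + sq2_poly ?w \<in> sym_ideal n"
        using hcomp_sym_ideal[OF w(2), of i] by (cases i) (auto simp: hcomp_add hcomp_sq2_poly)
      moreover have "?w \<in> hprims n i" using w(1) by (cases i) (auto simp: hprims_Suc hcomp_polys)
      ultimately show "\<exists>w\<in>hprims n i. hcomp i (p + q) + sq2_poly w \<in> sym_ideal n" by blast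
    qed
  qed
  finally show ?thesis .
qed

lemma E_family_surj:
  assumes "x \<in> carrier (E_Fl n)"
  obtains p where "p \<in> sq2_cycles n" "x = E_family n p"
proof -
  let ?F = "{i. x i \<noteq> E_cls n i 0}"
  have F: "finite ?F" and "\<forall>i. \<exists>c\<in>hcycles n i. x i = E_cls n i c" using assms unfolding E_Fl_carrier by auto
  then obtain c where c: "\<And>i. c i \<in> hcycles n i" "\<And>i. x i = E_cls n i (c i)" by metis
  define p where "p = (\<Sum>i\<in>?F. c i)"
  have "p \<in> sq2_cycles n"
    unfolding p_def using F by (induction rule: finite_induct)
      (use c(1) in \<open>auto simp: hcycles_def intro: sq2_cycles_add\<close>)
  moreover have "x i = E_family n p i" for i
  proof -
    have "hcomp i p = (\<Sum>j\<in>?F. if i = j then c j else 0)"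
      unfolding p_def hcomp_sum using c(1) by (intro sum.cong) (auto simp: hcycles_def hcomp_homog)
    also have "\<dots> = (if i \<in> ?F then c i else 0)" using F by (simp only: sum.delta')
    finally have "hcomp i p = (if i \<in> ?F then c i else 0)" .
    then show ?thesis using c(2)[of i] by (auto simp: E_family_def)
  qed
  ultimately show ?thesis using that by blast
qed

context flag_classes
begin

text \<open>Substituting the T_a for the generators induces the map:
  \<open>poly_subst_bound_iff\<close> makes it both well defined and injective, and
  \<open>cycles_generated\<close> makes it surjective.\<close>

lemma ext_alg_iso_E_Fl:
  assumes n: "n > 0"
  shows "\<exists>\<phi>\<in>ring_iso (ext_alg (n div 2)) (E_Fl n).
    \<forall>a\<in>{1..n div 2}. \<phi> (ext_gen (n div 2) a) = E_Fl_class n (T_deg n a) (T a)"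
proof -
  let ?m = "n div 2"
  let ?c = "\<lambda>p. ext_ideal ?m +>\<^bsub>poly_ring ?m\<^esub> p"
  define \<psi> where "\<psi> p = E_family n (poly_subst T p)" for p
  have \<psi>_eq: "\<psi> p = \<psi> q \<longleftrightarrow> ?c p = ?c q" if "p \<in> polys ?m" "q \<in> polys ?m" for p q
    unfolding \<psi>_def poly_ring_coset_eq_iff[OF ext_ideal_ideal]
    using that by (simp add: E_family_eq_iff poly_subst_T_cycles poly_subst_add[symmetric]
        poly_subst_bound_iff[OF n] polys_add)
  define \<phi> where "\<phi> X = \<psi> (SOME p. p \<in> polys ?m \<and> ?c p = X)" for X
  have \<phi>: "\<phi> (?c p) = \<psi> p" if p: "p \<in> polys ?m" for p
  proof -
    have "(SOME q. q \<in> polys ?m \<and> ?c q = ?c p) \<in> polys ?m \<and> ?c (SOME q. q \<in> polys ?m \<and> ?c q = ?c p) = ?c p"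
      by (rule someI[of "\<lambda>q. q \<in> polys ?m \<and> ?c q = ?c p" p]) (use p in simp)
    then show ?thesis unfolding \<phi>_def using \<psi>_eq p by blast
  qed
  note quot = poly_ring_quot[OF ext_ideal_ideal[of ?m], folded ext_alg_def]
  have "\<phi> \<in> ring_hom (ext_alg ?m) (E_Fl n)"
  proof (rule ring_hom_memI)
    fix X assume "X \<in> carrier (ext_alg ?m)"
    then obtain p where p: "p \<in> polys ?m" "X = ?c p" unfolding quot(1) by blast
    then show "\<phi> X \<in> carrier (E_Fl n)"
      by (simp add: \<phi>) (simp add: \<psi>_def E_family_carrier poly_subst_T_cycles)
    fix Y assume "Y \<in> carrier (ext_alg ?m)"
    then obtain q where q: "q \<in> polys ?m" "Y = ?c q" unfolding quot(1) by blast
    show "\<phi> (X \<otimes>\<^bsub>ext_alg ?m\<^esub> Y) = \<phi> X \<otimes>\<^bsub>E_Fl n\<^esub> \<phi> Y"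
      unfolding p(2) q(2) quot(3)[OF p(1) q(1)] \<phi>[OF p(1)] \<phi>[OF q(1)] \<phi>[OF polys_mult[OF p(1) q(1)]]
      unfolding \<psi>_def poly_subst_mult by (intro E_family_mult poly_subst_T_cycles p q)
    show "\<phi> (X \<oplus>\<^bsub>ext_alg ?m\<^esub> Y) = \<phi> X \<oplus>\<^bsub>E_Fl n\<^esub> \<phi> Y"
      unfolding p(2) q(2) quot(2)[OF p(1) q(1)] \<phi>[OF p(1)] \<phi>[OF q(1)] \<phi>[OF polys_add[OF p(1) q(1)]]
      unfolding \<psi>_def poly_subst_add by (intro E_family_add poly_subst_T_cycles p q)
  next
    show "\<phi> \<one>\<^bsub>ext_alg ?m\<^esub> = \<one>\<^bsub>E_Fl n\<^esub>"
      unfolding quot(4) \<phi>[OF polys_1] by (simp only: \<psi>_def poly_subst_1 E_family_one)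
  qed
  moreover have "bij_betw \<phi> (carrier (ext_alg ?m)) (carrier (E_Fl n))"
  proof (rule bij_betw_imageI)
    show "inj_on \<phi> (carrier (ext_alg ?m))"
      unfolding quot(1) inj_on_def using \<phi> \<psi>_eq by auto
    show "\<phi> ` carrier (ext_alg ?m) = carrier (E_Fl n)"
    proof
      show "\<phi> ` carrier (ext_alg ?m) \<subseteq> carrier (E_Fl n)"
        unfolding quot(1) by (auto simp: \<phi> \<psi>_def E_family_carrier poly_subst_T_cycles)
      show "carrier (E_Fl n) \<subseteq> \<phi> ` carrier (ext_alg ?m)"
      proof
        fix x assume "x \<in> carrier (E_Fl n)"
        then obtain z where z: "z \<in> sq2_cycles n" "x = E_family n z" by (rule E_family_surj)
        obtain p where p: "p \<in> polys ?m" "z + poly_subst T p \<in> sq2_bounds n"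
          using cycles_generated[OF n z(1)] .
        then have "x = \<phi> (?c p)"
          using z by (simp add: \<phi>) (simp add: \<psi>_def E_family_eq_iff poly_subst_T_cycles)
        then show "x \<in> \<phi> ` carrier (ext_alg ?m)" unfolding quot(1) using p(1) by blast
      qed
    qed
  qed
  moreover have "\<phi> (ext_gen ?m a) = E_Fl_class n (T_deg n a) (T a)" if a: "a \<in> {1..?m}" for a
    unfolding ext_gen_def using a
    by (simp add: \<phi> del: atLeastAtMost_iff) (simp add: \<psi>_def E_family_homog[OF T_homog])
  ultimately show ?thesis unfolding ring_iso_def by blast
qed

end

theorem proposition1p5:
  fixes n :: nat and u :: "nat \<Rightarrow> mpoly2"
  assumes "n \<ge> 1"
    and "\<And>a. 1 \<le> a \<Longrightarrow> a \<le> n div 2 \<Longrightarrow> odd n \<or> (even n \<and> a < n div 2) \<Longrightarrow>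
      u a \<in> polys (n - 2*a) \<and> homog (4*a - 1) (u a) \<and>
      sq2 n (cls n (u a)) = cls n ((complete_h (2*a) (n - 2*a))^2)"
  shows "(\<forall>a\<in>{1..n div 2}.
            cls n (T_poly n u a) \<in> cycles (Ch_Fl n) (Ch_Fl_deg n) (sq2 n) (T_deg n a)) \<and>
         (\<exists>\<phi>\<in>ring_iso (ext_alg (n div 2)) (E_Fl n).
            \<forall>a\<in>{1..n div 2}.
              \<phi> (ext_gen (n div 2) a) = E_Fl_class n (T_deg n a) (T_poly n u a))"
proof -
  have u: "u a \<in> polys (n - 2 * a)" "homog (4 * a - 1) (u a)"
    "sq2_poly (u a) + (complete_h (2 * a) (n - 2 * a))\<^sup>2 \<in> sym_ideal n"
    if a: "0 < a" "2 * a < n" for a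
  proof -
    \<comment> \<open>The range of indices in the hypothesis on u is 0 < 2 * a < n, the form that
      the locale uses.\<close>
    have "1 \<le> a" "a \<le> n div 2" "odd n \<or> (even n \<and> a < n div 2)" using a by (auto elim!: evenE)
    from assms(2)[OF this] show *: "u a \<in> polys (n - 2 * a)" "homog (4 * a - 1) (u a)"
      and "sq2_poly (u a) + (complete_h (2 * a) (n - 2 * a))\<^sup>2 \<in> sym_ideal n"
      using polys_mono[of "u a" "n - 2 * a" n] by (auto simp: sq2_cls cls_eq_iff)
  qed
  interpret flag_classes n u by unfold_locales (fact u)+
  have "cls n (T a) \<in> cycles_Fl n (T_deg n a)" if "a \<in> {1..n div 2}" for a
    unfolding cycles_Fl_eq hcycles_def using T_cycles[OF that] T_homog[OF that] by blast
  then show ?thesis using ext_alg_iso_E_Fl assms(1) by auto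
qed

end
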